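(* Let $N>2$ and let $G$ be a finite simple graph with $V\ge N+1$ vertices. Consider the SU($N$) Hubbard model on $G$ in the limit $U\to+\infty$ with exactly one hole, i.e. the operator $H_\infty=P\big(\sum_{i,j}\sum_{\alpha=1}^N t_{ij}c^\dagger_{i\alpha}c_{j\alpha}\big)P$ on the space $\mathcal H_1^{(N)}$ defined in the context. Suppose that $G$ is non-separable, $G$ is not the $\theta_0$-graph, $G$ is not a polygon with $V\ge4$ vertices, and, if $G$ is bipartite, additionally $V\ge N+2$. Then the connectivity condition holds in every sector of fixed flavor occupation numbers, and the ground state of $H_\infty$ lies in the fully symmetric (one-row Young diagram) irreducible representation of SU($N$) and is unique up to the SU($N$) degeneracy, i.e. the ground space is a single copy of this irreducible representation.
   Context: Vertices of $G$ are $1,\dots,V$; $t_{ij}=t_{ji}>0$ if $\{i,j\}$ is an edge and $t_{ij}=0$ otherwise. The SU($N$) Hubbard Hamiltonian is $H=\sum_{i,j}\sum_{\alpha=1}^N t_{ij}c^\dagger_{i\alpha}c_{j\alpha}+\frac U2\sum_i n_i(n_i-1)$, where $c_{i\alpha}$ are fermion operators for $N$-component fermions (fundamental representation of SU($N$)) and $n_i=\sum_\alpha c^\dagger_{i\alpha}c_{i\alpha}$. $\mathcal H_1^{(N)}$ is the space spanned by states with exactly $V-1$ fermions and at most one fermion per vertex; $P$ is the orthogonal projection onto it. Basis: $|h,\alpha\rangle=(-1)^h\prod_{i\ne h}c^\dagger_{i,\alpha_i}|0\rangle$ (product in increasing order of $i$), with $h$ the hole position and $\alpha_i\in\{1,\dots,N\}$.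 A sector of fixed flavor occupation numbers is the span of basis states with prescribed numbers $m_1,\dots,m_N\ge 0$ ($\sum m_\alpha=V-1$) of fermions of each flavor. Connectivity condition in a sector: for any two basis states $b,b'$ in it there exists $n\ge 1$ with $\langle b'|H_\infty^n|b\rangle\ne0$. A graph is non-separable if it is connected and remains connected after deleting any single vertex with its incident edges. A polygon with $V$ vertices is the cycle graph $C_V$. The $\theta_0$-graph is the graph on 7 vertices consisting of a hexagon (6-cycle) $a_1a_2a_3a_4a_5a_6$ together with one extra vertex $b$ adjacent exactly to the two opposite hexagon vertices $a_1$ and $a_4$. *)

theory Defs
  imports Complex_Main "HOL-Combinatorics.Permutations"
begin

section \<open>Graphs on the vertex set {1..V}\<close>

text \<open>A finite simple graph on vertices 1..V is given by a symmetric irreflexive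
  adjacency relation E (only its values on {1..V} matter).\<close>

definition simple_graph :: "nat \<Rightarrow> (nat \<Rightarrow> nat \<Rightarrow> bool) \<Rightarrow> bool" where
  "simple_graph V E \<longleftrightarrow>
     (\<forall>i\<in>{1..V}. \<forall>j\<in>{1..V}. E i j = E j i) \<and> (\<forall>i\<in>{1..V}. \<not> E i i)"

definition edges_in :: "(nat \<Rightarrow> nat \<Rightarrow> bool) \<Rightarrow> nat set \<Rightarrow> (nat \<times> nat) set" where
  "edges_in E W = {(i, j). i \<in> W \<and> j \<in> W \<and> E i j}"

definition connected_on :: "(nat \<Rightarrow> nat \<Rightarrow> bool) \<Rightarrow> nat set \<Rightarrow> bool" where
  "connected_on E W \<longleftrightarrow> (\<forall>i\<in>W. \<forall>j\<in>W. (i, j) \<in> (edges_in E W)\<^sup>*)"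

text \<open>Non-separable: connected, and connected after deleting any single vertex.\<close>
definition non_separable :: "nat \<Rightarrow> (nat \<Rightarrow> nat \<Rightarrow> bool) \<Rightarrow> bool" where
  "non_separable V E \<longleftrightarrow>
     connected_on E {1..V} \<and> (\<forall>v\<in>{1..V}. connected_on E ({1..V} - {v}))"

definition bipartite :: "nat \<Rightarrow> (nat \<Rightarrow> nat \<Rightarrow> bool) \<Rightarrow> bool" where
  "bipartite V E \<longleftrightarrow> (\<exists>c :: nat \<Rightarrow> bool. \<forall>i\<in>{1..V}. \<forall>j\<in>{1..V}. E i j \<longrightarrow> c i \<noteq> c j)"

text \<open>Graph isomorphism onto a model graph on vertices {0..<n}.\<close>
definition iso_to :: "nat \<Rightarrow> (nat \<Rightarrow> nat \<Rightarrow> bool) \<Rightarrow> nat \<Rightarrow> (nat \<Rightarrow> nat \<Rightarrow> bool) \<Rightarrow> bool" where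
  "iso_to V E n F \<longleftrightarrow> (\<exists>f. bij_betw f {1..V} {0..<n} \<and>
      (\<forall>i\<in>{1..V}. \<forall>j\<in>{1..V}. E i j \<longleftrightarrow> F (f i) (f j)))"

text \<open>Cycle graph C_n on {0..<n}.\<close>
definition cycle_adj :: "nat \<Rightarrow> nat \<Rightarrow> nat \<Rightarrow> bool" where
  "cycle_adj n a b \<longleftrightarrow> b = (a + 1) mod n \<or> a = (b + 1) mod n"

definition is_polygon :: "nat \<Rightarrow> (nat \<Rightarrow> nat \<Rightarrow> bool) \<Rightarrow> bool" where
  "is_polygon V E \<longleftrightarrow> iso_to V E V (cycle_adj V)"

text \<open>theta_0 graph: hexagon a1..a6 = 0..5, extra vertex b = 6 adjacent to a1 = 0 and a4 = 3.\<close>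
definition theta0_adj :: "nat \<Rightarrow> nat \<Rightarrow> bool" where
  "theta0_adj a b \<longleftrightarrow>
     (a < 6 \<and> b < 6 \<and> cycle_adj 6 a b) \<or>
     (a = 6 \<and> (b = 0 \<or> b = 3)) \<or> (b = 6 \<and> (a = 0 \<or> a = 3))"

definition is_theta0 :: "nat \<Rightarrow> (nat \<Rightarrow> nat \<Rightarrow> bool) \<Rightarrow> bool" where
  "is_theta0 V E \<longleftrightarrow> iso_to V E 7 theta0_adj"

section \<open>Fermionic Fock space\<close>

text \<open>Modes are pairs (i, alpha), i in {1..V}, alpha in {1..N}. A Fock basis state is a finite
  set S of occupied modes, standing for the product of creation operators in increasing
  (lexicographic) mode order applied to the vacuum. A vector is a function from sets of modes
  to complex amplitudes.\<close>

type_synonym mode = "nat \<times> nat"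
type_synonym fvec = "mode set \<Rightarrow> complex"

definition modes :: "nat \<Rightarrow> nat \<Rightarrow> mode set" where
  "modes V N = {1..V} \<times> {1..N}"

definition mode_less :: "mode \<Rightarrow> mode \<Rightarrow> bool" where
  "mode_less m m' \<longleftrightarrow> fst m < fst m' \<or> (fst m = fst m' \<and> snd m < snd m')"

definition fsign :: "mode \<Rightarrow> mode set \<Rightarrow> complex" where
  "fsign m S = (-1) ^ card {m' \<in> S. mode_less m' m}"

text \<open>Creation and annihilation operators c^dagger_m and c_m.\<close>
definition cdag :: "mode \<Rightarrow> fvec \<Rightarrow> fvec" where
  "cdag m \<psi> = (\<lambda>S. if m \<in> S then fsign m S * \<psi> (S - {m}) else 0)"

definition cann :: "mode \<Rightarrow> fvec \<Rightarrow> fvec" where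
  "cann m \<psi> = (\<lambda>S. if m \<notin> S then fsign m S * \<psi> (insert m S) else 0)"

definition inner :: "nat \<Rightarrow> nat \<Rightarrow> fvec \<Rightarrow> fvec \<Rightarrow> complex" where
  "inner V N \<phi> \<psi> = (\<Sum>S\<in>Pow (modes V N). cnj (\<phi> S) * \<psi> S)"

text \<open>Hopping part  sum_{i,j} sum_alpha t_ij c^dagger_{i alpha} c_{j alpha}.\<close>
definition hopping :: "nat \<Rightarrow> nat \<Rightarrow> (nat \<Rightarrow> nat \<Rightarrow> real) \<Rightarrow> fvec \<Rightarrow> fvec" where
  "hopping V N t \<psi> = (\<lambda>S. \<Sum>i\<in>{1..V}. \<Sum>j\<in>{1..V}. \<Sum>a\<in>{1..N}.
       complex_of_real (t i j) * cdag (i, a) (cann (j, a) \<psi>) S)"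

text \<open>Fock basis states spanning H_1^(N): V-1 fermions, at most one per vertex.\<close>
definition in_H1 :: "nat \<Rightarrow> nat \<Rightarrow> mode set \<Rightarrow> bool" where
  "in_H1 V N S \<longleftrightarrow> S \<subseteq> modes V N \<and> card S = V - 1 \<and>
      (\<forall>i. card {a. (i, a) \<in> S} \<le> 1)"

definition H1 :: "nat \<Rightarrow> nat \<Rightarrow> fvec set" where
  "H1 V N = {\<psi>. \<forall>S. \<psi> S \<noteq> 0 \<longrightarrow> in_H1 V N S}"

text \<open>Orthogonal projection P onto H_1^(N) (spanned by Fock basis states).\<close>
definition projP :: "nat \<Rightarrow> nat \<Rightarrow> fvec \<Rightarrow> fvec" where
  "projP V N \<psi> = (\<lambda>S. if in_H1 V N S then \<psi> S else 0)"

definition Hinf :: "nat \<Rightarrow> nat \<Rightarrow> (nat \<Rightarrow> nat \<Rightarrow> real) \<Rightarrow> fvec \<Rightarrow> fvec" where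
  "Hinf V N t \<psi> = projP V N (hopping V N t (projP V N \<psi>))"

text \<open>Basis states |h, alpha> = (-1)^h prod_{i \<noteq> h} c^dagger_{i, alpha_i} |0>.\<close>
definition valid_config :: "nat \<Rightarrow> nat \<Rightarrow> nat \<Rightarrow> (nat \<Rightarrow> nat) \<Rightarrow> bool" where
  "valid_config V N h \<alpha> \<longleftrightarrow> h \<in> {1..V} \<and> (\<forall>i\<in>{1..V} - {h}. \<alpha> i \<in> {1..N})"

definition hole_state :: "nat \<Rightarrow> nat \<Rightarrow> (nat \<Rightarrow> nat) \<Rightarrow> fvec" where
  "hole_state V h \<alpha> = (\<lambda>S. if S = (\<lambda>i. (i, \<alpha> i)) ` ({1..V} - {h}) then (-1) ^ h else 0)"

definition flavor_count :: "nat \<Rightarrow> nat \<Rightarrow> (nat \<Rightarrow> nat) \<Rightarrow> nat \<Rightarrow> nat" where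
  "flavor_count V h \<alpha> b = card {i \<in> {1..V} - {h}. \<alpha> i = b}"

definition in_sector :: "nat \<Rightarrow> nat \<Rightarrow> (nat \<Rightarrow> nat) \<Rightarrow> nat \<Rightarrow> (nat \<Rightarrow> nat) \<Rightarrow> bool" where
  "in_sector V N m h \<alpha> \<longleftrightarrow> valid_config V N h \<alpha> \<and> (\<forall>b\<in>{1..N}. flavor_count V h \<alpha> b = m b)"

text \<open>Connectivity condition in the sector with flavor occupation numbers m.\<close>
definition connectivity :: "nat \<Rightarrow> nat \<Rightarrow> (nat \<Rightarrow> nat \<Rightarrow> real) \<Rightarrow> (nat \<Rightarrow> nat) \<Rightarrow> bool" where
  "connectivity V N t m \<longleftrightarrow>
     (\<forall>h \<alpha> h' \<alpha>'. in_sector V N m h \<alpha> \<longrightarrow> in_sector V N m h' \<alpha>' \<longrightarrow>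
        (\<exists>n\<ge>1. inner V N (hole_state V h' \<alpha>') ((Hinf V N t ^^ n) (hole_state V h \<alpha>)) \<noteq> 0))"

section \<open>Ground states\<close>

definition ground_energy :: "nat \<Rightarrow> nat \<Rightarrow> (nat \<Rightarrow> nat \<Rightarrow> real) \<Rightarrow> real \<Rightarrow> bool" where
  "ground_energy V N t E0 \<longleftrightarrow>
     (\<exists>\<psi>\<in>H1 V N. (\<exists>S. \<psi> S \<noteq> 0) \<and> Hinf V N t \<psi> = (\<lambda>S. complex_of_real E0 * \<psi> S)) \<and>
     (\<forall>\<psi>\<in>H1 V N. \<forall>E. (\<exists>S. \<psi> S \<noteq> 0) \<and> Hinf V N t \<psi> = (\<lambda>S. E * \<psi> S) \<longrightarrow> E0 \<le> Re E)"

definition ground_space :: "nat \<Rightarrow> nat \<Rightarrow> (nat \<Rightarrow> nat \<Rightarrow> real) \<Rightarrow> real \<Rightarrow> fvec set" where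
  "ground_space V N t E0 =
     {\<psi> \<in> H1 V N. Hinf V N t \<psi> = (\<lambda>S. complex_of_real E0 * \<psi> S)}"

section \<open>SU(N) symmetry\<close>

text \<open>SU(N) generators on Fock space: S^{alpha beta} = sum_i c^dagger_{i alpha} c_{i beta}.\<close>
definition su_gen :: "nat \<Rightarrow> nat \<Rightarrow> nat \<Rightarrow> fvec \<Rightarrow> fvec" where
  "su_gen V a b \<psi> = (\<lambda>S. \<Sum>i\<in>{1..V}. cdag (i, a) (cann (i, b) \<psi>) S)"

text \<open>The fully symmetric (one-row Young diagram with M boxes) irreducible representation:
  symmetric tensors in (C^N)^{\<otimes> M}, i.e. functions on words w : {0..<M} \<rightarrow> {1..N}
  invariant under permutations of positions, with the matrix unit E_{alpha beta}
  (e_beta \<mapsto> e_alpha) acting on each tensor factor.\<close>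
definition words :: "nat \<Rightarrow> nat \<Rightarrow> (nat \<Rightarrow> nat) set" where
  "words N M = {w. (\<forall>p<M. w p \<in> {1..N}) \<and> (\<forall>p\<ge>M. w p = 0)}"

definition sym_space :: "nat \<Rightarrow> nat \<Rightarrow> ((nat \<Rightarrow> nat) \<Rightarrow> complex) set" where
  "sym_space N M = {f. (\<forall>w. f w \<noteq> 0 \<longrightarrow> w \<in> words N M) \<and>
                      (\<forall>w \<sigma>. \<sigma> permutes {0..<M} \<longrightarrow> f (w \<circ> \<sigma>) = f w)}"

definition sym_gen :: "nat \<Rightarrow> nat \<Rightarrow> nat \<Rightarrow> ((nat \<Rightarrow> nat) \<Rightarrow> complex) \<Rightarrow> ((nat \<Rightarrow> nat) \<Rightarrow> complex)" where
  "sym_gen M a b f = (\<lambda>w. \<Sum>p<M. if w p = a then f (w(p := b)) else 0)"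

text \<open>A subspace W of Fock space is, as a representation of SU(N) (via its generators),
  isomorphic to the fully symmetric irreducible representation with M boxes.\<close>
definition iso_to_symmetric_irrep :: "nat \<Rightarrow> nat \<Rightarrow> nat \<Rightarrow> fvec set \<Rightarrow> bool" where
  "iso_to_symmetric_irrep V N M W \<longleftrightarrow>
     (\<exists>\<Phi>. bij_betw \<Phi> (sym_space N M) W \<and>
        (\<forall>f\<in>sym_space N M. \<forall>g\<in>sym_space N M. \<forall>c::complex.
            \<Phi> (\<lambda>w. c * f w + g w) = (\<lambda>S. c * \<Phi> f S + \<Phi> g S)) \<and>
        (\<forall>a\<in>{1..N}. \<forall>b\<in>{1..N}. \<forall>f\<in>sym_space N M.
            \<Phi> (sym_gen M a b f) = su_gen V a b (\<Phi> f)))"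

end

theory Submission
  imports Defs "HOL-Combinatorics.Cycles" "HOL-Analysis.Function_Topology"
begin

text \<open>
  In the basis \<open>|h, \<alpha>\<rangle>\<close> every hop of the hole across an edge has matrix element \<open>- t i j\<close>, so \<open>- H\<^sub>\<infinity>\<close>
  is a nonnegative matrix, and connectivity of a sector means that any labelling of the vertices
  can be turned into any other one by sliding the hole along a walk. That is Wilson's theorem on
  graph puzzles, proved as follows. Call two vertices linked if some 3-cycle realised by a closed
  walk of the hole moves one to the other; this is an equivalence relation invariant under all closed walks,
  and if everything is linked then all even permutations occur. A theta subgraph (two vertices
  joined by three paths) is fully linked unless it is \<open>\<theta>\<^sub>0\<close>: the commutator of two of its cycles
  is a 3-cycle or a double transposition, from which a 3-cycle is extracted. Attaching an ear keeps
  everything linked, and \<open>\<theta>\<^sub>0\<close> together with any ear contains another theta graph. Odd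
  permutations come from an odd closed walk, or are harmless because two fermions share a flavor.

  For the ground states let \<open>\<phi> > 0\<close> be the Perron vector of \<open>t\<close> with eigenvalue \<open>l\<close>. If \<open>f\<close> is a
  symmetric tensor, \<open>(h, \<alpha>) \<mapsto> \<phi> h * f \<alpha>\<close> is an eigenvector with eigenvalue \<open>- l\<close>; the maximum
  principle applied to the quotient of an eigenvector by \<open>\<phi>\<close> shows that no eigenvalue is lower and,
  by connectivity, that there are no other ground states.
\<close>

section \<open>Permutation groups and 3-cycles\<close>

text \<open>A link controls two points of a 3-cycle and leaves the third one open, because a pair is
  easily transported by walks and by powers of a cycle; \<open>three_cycle_of_linked\<close>
  prescribes the third point afterwards. Links are relative to the position of the hole, which
  carries no label, and are moved between positions by conjugation; so an ear can always be attached
  with the hole parked at one of its ends.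

  The exceptional graphs are genuine obstacles. On a polygon the closed walks of the hole merely
  rotate the labels. On theta_0 they generate a group of order 120 that is sharply 3-transitive on
  six points and hence contains no 3-cycle. On a bipartite graph every closed walk has an even
  number of steps, so odd permutations are out of reach; the bound \<open>N + 2\<close> enters
  through the pigeonhole principle, which provides two fermions of the same flavor.

  The Perron vector lives on the graph and not on the configurations: a symmetric tensor depends
  only on letter counts, and a hop preserves these.\<close>

lemma distinct_cycle_nth:
  assumes "distinct cs" "i < length cs"
  shows "(cycle_of_list cs ^^ n) (cs ! i) = cs ! ((i + n) mod length cs)"
proof -
  have "(cycle_of_list cs ^^ n) (cs ! i) = map (cycle_of_list cs ^^ n) cs ! i"
    using assms by simp
  also have "\<dots> = rotate n cs ! i" by (simp only: cyclic_rotation[OF assms(1)])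
  also have "\<dots> = cs ! ((i + n) mod length cs)"
    using assms(2) by (simp add: nth_rotate add.commute)
  finally show ?thesis .
qed

lemma cycle_transitive:
  assumes "distinct cs" "u \<in> set cs" "v \<in> set cs"
  obtains n where "(cycle_of_list cs ^^ n) u = v"
proof -
  obtain i j where ij: "i < length cs" "cs ! i = u" "j < length cs" "cs ! j = v"
    using assms by (metis in_set_conv_nth)
  have "(i + (length cs - i + j)) mod length cs = j"
    using ij by simp
  then have "(cycle_of_list cs ^^ (length cs - i + j)) u = v"
    using distinct_cycle_nth[OF assms(1) ij(1)] ij by metis
  then show thesis by (rule that)
qed

lemma bij_cycle_of_list: "bij (cycle_of_list cs)"
  by (rule permutes_bij[OF cycle_permutes])

text \<open>The shared point \<open>z\<close> lets the transpositions of the two pieces follow each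
  other without a gap, so joining walks of the hole becomes composition. The lists may contain
  repetitions.\<close>

lemma cycle_of_list_append:
  "cycle_of_list (xs @ z # ys) = cycle_of_list (xs @ [z]) \<circ> cycle_of_list (z # ys)"
proof (induction xs)
  case (Cons a xs)
  then show ?case by (cases xs) (auto simp: fun_eq_iff)
qed simp

text \<open>Reversal puts the transpositions, each its own inverse, into the opposite order. A walk
  run backwards thus gives the inverse permutation.\<close>

lemma cycle_of_list_comp_rev: "cycle_of_list xs \<circ> cycle_of_list (rev xs) = id"
proof (induction xs rule: cycle_of_list.induct)
  case (1 i j cs)
  have "cycle_of_list (rev (i # j # cs)) = cycle_of_list (rev (j # cs)) \<circ> transpose j i"
    using cycle_of_list_append[of "rev cs" j "[i]"] by simp
  then have "cycle_of_list (i # j # cs) \<circ> cycle_of_list (rev (i # j # cs)) =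
      transpose i j \<circ> (cycle_of_list (j # cs) \<circ> cycle_of_list (rev (j # cs))) \<circ> transpose j i"
    by (simp add: comp_assoc)
  also have "\<dots> = id"
    unfolding 1 by (simp add: fun_eq_iff transpose_commute[of j i])
  finally show ?case .
qed simp_all

lemma inv_cycle_of_list: "inv (cycle_of_list xs) = cycle_of_list (rev xs)"
  using cycle_of_list_comp_rev[of xs] cycle_of_list_comp_rev[of "rev xs"]
  by (intro inv_unique_comp) simp_all

lemma cycle_of_list_last: "xs \<noteq> [] \<Longrightarrow> cycle_of_list xs (last xs) = hd xs"
  by (induction xs rule: cycle_of_list.induct) auto

text \<open>If \<open>p\<close> runs from \<open>a\<close> to \<open>z\<close>, its cycle sends
  \<open>z\<close> to \<open>a\<close> and fixes \<open>x\<close>; moving the closing transposition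
  \<open>(z x)\<close> to its left turns it into \<open>(a x)\<close>, which cancels the opening
  step. Around a cycle of the graph the labels are therefore rotated by one place.\<close>

lemma cycle_of_list_closed_walk:
  assumes "distinct (x # p)"
  shows "cycle_of_list (x # p @ [x]) = cycle_of_list p"
proof (cases p rule: rev_cases)
  case Nil
  then show ?thesis by (simp add: fun_eq_iff)
next
  case (snoc q z)
  then obtain a r where p: "p = a # r" by (metis list.exhaust snoc_eq_iff_butlast)
  have rot: "cycle_of_list p z = a"
    using cycle_of_list_last[of p] snoc p by (metis last_snoc list.discI list.sel(1))
  have fix_x: "cycle_of_list p x = x"
    using assms by (intro id_outside_supp) simp
  have "cycle_of_list (x # p @ [x]) = transpose x a \<circ> cycle_of_list (p @ [x])"
    using p by simp
  also have "cycle_of_list (p @ [x]) = cycle_of_list p \<circ> transpose z x"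
    using cycle_of_list_append[of q z "[x]"] snoc by simp
  also have "\<dots> = transpose a x \<circ> cycle_of_list p"
  proof
    fix y
    have "cycle_of_list p y = a \<longleftrightarrow> y = z" "cycle_of_list p y = x \<longleftrightarrow> y = x"
      using bij_is_inj[OF bij_cycle_of_list[of p]] rot fix_x by (metis injD)+
    then show "(cycle_of_list p \<circ> transpose z x) y = (transpose a x \<circ> cycle_of_list p) y"
      using rot fix_x by (simp add: transpose_def)
  qed
  finally show ?thesis
    by (simp add: fun_eq_iff transpose_commute[of a x])
qed

text \<open>Neighbouring entries differ, so each of the \<open>length w - 1\<close> steps is a
  genuine transposition.\<close>

lemma evenperm_cycle_of_list:
  assumes "successively (\<noteq>) w" "w \<noteq> []"
  shows "evenperm (cycle_of_list w) \<longleftrightarrow> odd (length w)"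
  using assms
proof (induction w rule: cycle_of_list.induct)
  case (1 i j cs)
  then have "evenperm (cycle_of_list (i # j # cs)) \<longleftrightarrow>
      (evenperm (transpose i j) \<longleftrightarrow> evenperm (cycle_of_list (j # cs)))"
    by (simp only: cycle_of_list.simps evenperm_comp[OF permutation_swap_id permutation_of_cycle])
  also have "\<dots> \<longleftrightarrow> odd (length (i # j # cs))"
    using 1 by (auto simp: evenperm_swap)
  finally show ?case .
qed (simp_all add: evenperm_id)

section \<open>Links between points moved by a common 3-cycle\<close>

locale perm_group =
  fixes K :: "('a \<Rightarrow> 'a) set"
  assumes id_mem: "id \<in> K"
    and comp_mem: "g \<in> K \<Longrightarrow> h \<in> K \<Longrightarrow> g \<circ> h \<in> K"
    and inv_mem: "g \<in> K \<Longrightarrow> inv g \<in> K"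
    and bij_mem: "g \<in> K \<Longrightarrow> bij g"
begin

lemma funpow_mem: "g \<in> K \<Longrightarrow> g ^^ n \<in> K"
  by (induction n) (auto simp: comp_mem id_mem[unfolded id_def] id_mem)

definition linked :: "'a \<Rightarrow> 'a \<Rightarrow> bool" where
  "linked a b \<longleftrightarrow> a = b \<or> (\<exists>c. distinct [a, b, c] \<and> cycle_of_list [a, b, c] \<in> K)"

lemma linked_refl: "linked a a"
  by (simp add: linked_def)

lemma three_cycle_rotate:
  "distinct [a, b, c] \<Longrightarrow> cycle_of_list [a, b, c] \<in> K \<Longrightarrow> cycle_of_list [b, c, a] \<in> K"
  using cycle_of_list_rotate_independent[of "[a, b, c]" 1] by simp

lemma three_cycle_swap:
  assumes "distinct [a, b, c]" "cycle_of_list [a, b, c] \<in> K"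
  shows "cycle_of_list [b, a, c] \<in> K"
proof -
  have "cycle_of_list [c, b, a] \<in> K"
    using inv_mem[OF assms(2)] by (simp only: inv_cycle_of_list) simp
  moreover have "distinct [c, b, a]" using assms(1) by auto
  ultimately show ?thesis using three_cycle_rotate[of c b a] by blast
qed

lemma three_cycle_conj:
  assumes "s \<in> K" "distinct [a, b, c]" "cycle_of_list [a, b, c] \<in> K"
  shows "cycle_of_list [s a, s b, s c] \<in> K" "distinct [s a, s b, s c]"
proof -
  have "s \<circ> cycle_of_list [a, b, c] \<circ> inv s = cycle_of_list (map s [a, b, c])"
    by (rule conjugation_of_cycle[OF assms(2) bij_mem[OF assms(1)]])
  then show "cycle_of_list [s a, s b, s c] \<in> K"
    using comp_mem[OF comp_mem[OF assms(1,3)] inv_mem[OF assms(1)]] by simp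
  show "distinct [s a, s b, s c]"
    using assms(2) bij_is_inj[OF bij_mem[OF assms(1)]] by (auto dest: injD)
qed

lemma linked_sym: "linked a b \<Longrightarrow> linked b a"
  unfolding linked_def using three_cycle_swap by (metis distinct_length_2_or_more)

lemma linked_image: "linked a b \<Longrightarrow> s \<in> K \<Longrightarrow> linked (s a) (s b)"
  unfolding linked_def using three_cycle_conj by blast

lemma three_cycle_linked:
  assumes "distinct [a, b, c]" "cycle_of_list [a, b, c] \<in> K"
  shows "linked a b" "linked b c" "linked a c"
proof -
  have r: "cycle_of_list [b, c, a] \<in> K" "distinct [b, c, a]"
    using three_cycle_rotate[OF assms] assms(1) by auto
  have "cycle_of_list [c, a, b] \<in> K" "distinct [c, a, b]"
    using three_cycle_rotate[OF r(2,1)] assms(1) by auto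
  then show "linked a b" "linked b c" "linked a c"
    using assms r three_cycle_swap[of c a b] unfolding linked_def by auto
qed

text \<open>The 3-cycle behind the second link takes \<open>b\<close> to \<open>d\<close> and,
  unless \<open>a\<close> is its third point, fixes \<open>a\<close>; so it carries the first link
  to one between \<open>a\<close> and \<open>d\<close>. If \<open>a\<close> is the third point, that
  3-cycle itself links \<open>a\<close> and \<open>d\<close>.\<close>

lemma linked_trans:
  assumes "linked a b" "linked b d"
  shows "linked a d"
proof (cases "a = b \<or> b = d \<or> a = d")
  case True
  then show ?thesis using assms by (auto simp: linked_refl)
next
  case False
  then obtain c e where c: "distinct [a, b, c]" "cycle_of_list [a, b, c] \<in> K"
    and e: "distinct [b, d, e]" "cycle_of_list [b, d, e] \<in> K"
    using assms unfolding linked_def by blast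
  show ?thesis
  proof (cases "a = e")
    case True
    then show ?thesis using three_cycle_linked(2)[OF e] linked_sym by simp
  next
    case False
    have "cycle_of_list [b, d, e] a = a"
      using \<open>a \<noteq> e\<close> \<open>\<not> (a = b \<or> b = d \<or> a = d)\<close> by (intro id_outside_supp) auto
    moreover have "cycle_of_list [b, d, e] b = d"
      using e(1) by (auto simp: transpose_def)
    ultimately show ?thesis
      using linked_image[OF assms(1) e(2)] by simp
  qed
qed

text \<open>Conjugating \<open>(a b p)\<close> by \<open>(b c p)\<close> gives
  \<open>(a c b)\<close>, the inverse of the 3-cycle wanted; the auxiliary point \<open>p\<close>
  has disappeared.\<close>

lemma three_cycle_exchange:
  assumes "distinct [a, b, p, c]" "cycle_of_list [a, b, p] \<in> K" "cycle_of_list [b, c, p] \<in> K"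
  shows "cycle_of_list [a, b, c] \<in> K"
proof -
  have d: "distinct [a, b, p]" "distinct [b, c, p]" using assms(1) by auto
  have "cycle_of_list [b, c, p] a = a" "cycle_of_list [b, c, p] b = c" "cycle_of_list [b, c, p] p = b"
    using assms(1) by (auto simp: transpose_def)
  then have *: "cycle_of_list [a, c, b] \<in> K" "distinct [a, c, b]"
    using three_cycle_conj[OF assms(3) d(1) assms(2)] by auto
  then show ?thesis
    using three_cycle_rotate[of c a b] three_cycle_swap[of a c b] by auto
qed

text \<open>The unknown third points \<open>p\<close> and \<open>q\<close> of the two links have to
  be removed. When they are new and different, one conjugation first produces the common third point
  that \<open>three_cycle_exchange\<close> expects.\<close>

lemma three_cycle_of_linked:
  assumes "linked a b" "linked b c" "distinct [a, b, c]"
  shows "cycle_of_list [a, b, c] \<in> K"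
proof -
  obtain p q where p: "distinct [a, b, p]" "cycle_of_list [a, b, p] \<in> K"
    and q: "distinct [b, c, q]" "cycle_of_list [b, c, q] \<in> K"
    using assms unfolding linked_def by auto
  show ?thesis
  proof (cases "p = c \<or> q = a")
    case True
    then show ?thesis using p q three_cycle_rotate[of b c a] three_cycle_rotate[of c a b] assms(3) by auto
  next
    case neq: False
    show ?thesis
    proof (cases "p = q")
      case True
      then show ?thesis using three_cycle_exchange[of a b p c] p q assms(3) neq by auto
    next
      case False
      have "cycle_of_list [b, c, q] a = a" "cycle_of_list [b, c, q] b = c" "cycle_of_list [b, c, q] p = p"
        using assms(3) p(1) q(1) neq False by (auto simp: transpose_def)
      then have *: "cycle_of_list [a, c, p] \<in> K" "distinct [a, c, p]"
        using three_cycle_conj[OF q(2) p] by auto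
      have 2: "cycle_of_list [b, a, p] \<in> K" using three_cycle_swap[OF p] .
      have 3: "cycle_of_list [b, a, c] \<in> K"
        using three_cycle_exchange[of b a p c] 2 * p assms(3) by auto
      show ?thesis using three_cycle_swap[of b a c] 3 assms(3) by auto
    qed
  qed
qed

text \<open>Some power of the cycle carries \<open>p\<close> to \<open>q\<close>; since it fixes
  \<open>c\<close>, it transports the link.\<close>

lemma linked_fixed_point_cycle:
  assumes "distinct cs" "cycle_of_list cs \<in> K" "c \<notin> set cs" "p \<in> set cs" "linked c p" "q \<in> set cs"
  shows "linked c q"
proof -
  obtain n where n: "(cycle_of_list cs ^^ n) p = q"
    using cycle_transitive[OF assms(1,4,6)] by blast
  have "(cycle_of_list cs ^^ n) c = c"
    by (induction n) (simp_all add: id_outside_supp[OF assms(3)])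
  then show ?thesis
    using linked_image[OF assms(5) funpow_mem[OF assms(2), of n]] n by simp
qed

text \<open>Powers of the cycle carry one link between neighbours all the way round, and
  transitivity joins the copies.\<close>

lemma linked_neighbours_cycle:
  assumes "distinct cs" "cycle_of_list cs \<in> K" "p \<in> set cs" "linked p (cycle_of_list cs p)" "q \<in> set cs"
  shows "linked p q"
proof -
  obtain n where n: "(cycle_of_list cs ^^ n) p = q"
    using cycle_transitive[OF assms(1,3,5)] by blast
  have "linked p ((cycle_of_list cs ^^ n) p)" for n
  proof (induction n)
    case (Suc n)
    have "linked ((cycle_of_list cs ^^ n) p) ((cycle_of_list cs ^^ n) (cycle_of_list cs p))"
      using linked_image[OF assms(4) funpow_mem[OF assms(2)]] .
    then show ?case using Suc linked_trans by (metis funpow_swap1 funpow.simps(2) comp_apply)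
  qed (simp add: linked_refl)
  then show ?thesis using n by metis
qed

lemma evenperm_mem_of_linked:
  assumes fin: "finite X" and lnk: "\<And>a b. a \<in> X \<Longrightarrow> b \<in> X \<Longrightarrow> linked a b"
    and "p permutes X" "evenperm p"
  shows "p \<in> K"
  using assms(3,4)
proof (induction "card {x. p x \<noteq> x}" arbitrary: p rule: less_induct)
  case less
  have sub: "{x. p x \<noteq> x} \<subseteq> X" using less.prems(1) by (auto simp: permutes_def)
  then have finm: "finite {x. p x \<noteq> x}" using fin finite_subset by blast
  have pp: "permutation p" using less.prems(1) fin permutation_permutes by blast
  show ?case
  proof (cases "p = id")
    case True
    then show ?thesis by (simp add: id_mem)
  next
    case False
    then obtain a where a: "p a \<noteq> a" by (auto simp: fun_eq_iff)
    define b where "b = p a"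
    have bij: "bij p" using less.prems(1) permutes_bij by blast
    have b: "p b \<noteq> b" using a bij unfolding b_def by (metis bij_is_inj injD)
    \<comment> \<open>Otherwise \<open>p\<close> would be the transposition of \<open>a\<close> and
      \<open>b\<close>, which is odd.\<close>
    have "\<exists>c. c \<noteq> a \<and> c \<noteq> b \<and> p c \<noteq> c"
    proof (rule ccontr)
      assume "\<not> ?thesis"
      then have fixc: "p c = c" if "c \<noteq> a" "c \<noteq> b" for c using that by blast
      have "p b = a"
        using fixc b bij by (metis bij_is_inj injD)
      then have "p = transpose a b"
        using fixc b_def by (auto simp: fun_eq_iff transpose_def)
      moreover have "a \<noteq> b" using a b_def by simp
      ultimately show False using less.prems(2) evenperm_swap[of a b] by metis
    qed
    then obtain c where c: "c \<noteq> a" "c \<noteq> b" "p c \<noteq> c" by blast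
    have ab: "a \<noteq> b" using a b_def by simp
    have inX: "a \<in> X" "b \<in> X" "c \<in> X" using sub a b c by auto
    \<comment> \<open>Chosen with \<open>s b = a\<close>, so that \<open>s \<circ> p\<close> fixes
      \<open>a\<close>; no new point is moved because \<open>p\<close> already moves
      \<open>b\<close> and \<open>c\<close>.\<close>
    define s where "s = cycle_of_list [b, a, c]"
    have d: "distinct [b, a, c]" using c ab by auto
    have s: "s \<in> K" unfolding s_def
      using three_cycle_of_linked[OF lnk lnk d] inX by blast
    have sv: "s b = a" "s a = c" "s c = b" "\<And>z. z \<noteq> a \<Longrightarrow> z \<noteq> b \<Longrightarrow> z \<noteq> c \<Longrightarrow> s z = z"
      unfolding s_def using d by (auto simp: transpose_def)
    have sper: "s permutes X" unfolding s_def
      using permutes_subset[OF cycle_permutes, of "[b, a, c]" X] inX by simp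
    have evs: "evenperm s" unfolding s_def
      using evenperm_cycle_of_list[of "[b, a, c]"] d by auto
    have "evenperm (s \<circ> p)"
      using evenperm_comp[of s p] evs less.prems(2) pp permutation_of_cycle[of "[b, a, c]"] s_def by auto
    moreover have "(s \<circ> p) permutes X" using permutes_compose[OF less.prems(1) sper] .
    moreover have "card {x. (s \<circ> p) x \<noteq> x} < card {x. p x \<noteq> x}"
    proof (rule psubset_card_mono[OF finm])
      have "{x. (s \<circ> p) x \<noteq> x} \<subseteq> {x. p x \<noteq> x} - {a}"
      proof safe
        fix x assume "(s \<circ> p) x \<noteq> x" "p x = x"
        then have "s x \<noteq> x" by simp
        then have "x = a \<or> x = b \<or> x = c" using sv(4) by blast
        then show False using \<open>p x = x\<close> a b c by auto
      next
        assume "(s \<circ> p) a \<noteq> a"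
        then show False using sv(1) b_def by simp
      qed
      then show "{x. (s \<circ> p) x \<noteq> x} \<subset> {x. p x \<noteq> x}" using a by auto
    qed
    ultimately have "s \<circ> p \<in> K" using less.hyps by blast
    then have "inv s \<circ> (s \<circ> p) \<in> K" using comp_mem inv_mem s by blast
    moreover have "inv s \<circ> (s \<circ> p) = p"
      using bij_mem[OF s] by (simp add: fun_eq_iff bij_is_inj)
    ultimately show ?thesis by simp
  qed
qed

end

section \<open>Walks of the hole\<close>

locale symmetric_graph =
  fixes E :: "nat \<Rightarrow> nat \<Rightarrow> bool" and U :: "nat set"
  assumes fin: "finite U" and sym: "x \<in> U \<Longrightarrow> y \<in> U \<Longrightarrow> E x y \<Longrightarrow> E y x"
begin

definition walk :: "nat set \<Rightarrow> nat list \<Rightarrow> bool" where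
  "walk S w \<longleftrightarrow> w \<noteq> [] \<and> set w \<subseteq> S \<and> successively E w"

definition walk_connected :: "nat set \<Rightarrow> bool" where
  "walk_connected S \<longleftrightarrow> (\<forall>a\<in>S. \<forall>b\<in>S. \<exists>w. walk S w \<and> hd w = a \<and> last w = b)"

text \<open>A walk of the hole through \<open>x\<^sub>0, \<dots>, x\<^sub>n\<close> composes the transpositions \<open>(x\<^sub>i x\<^sub>i\<^sub>+\<^sub>1)\<close>, which is
  what \<open>cycle_of_list\<close> computes also for lists with repetitions: a labelling \<open>\<alpha>\<close> becomes
  \<open>\<alpha> \<circ> cycle_of_list w\<close>.\<close>
definition loop_group :: "nat set \<Rightarrow> nat \<Rightarrow> (nat \<Rightarrow> nat) set" where
  "loop_group S x = {cycle_of_list w | w. walk S w \<and> hd w = x \<and> last w = x}"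

lemma walk_mono: "walk S w \<Longrightarrow> S \<subseteq> T \<Longrightarrow> walk T w"
  by (auto simp: walk_def)

lemma walk_rev:
  assumes "walk S w" "S \<subseteq> U"
  shows "walk S (rev w)"
proof -
  have "successively (\<lambda>x y. E y x) w"
    using assms unfolding walk_def by (auto intro!: successively_mono[where P = E and xs = w] dest: sym)
  then show ?thesis using assms by (auto simp: walk_def)
qed

lemma walk_join:
  assumes "walk S v" "walk S w" "last v = hd w"
  shows "walk S (v @ tl w)" "hd (v @ tl w) = hd v" "last (v @ tl w) = last w"
    "cycle_of_list (v @ tl w) = cycle_of_list v \<circ> cycle_of_list w"
proof -
  obtain v' z w' where v: "v = v' @ [z]" and w: "w = z # w'"
    using assms unfolding walk_def by (metis append_butlast_last_id list.collapse)
  show "walk S (v @ tl w)"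
    using assms unfolding walk_def v w by (auto simp: successively_append_iff successively_Cons)
  show "hd (v @ tl w) = hd v" by (simp add: v hd_append)
  show "last (v @ tl w) = last w" by (simp add: v w last_append)
  show "cycle_of_list (v @ tl w) = cycle_of_list v \<circ> cycle_of_list w"
    using cycle_of_list_append[of v' z w'] by (simp add: v w)
qed

lemma walk_connectedI:
  assumes "S \<subseteq> U" "\<And>a. a \<in> S \<Longrightarrow> \<exists>w. walk S w \<and> hd w = r \<and> last w = a"
  shows "walk_connected S"
  unfolding walk_connected_def
proof (intro ballI)
  fix a b assume "a \<in> S" "b \<in> S"
  then obtain v w where v: "walk S v" "hd v = r" "last v = a" and w: "walk S w" "hd w = r" "last w = b"
    using assms(2) by metis
  have rv: "walk S (rev v)" "hd (rev v) = a" "last (rev v) = r"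
    using walk_rev[OF v(1) assms(1)] v by (auto simp: hd_rev last_rev)
  show "\<exists>w. walk S w \<and> hd w = a \<and> last w = b"
    using walk_join[OF rv(1) w(1)] rv w by metis
qed

lemma loop_groupI:
  "walk S w \<Longrightarrow> hd w = x \<Longrightarrow> last w = x \<Longrightarrow> cycle_of_list w \<in> loop_group S x"
  unfolding loop_group_def by blast

lemma perm_group_loop_group:
  assumes "x \<in> S" "S \<subseteq> U"
  shows "perm_group (loop_group S x)"
proof
  have "walk S [x]" using assms by (simp add: walk_def)
  then show "id \<in> loop_group S x"
    using loop_groupI[of S "[x]" x] by simp
next
  fix g h assume "g \<in> loop_group S x" "h \<in> loop_group S x"
  then obtain v w where v: "g = cycle_of_list v" "walk S v" "hd v = x" "last v = x"
    and w: "h = cycle_of_list w" "walk S w" "hd w = x" "last w = x"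
    unfolding loop_group_def by blast
  then show "g \<circ> h \<in> loop_group S x"
    using walk_join[OF v(2) w(2)] loop_groupI[of S "v @ tl w" x] by simp
next
  fix g assume "g \<in> loop_group S x"
  then obtain v where v: "g = cycle_of_list v" "walk S v" "hd v = x" "last v = x"
    unfolding loop_group_def by blast
  then have "walk S (rev v)" "hd (rev v) = x" "last (rev v) = x"
    using walk_rev[OF v(2) assms(2)] by (auto simp: hd_rev last_rev)
  then show "inv g \<in> loop_group S x"
    unfolding v(1) inv_cycle_of_list by (rule loop_groupI)
next
  fix g assume "g \<in> loop_group S x"
  then show "bij g" unfolding loop_group_def using bij_cycle_of_list by blast
qed

abbreviation linked_at :: "nat set \<Rightarrow> nat \<Rightarrow> nat \<Rightarrow> nat \<Rightarrow> bool" where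
  "linked_at S x \<equiv> perm_group.linked (loop_group S x)"

lemma loop_group_mono: "S \<subseteq> T \<Longrightarrow> loop_group S x \<subseteq> loop_group T x"
  unfolding loop_group_def using walk_mono by blast

lemma linked_at_mono:
  assumes "linked_at S x a b" "S \<subseteq> T" "T \<subseteq> U" "x \<in> S"
  shows "linked_at T x a b"
proof -
  have *: "S \<subseteq> U" "x \<in> T" using assms by auto
  interpret K: perm_group "loop_group S x" by (rule perm_group_loop_group[OF assms(4) *(1)])
  interpret L: perm_group "loop_group T x" by (rule perm_group_loop_group[OF *(2) assms(3)])
  show ?thesis
    using assms(1) loop_group_mono[OF assms(2), of x] unfolding K.linked_def L.linked_def by blast
qed

lemma cycle_mem_loop_group:
  assumes "distinct (x # p)" "set (x # p) \<subseteq> S" "successively E (x # p @ [x])"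
  shows "cycle_of_list p \<in> loop_group S x"
proof -
  have "walk S (x # p @ [x])" using assms(2,3) by (simp add: walk_def)
  then show ?thesis
    unfolding cycle_of_list_closed_walk[OF assms(1), symmetric]
    by (rule loop_groupI) simp_all
qed

text \<open>The hole position \<open>x\<close> is left out since closed walks from \<open>x\<close>
  fix it.\<close>

definition all_linked :: "nat set \<Rightarrow> bool" where
  "all_linked S \<longleftrightarrow> S \<subseteq> U \<and> walk_connected S \<and>
     (\<forall>x\<in>S. \<forall>a\<in>S - {x}. \<forall>b\<in>S - {x}. linked_at S x a b)"

lemma walk_mem_image:
  assumes "walk S w" "a \<in> S" "a \<noteq> last w"
  shows "cycle_of_list w a \<in> S - {hd w}"
proof -
  have "cycle_of_list w permutes S"
    using assms(1) permutes_subset[OF cycle_permutes] by (auto simp: walk_def)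
  then have "cycle_of_list w a \<in> S" using assms(2) permutes_in_image by metis
  moreover have "cycle_of_list w a \<noteq> cycle_of_list w (last w)"
    using assms(3) bij_is_inj[OF bij_cycle_of_list] by (metis injD)
  ultimately show ?thesis
    using cycle_of_list_last[of w] assms(1) by (simp add: walk_def)
qed

text \<open>A single hole position suffices: a walk from \<open>x\<close> to \<open>x'\<close>
  conjugates the closed walks at \<open>x\<close> into closed walks at \<open>x'\<close>, and
  3-cycles into 3-cycles.\<close>

lemma all_linkedI:
  assumes "S \<subseteq> U" "walk_connected S" "x \<in> S"
    and lnk: "\<And>a b. a \<in> S - {x} \<Longrightarrow> b \<in> S - {x} \<Longrightarrow> linked_at S x a b"
  shows "all_linked S"
  unfolding all_linked_def
proof (intro conjI ballI assms(1,2))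
  fix x' a b assume x': "x' \<in> S" and a: "a \<in> S - {x'}" and b: "b \<in> S - {x'}"
  obtain w where w: "walk S w" "hd w = x" "last w = x'"
    using assms(2,3) x' by (auto simp: walk_connected_def)
  define s where "s = cycle_of_list w"
  have bij: "bij s" unfolding s_def by (rule bij_cycle_of_list)
  have s: "s a \<in> S - {x}" "s b \<in> S - {x}"
    unfolding s_def using walk_mem_image[OF w(1)] w a b by auto
  interpret K: perm_group "loop_group S x" by (rule perm_group_loop_group[OF assms(3,1)])
  interpret K': perm_group "loop_group S x'" by (rule perm_group_loop_group[OF x' assms(1)])
  have conj: "inv s \<circ> k \<circ> s \<in> loop_group S x'" if k: "k \<in> loop_group S x" for k
  proof -
    obtain v where v: "k = cycle_of_list v" "walk S v" "hd v = x" "last v = x"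
      using k unfolding loop_group_def by blast
    have r: "walk S (rev w)" "hd (rev w) = x'" "last (rev w) = x"
      using walk_rev[OF w(1) assms(1)] w by (auto simp: hd_rev last_rev)
    note j = walk_join[OF r(1) v(2)] and j' = walk_join[OF _ w(1), of "rev w @ tl v"]
    have "cycle_of_list ((rev w @ tl v) @ tl w) = inv s \<circ> k \<circ> s"
      using j' j r v w by (simp add: s_def inv_cycle_of_list)
    moreover have "walk S ((rev w @ tl v) @ tl w)" "hd ((rev w @ tl v) @ tl w) = x'"
      "last ((rev w @ tl v) @ tl w) = x'"
      using j' j r v w by auto
    ultimately show ?thesis using loop_groupI by metis
  qed
  have "K.linked (s a) (s b)" using lnk s by blast
  then consider "a = b" | c where "distinct [s a, s b, c]" "cycle_of_list [s a, s b, c] \<in> loop_group S x"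
    unfolding K.linked_def using bij by (metis bij_is_inj injD)
  then show "linked_at S x' a b"
  proof cases
    case 1
    then show ?thesis by (simp add: K'.linked_refl)
  next
    case (2 c)
    have "inv s \<circ> cycle_of_list [s a, s b, c] \<circ> inv (inv s) = cycle_of_list (map (inv s) [s a, s b, c])"
      by (rule conjugation_of_cycle[OF 2(1) bij_imp_bij_inv[OF bij]])
    then have *: "cycle_of_list [a, b, inv s c] \<in> loop_group S x'"
      using conj[OF 2(2)] bij by (simp add: inv_inv_eq bij_is_inj)
    have "distinct (map (inv s) [s a, s b, c])"
      using 2(1) inj_on_subset[OF bij_is_inj[OF bij_imp_bij_inv[OF bij]] subset_UNIV]
      unfolding distinct_map by blast
    then show ?thesis using * bij unfolding K'.linked_def by (auto simp: bij_is_inj)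
  qed
qed

text \<open>The interior \<open>p\<close> may be empty; the ear is then an edge between two vertices
  of \<open>S\<close>, and possibly one that is already in use.\<close>

definition ear :: "nat set \<Rightarrow> nat \<Rightarrow> nat list \<Rightarrow> nat \<Rightarrow> bool" where
  "ear S u p v \<longleftrightarrow> u \<in> S \<and> v \<in> S \<and> u \<noteq> v \<and> distinct p \<and> set p \<inter> S = {} \<and> set p \<subseteq> U \<and>
     successively E (u # p @ [v])"

lemma distinct_path_of_walk:
  assumes "walk S w"
  obtains p where "walk S p" "distinct p" "hd p = hd w" "last p = last w"
proof -
  have "\<exists>p. walk S p \<and> distinct p \<and> hd p = hd w \<and> last p = last w"
    using assms
  proof (induction w)
    case (Cons a w)
    show ?case
    proof (cases "w = []")
      case True
      then show ?thesis using Cons.prems by (intro exI[of _ "[a]"]) (auto simp: walk_def)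
    next
      case False
      then have "walk S w" and e: "E a (hd w)" and a: "a \<in> S"
        using Cons.prems by (auto simp: walk_def successively_Cons)
      then obtain p where p: "walk S p" "distinct p" "hd p = hd w" "last p = last w"
        using Cons.IH by blast
      show ?thesis
      proof (cases "a \<in> set p")
        case True
        then obtain p1 p2 where q: "p = p1 @ a # p2" by (meson split_list)
        then have "walk S (a # p2)" "distinct (a # p2)" "last (a # p2) = last p"
          using p by (auto simp: walk_def successively_append_iff)
        then show ?thesis using p False by (intro exI[of _ "a # p2"]) auto
      next
        case a': False
        then show ?thesis using p e a False
          by (intro exI[of _ "a # p"]) (auto simp: walk_def successively_Cons)
      qed
    qed
  qed (simp add: walk_def)
  then show thesis using that by blast
qed

lemma successively_append_common:
  "successively P (xs @ [z]) \<Longrightarrow> successively P (z # ys) \<Longrightarrow> successively P (xs @ z # ys)"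
  by (auto simp: successively_append_iff successively_Cons)

lemma walk_connected_ear:
  assumes "S \<subseteq> U" "walk_connected S" "ear S u p v"
  shows "walk_connected (S \<union> set p)"
proof (rule walk_connectedI[where r = u])
  show "S \<union> set p \<subseteq> U" using assms by (auto simp: ear_def)
  fix a assume "a \<in> S \<union> set p"
  then show "\<exists>w. walk (S \<union> set p) w \<and> hd w = u \<and> last w = a"
  proof
    assume "a \<in> S"
    then show ?thesis
      using assms(2,3) walk_mono[of S _ "S \<union> set p"] unfolding walk_connected_def ear_def
      by (meson Un_upper1)
  next
    assume "a \<in> set p"
    then obtain p1 p2 where p: "p = p1 @ a # p2" by (meson split_list)
    have "successively E ((u # p1 @ [a]) @ p2 @ [v])"
      using assms(3) by (simp add: ear_def p)
    then have "successively E (u # p1 @ [a])"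
      by (simp only: successively_append_iff)
    then have "walk (S \<union> set p) (u # p1 @ [a])"
      using assms(3) by (auto simp: walk_def ear_def p)
    then show ?thesis by (intro exI[of _ "u # p1 @ [a]"]) auto
  qed
qed

text \<open>With the hole at \<open>u\<close>, the ear and a path back from \<open>v\<close> through
  \<open>S\<close> form a cycle that rotates the ear vertices together with \<open>v\<close>; it
  spreads a link inside \<open>S\<close> over the ear.\<close>

lemma all_linked_ear:
  assumes S: "all_linked S" and ear: "ear S u p v" and card: "card S \<ge> 3"
  shows "all_linked (S \<union> set p)"
proof -
  define T where "T = S \<union> set p"
  have SU: "S \<subseteq> U" and conn: "walk_connected S" using S by (auto simp: all_linked_def)
  have TU: "T \<subseteq> U" using SU ear by (auto simp: T_def ear_def)
  have u: "u \<in> S" "v \<in> S" "u \<noteq> v" using ear by (auto simp: ear_def)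
  then have uT: "u \<in> T" by (simp add: T_def)
  interpret K: perm_group "loop_group T u" by (rule perm_group_loop_group[OF uT TU])
  have lS: "K.linked a b" if "a \<in> S - {u}" "b \<in> S - {u}" for a b
    using linked_at_mono[of S u a b T] S u that TU by (auto simp: all_linked_def T_def)
  obtain w where w: "walk S w" "hd w = v" "last w = u"
    using conn u by (auto simp: walk_connected_def)
  obtain q where q: "walk S q" "distinct q" "hd q = v" "last q = u"
    using distinct_path_of_walk[OF w(1)] w by metis
  obtain q' where q': "q = v # q'" using q by (cases q) (auto simp: walk_def)
  then have "q' \<noteq> []" using q(4) u(3) by auto
  then have "q' = butlast q' @ [u]" using q(4) append_butlast_last_id[of q'] by (simp add: q')
  then obtain r where r: "q = v # r @ [u]" using q' by blast
  define cs where "cs = p @ v # r"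
  have qf: "distinct (v # r @ [u])" "set (v # r @ [u]) \<subseteq> S" "successively E (v # r @ [u])"
    using q(1,2) unfolding r walk_def by blast+
  have ef: "distinct p" "set p \<inter> S = {}" "successively E ((u # p) @ [v])"
    using ear unfolding ear_def by simp_all
  have d: "distinct (u # cs)" "set (u # cs) \<subseteq> T"
    using qf(1,2) ef(1,2) unfolding cs_def T_def by auto
  have "successively E ((u # p) @ v # (r @ [u]))"
    by (rule successively_append_common[OF ef(3) qf(3)])
  then have cs: "cycle_of_list cs \<in> loop_group T u"
    by (intro cycle_mem_loop_group d) (simp add: cs_def)
  have vcs: "v \<in> set cs" by (simp add: cs_def)
  have dcs: "distinct cs" using d by simp
  have lv: "K.linked v b" if b: "b \<in> set p" for b
  proof (cases r)
    \<comment> \<open>The path back is the edge from \<open>v\<close> to \<open>u\<close>. A third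
      vertex \<open>c\<close> of \<open>S\<close>, which exists by the bound on
      \<open>card S\<close>, is off the cycle and hence fixed, so its link to \<open>v\<close>
      spreads over the ear.\<close>
    case Nil
    have "\<not> S \<subseteq> {u, v}"
      using card card_mono[of "{u, v}" S] card_insert_le_m1[of 2 "{v}" u] by auto
    then obtain c where c: "c \<in> S" "c \<noteq> u" "c \<noteq> v" by blast
    then have cc: "c \<notin> set cs" using ear by (auto simp: cs_def Nil ear_def)
    have "K.linked c b"
      by (rule K.linked_fixed_point_cycle[OF dcs cs cc vcs]) (use lS c u b in \<open>auto simp: cs_def\<close>)
    then show ?thesis using lS[of v c] c u K.linked_trans by blast
  next
    case (Cons z r')
    \<comment> \<open>The cycle moves \<open>v\<close> to another vertex of \<open>S\<close>, so two
      neighbours on the cycle are already linked.\<close>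
    have "cycle_of_list cs (cs ! length p) = cs ! (length p + 1)"
      using distinct_cycle_nth[OF dcs, of "length p" 1] by (simp add: cs_def Cons)
    then have "cycle_of_list cs v = z" by (simp add: cs_def Cons nth_append)
    moreover have "z \<in> S - {u}" using qf(1,2) by (auto simp: Cons)
    ultimately show ?thesis
      using K.linked_neighbours_cycle[OF dcs cs vcs] lS u b by (auto simp: cs_def)
  qed
  have lv': "K.linked v b" if "b \<in> T - {u}" for b
    using that lv lS u by (auto simp: T_def)
  show ?thesis
    unfolding T_def[symmetric]
  proof (rule all_linkedI[OF TU _ uT])
    show "walk_connected T" unfolding T_def by (rule walk_connected_ear[OF SU conn ear])
    show "linked_at T u a b" if "a \<in> T - {u}" "b \<in> T - {u}" for a b
      using lv' that K.linked_trans K.linked_sym by blast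
  qed
qed

end

section \<open>Theta graphs\<close>

text \<open>Reduces an identity between explicit permutations to a comparison of value
  tables.\<close>

lemma eq_on_listI:
  assumes "map f zs = map g zs" "\<And>z. z \<notin> set zs \<Longrightarrow> f z = z" "\<And>z. z \<notin> set zs \<Longrightarrow> g z = z"
  shows "f = g"
proof
  fix z
  show "f z = g z" using assms by (cases "z \<in> set zs") auto
qed

lemma cycle_map: "distinct cs \<Longrightarrow> map (cycle_of_list cs) cs = rotate1 cs"
  using cyclic_rotation[of cs 1] by simp

text \<open>The theta graphs whose paths have (1,2,3), (2,2,2), (2,2,3) or (2,2,4) interior vertices are
  too small for the general argument; the following words were found by a computer search.\<close>
lemma three_cycle_word_123:
  assumes "distinct [a1, b1, b2, c1, c2, c3, y]"
    and "g = cycle_of_list [a1, y, b2, b1]"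
    and "k = cycle_of_list [a1, y, c3, c2, c1]"
    and "h = cycle_of_list [b1, b2, y, c3, c2, c1]"
  shows "g \<circ> k \<circ> g \<circ> k \<circ> g \<circ> k \<circ> h = cycle_of_list [b1, b2, c1]"
proof (rule eq_on_listI)
  have t_g: "map g [a1, b1, b2, c1, c2, c3, y] = [y, a1, b1, c1, c2, c3, b2]"
    using assms(1) cycle_map[of "[a1, y, b2, b1]"] unfolding assms by (auto simp del: cycle_of_list.simps simp: id_outside_supp)
  have t_k: "map k [a1, b1, b2, c1, c2, c3, y] = [y, b1, b2, a1, c1, c2, c3]"
    using assms(1) cycle_map[of "[a1, y, c3, c2, c1]"] unfolding assms by (auto simp del: cycle_of_list.simps simp: id_outside_supp)
  have t_h: "map h [a1, b1, b2, c1, c2, c3, y] = [a1, b2, y, b1, c1, c2, c3]"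
    using assms(1) cycle_map[of "[b1, b2, y, c3, c2, c1]"] unfolding assms by (auto simp del: cycle_of_list.simps simp: id_outside_supp)
  have t_c: "map (cycle_of_list [b1, b2, c1]) [a1, b1, b2, c1, c2, c3, y] = [a1, b2, c1, b1, c2, c3, y]"
    using assms(1) cycle_map[of "[b1, b2, c1]"] by (auto simp del: cycle_of_list.simps simp: id_outside_supp)
  show "map (g \<circ> k \<circ> g \<circ> k \<circ> g \<circ> k \<circ> h) [a1, b1, b2, c1, c2, c3, y] = map (cycle_of_list [b1, b2, c1]) [a1, b1, b2, c1, c2, c3, y]"
    using t_g t_k t_h t_c by (simp del: cycle_of_list.simps)
qed (auto simp: assms(2-) id_outside_supp simp del: cycle_of_list.simps)

lemma three_cycle_word_222:
  assumes "distinct [a1, a2, b1, b2, c1, c2, y]"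
    and "g = cycle_of_list [a1, a2, y, b2, b1]"
    and "k = cycle_of_list [a1, a2, y, c2, c1]"
  shows "g \<circ> g \<circ> k \<circ> g \<circ> g \<circ> k = cycle_of_list [c1, c2, y]"
proof (rule eq_on_listI)
  have t_g: "map g [a1, a2, b1, b2, c1, c2, y] = [a2, y, a1, b1, c1, c2, b2]"
    using assms(1) cycle_map[of "[a1, a2, y, b2, b1]"] unfolding assms by (auto simp del: cycle_of_list.simps simp: id_outside_supp)
  have t_k: "map k [a1, a2, b1, b2, c1, c2, y] = [a2, y, b1, b2, a1, c1, c2]"
    using assms(1) cycle_map[of "[a1, a2, y, c2, c1]"] unfolding assms by (auto simp del: cycle_of_list.simps simp: id_outside_supp)
  have t_c: "map (cycle_of_list [c1, c2, y]) [a1, a2, b1, b2, c1, c2, y] = [a1, a2, b1, b2, c2, y, c1]"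
    using assms(1) cycle_map[of "[c1, c2, y]"] by (auto simp del: cycle_of_list.simps simp: id_outside_supp)
  show "map (g \<circ> g \<circ> k \<circ> g \<circ> g \<circ> k) [a1, a2, b1, b2, c1, c2, y] = map (cycle_of_list [c1, c2, y]) [a1, a2, b1, b2, c1, c2, y]"
    using t_g t_k t_c by (simp del: cycle_of_list.simps)
qed (auto simp: assms(2-) id_outside_supp simp del: cycle_of_list.simps)

lemma three_cycle_word_223:
  assumes "distinct [a1, a2, b1, b2, c1, c2, c3, y]"
    and "k' = cycle_of_list [c1, c2, c3, y, a2, a1]"
    and "h' = cycle_of_list [c1, c2, c3, y, b2, b1]"
    and "g = cycle_of_list [a1, a2, y, b2, b1]"
    and "k = cycle_of_list [a1, a2, y, c3, c2, c1]"
    and "h = cycle_of_list [b1, b2, y, c3, c2, c1]"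
  shows "g \<circ> g \<circ> k' \<circ> h' \<circ> g \<circ> k \<circ> h = cycle_of_list [b1, c2, y]"
proof (rule eq_on_listI)
  have t_k': "map k' [a1, a2, b1, b2, c1, c2, c3, y] = [c1, a1, b1, b2, c2, c3, y, a2]"
    using assms(1) cycle_map[of "[c1, c2, c3, y, a2, a1]"] unfolding assms by (auto simp del: cycle_of_list.simps simp: id_outside_supp)
  have t_h': "map h' [a1, a2, b1, b2, c1, c2, c3, y] = [a1, a2, c1, b1, c2, c3, y, b2]"
    using assms(1) cycle_map[of "[c1, c2, c3, y, b2, b1]"] unfolding assms by (auto simp del: cycle_of_list.simps simp: id_outside_supp)
  have t_g: "map g [a1, a2, b1, b2, c1, c2, c3, y] = [a2, y, a1, b1, c1, c2, c3, b2]"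
    using assms(1) cycle_map[of "[a1, a2, y, b2, b1]"] unfolding assms by (auto simp del: cycle_of_list.simps simp: id_outside_supp)
  have t_k: "map k [a1, a2, b1, b2, c1, c2, c3, y] = [a2, y, b1, b2, a1, c1, c2, c3]"
    using assms(1) cycle_map[of "[a1, a2, y, c3, c2, c1]"] unfolding assms by (auto simp del: cycle_of_list.simps simp: id_outside_supp)
  have t_h: "map h [a1, a2, b1, b2, c1, c2, c3, y] = [a1, a2, b2, y, b1, c1, c2, c3]"
    using assms(1) cycle_map[of "[b1, b2, y, c3, c2, c1]"] unfolding assms by (auto simp del: cycle_of_list.simps simp: id_outside_supp)
  have t_c: "map (cycle_of_list [b1, c2, y]) [a1, a2, b1, b2, c1, c2, c3, y] = [a1, a2, c2, b2, c1, y, c3, b1]"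
    using assms(1) cycle_map[of "[b1, c2, y]"] by (auto simp del: cycle_of_list.simps simp: id_outside_supp)
  show "map (g \<circ> g \<circ> k' \<circ> h' \<circ> g \<circ> k \<circ> h) [a1, a2, b1, b2, c1, c2, c3, y] = map (cycle_of_list [b1, c2, y]) [a1, a2, b1, b2, c1, c2, c3, y]"
    using t_k' t_h' t_g t_k t_h t_c by (simp del: cycle_of_list.simps)
qed (auto simp: assms(2-) id_outside_supp simp del: cycle_of_list.simps)

lemma three_cycle_word_224:
  assumes "distinct [a1, a2, b1, b2, c1, c2, c3, c4, y]"
    and "k' = cycle_of_list [c1, c2, c3, c4, y, a2, a1]"
    and "h' = cycle_of_list [c1, c2, c3, c4, y, b2, b1]"
    and "g = cycle_of_list [a1, a2, y, b2, b1]"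
    and "k = cycle_of_list [a1, a2, y, c4, c3, c2, c1]"
    and "h = cycle_of_list [b1, b2, y, c4, c3, c2, c1]"
  shows "g \<circ> g \<circ> k' \<circ> h' \<circ> g \<circ> k \<circ> h = cycle_of_list [b1, c2, y]"
proof (rule eq_on_listI)
  have t_k': "map k' [a1, a2, b1, b2, c1, c2, c3, c4, y] = [c1, a1, b1, b2, c2, c3, c4, y, a2]"
    using assms(1) cycle_map[of "[c1, c2, c3, c4, y, a2, a1]"] unfolding assms by (auto simp del: cycle_of_list.simps simp: id_outside_supp)
  have t_h': "map h' [a1, a2, b1, b2, c1, c2, c3, c4, y] = [a1, a2, c1, b1, c2, c3, c4, y, b2]"
    using assms(1) cycle_map[of "[c1, c2, c3, c4, y, b2, b1]"] unfolding assms by (auto simp del: cycle_of_list.simps simp: id_outside_supp)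
  have t_g: "map g [a1, a2, b1, b2, c1, c2, c3, c4, y] = [a2, y, a1, b1, c1, c2, c3, c4, b2]"
    using assms(1) cycle_map[of "[a1, a2, y, b2, b1]"] unfolding assms by (auto simp del: cycle_of_list.simps simp: id_outside_supp)
  have t_k: "map k [a1, a2, b1, b2, c1, c2, c3, c4, y] = [a2, y, b1, b2, a1, c1, c2, c3, c4]"
    using assms(1) cycle_map[of "[a1, a2, y, c4, c3, c2, c1]"] unfolding assms by (auto simp del: cycle_of_list.simps simp: id_outside_supp)
  have t_h: "map h [a1, a2, b1, b2, c1, c2, c3, c4, y] = [a1, a2, b2, y, b1, c1, c2, c3, c4]"
    using assms(1) cycle_map[of "[b1, b2, y, c4, c3, c2, c1]"] unfolding assms by (auto simp del: cycle_of_list.simps simp: id_outside_supp)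
  have t_c: "map (cycle_of_list [b1, c2, y]) [a1, a2, b1, b2, c1, c2, c3, c4, y] = [a1, a2, c2, b2, c1, y, c3, c4, b1]"
    using assms(1) cycle_map[of "[b1, c2, y]"] by (auto simp del: cycle_of_list.simps simp: id_outside_supp)
  show "map (g \<circ> g \<circ> k' \<circ> h' \<circ> g \<circ> k \<circ> h) [a1, a2, b1, b2, c1, c2, c3, c4, y] = map (cycle_of_list [b1, c2, y]) [a1, a2, b1, b2, c1, c2, c3, c4, y]"
    using t_k' t_h' t_g t_k t_h t_c by (simp del: cycle_of_list.simps)
qed (auto simp: assms(2-) id_outside_supp simp del: cycle_of_list.simps)

text \<open>The factors \<open>(p q)\<close> and \<open>(p' q')\<close> commute with the rest and
  square to the identity. What remains is the square of the 3-cycle formed by \<open>(r s)\<close>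
  and \<open>(r' s)\<close>, which share only \<open>s\<close>.\<close>

lemma double_transposition_square:
  assumes "distinct [p, q, r, s, p', q', r']" and "f = transpose p q \<circ> transpose r s"
    and "g = transpose p' q' \<circ> transpose r' s"
  shows "(f \<circ> g) \<circ> (f \<circ> g) = cycle_of_list [s, r, r']"
proof (rule eq_on_listI)
  have f: "map f [p, q, r, s, p', q', r'] = [q, p, s, r, p', q', r']"
    using assms(1) by (auto simp: assms(2) transpose_apply_other)
  have g: "map g [p, q, r, s, p', q', r'] = [p, q, r, r', q', p', s]"
    using assms(1) by (auto simp: assms(3) transpose_apply_other)
  have c: "map (cycle_of_list [s, r, r']) [p, q, r, s, p', q', r'] = [p, q, r', r, p', q', s]"
    using assms(1) by (auto simp: transpose_apply_other)
  show "map ((f \<circ> g) \<circ> (f \<circ> g)) [p, q, r, s, p', q', r']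
    = map (cycle_of_list [s, r, r']) [p, q, r, s, p', q', r']"
    unfolding c using f g by simp
qed (auto simp: assms(2,3) transpose_apply_other)

context symmetric_graph
begin

text \<open>The lists are the interiors of the three paths and may be empty; that at most one of
  them is empty is assumed separately where it matters.\<close>

definition theta :: "nat \<Rightarrow> nat \<Rightarrow> nat list \<Rightarrow> nat list \<Rightarrow> nat list \<Rightarrow> bool" where
  "theta x y A B C \<longleftrightarrow> distinct (x # y # A @ B @ C) \<and> set (x # y # A @ B @ C) \<subseteq> U \<and>
     successively E (x # A @ [y]) \<and> successively E (x # B @ [y]) \<and> successively E (x # C @ [y])"

abbreviation theta_set :: "nat \<Rightarrow> nat \<Rightarrow> nat list \<Rightarrow> nat list \<Rightarrow> nat list \<Rightarrow> nat set" where
  "theta_set x y A B C \<equiv> insert x (insert y (set A \<union> set B \<union> set C))"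

lemma theta_swap: "theta x y A B C \<Longrightarrow> theta x y B A C" "theta x y A B C \<Longrightarrow> theta x y A C B"
  unfolding theta_def by auto

lemma theta_subset: "theta x y A B C \<Longrightarrow> theta_set x y A B C \<subseteq> U"
  by (auto simp: theta_def)

lemma theta_perm_group: "theta x y A B C \<Longrightarrow> perm_group (loop_group (theta_set x y A B C) x)"
  by (rule perm_group_loop_group[OF _ theta_subset]) auto

text \<open>The hole leaves \<open>x\<close> along \<open>A\<close>, passes \<open>y\<close> and
  returns along \<open>B\<close>.\<close>

lemma theta_cycle_mem:
  assumes "theta x y A B C"
  shows "cycle_of_list (A @ y # rev B) \<in> loop_group (theta_set x y A B C) x"
proof (rule cycle_mem_loop_group)
  have B: "successively E (x # B @ [y])" "set (x # B @ [y]) \<subseteq> U" and A: "successively E ((x # A) @ [y])"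
    using assms by (auto simp: theta_def)
  have "walk U (rev (x # B @ [y]))"
    by (rule walk_rev) (use B in \<open>auto simp: walk_def\<close>)
  then have "successively E (y # rev B @ [x])" by (simp add: walk_def)
  from successively_append_common[OF A this]
  show "successively E (x # (A @ y # rev B) @ [x])" by simp
  show "distinct (x # A @ y # rev B)" using assms by (auto simp: theta_def)
qed auto

text \<open>The cycle through \<open>A\<close> and \<open>B\<close> fixes \<open>C\<close> pointwise and rotates everything else.\<close>
lemma theta_linked_outside:
  assumes th: "theta x y A B C" and S: "S = theta_set x y A B C"
    and c: "c \<in> set C" and s: "s \<in> S - {x}" "s \<notin> set C" and cs: "linked_at S x c s"
    and ne: "A \<noteq> [] \<or> B \<noteq> []" and z: "z \<in> S - {x}"
  shows "linked_at S x c z"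
proof -
  interpret K: perm_group "loop_group S x" unfolding S by (rule theta_perm_group[OF th])
  have d: "distinct (x # y # A @ B @ C)" using th by (simp add: theta_def)
  have ab: "cycle_of_list (A @ y # rev B) \<in> loop_group S x"
    unfolding S by (rule theta_cycle_mem[OF th])
  have bc: "cycle_of_list (B @ y # rev C) \<in> loop_group S x"
    using theta_cycle_mem[OF theta_swap(2)[OF theta_swap(1)[OF th]]] S by (simp add: Un_ac)
  have ac: "cycle_of_list (A @ y # rev C) \<in> loop_group S x"
    using theta_cycle_mem[OF theta_swap(2)[OF th]] S by (simp add: Un_ac)
  have l: "K.linked c b" if b: "b \<in> set (A @ y # rev B)" for b
    by (rule K.linked_fixed_point_cycle[OF _ ab _ _ cs b]) (use d c s S in auto)
  show ?thesis
  proof (cases "z \<in> set C")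
    case zC: True
    \<comment> \<open>A vertex \<open>a\<close> on another path is linked to \<open>c\<close> by
      now, and the cycle through \<open>C\<close> and the remaining path fixes \<open>a\<close>; so
      the link spreads over \<open>C\<close>.\<close>
    show ?thesis
    proof (cases "A = []")
      case False
      then obtain a where a: "a \<in> set A" by (cases A) auto
      then have "K.linked a c" using l K.linked_sym by auto
      then have "K.linked a z"
        using K.linked_fixed_point_cycle[OF _ bc, of a c z] d a c zC by auto
      then show ?thesis using \<open>K.linked a c\<close> K.linked_sym K.linked_trans by blast
    next
      case True
      then obtain a where a: "a \<in> set B" using ne by (cases B) auto
      then have "K.linked a c" using l K.linked_sym by auto
      then have "K.linked a z"
        using K.linked_fixed_point_cycle[OF _ ac, of a c z] d a c zC by auto
      then show ?thesis using \<open>K.linked a c\<close> K.linked_sym K.linked_trans by blast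
    qed
  next
    case False
    then show ?thesis using l z S by auto
  qed
qed

lemma walk_prefix:
  assumes "walk S w" "a \<in> set w"
  shows "\<exists>w'. walk S w' \<and> hd w' = hd w \<and> last w' = a"
proof -
  obtain p q where w: "w = p @ a # q" using assms(2) by (meson split_list)
  have "successively E ((p @ [a]) @ q)" using assms(1) by (simp add: w walk_def)
  then have "walk S (p @ [a])"
    using assms(1) unfolding successively_append_iff[of E "p @ [a]" q] by (auto simp: w walk_def)
  then show ?thesis by (intro exI[of _ "p @ [a]"]) (auto simp: w hd_append)
qed

lemma walk_connected_theta:
  assumes th: "theta x y A B C"
  shows "walk_connected (theta_set x y A B C)"
proof (rule walk_connectedI[where r = x])
  show "theta_set x y A B C \<subseteq> U" by (rule theta_subset[OF th])
  fix a assume "a \<in> theta_set x y A B C"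
  moreover have "walk (theta_set x y A B C) (x # A @ [y])" "walk (theta_set x y A B C) (x # B @ [y])"
    "walk (theta_set x y A B C) (x # C @ [y])"
    using th by (auto simp: walk_def theta_def)
  ultimately show "\<exists>w. walk (theta_set x y A B C) w \<and> hd w = x \<and> last w = a"
    using walk_prefix[of "theta_set x y A B C" "x # A @ [y]" a] walk_prefix[of "theta_set x y A B C" "x # B @ [y]" a]
      walk_prefix[of "theta_set x y A B C" "x # C @ [y]" a] by auto
qed

text \<open>Rotating until \<open>u\<close> sits at \<open>y\<close> turns a link within one path
  into a link between a path and a vertex outside it.\<close>

lemma theta_linked_rotate:
  assumes th: "theta x y A B C" and S: "S = theta_set x y A B C"
    and uv: "u \<in> set (A @ y # rev B)" "v \<in> set (A @ y # rev B)" "u \<noteq> v" "linked_at S x u v"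
  shows "\<exists>z\<in>set A \<union> set B. linked_at S x z y"
proof -
  interpret K: perm_group "loop_group S x" unfolding S by (rule theta_perm_group[OF th])
  define cs where "cs = A @ y # rev B"
  have d: "distinct cs" using th by (auto simp: theta_def cs_def)
  have g: "cycle_of_list cs \<in> loop_group S x"
    unfolding S cs_def by (rule theta_cycle_mem[OF th])
  have yc: "y \<in> set cs" by (simp add: cs_def)
  obtain n where n: "(cycle_of_list cs ^^ n) u = y"
    using cycle_transitive[OF d uv(1)[folded cs_def] yc] by blast
  define v' where "v' = (cycle_of_list cs ^^ n) v"
  have per: "(cycle_of_list cs ^^ n) permutes set cs" by (rule permutes_funpow[OF cycle_permutes])
  have "v' \<noteq> y" using n uv(3) per unfolding v'_def by (metis permutes_inj injD)
  moreover have "v' \<in> set cs" unfolding v'_def using uv(2) permutes_in_image[OF per] by (simp add: cs_def)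
  moreover have "K.linked y v'"
    using K.linked_image[OF uv(4) K.funpow_mem[OF g, of n]] n by (simp add: v'_def)
  ultimately show ?thesis using K.linked_sym by (auto simp: cs_def)
qed

text \<open>A single link is enough. It can be taken to leave one of the paths, after a rotation if
  both ends lie on the same path; the cycle through the other two paths then spreads it.\<close>

lemma theta_all_linked:
  assumes th: "theta x y A B C" and S: "S = theta_set x y A B C"
    and uv: "u \<in> S - {x}" "v \<in> S - {x}" "u \<noteq> v" "linked_at S x u v"
    and ne: "A \<noteq> [] \<or> B \<noteq> []" "A \<noteq> [] \<or> C \<noteq> []" "B \<noteq> [] \<or> C \<noteq> []"
  shows "all_linked S"
proof -
  interpret K: perm_group "loop_group S x" unfolding S by (rule theta_perm_group[OF th])
  have d: "distinct (x # y # A @ B @ C)" using th by (simp add: theta_def)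
  note th' = theta_swap(2)[OF th] theta_swap(1)[OF th] theta_swap(2)[OF theta_swap(1)[OF th]]
  have S': "S = theta_set x y A C B" "S = theta_set x y B A C" "S = theta_set x y B C A" using S by auto
  have y: "y \<in> S - {x}" "y \<notin> set A" "y \<notin> set B" "y \<notin> set C" using S d by auto
  have "\<exists>P\<in>{set A, set B, set C}. \<exists>c\<in>P. \<exists>s\<in>S - {x}. s \<notin> P \<and> K.linked c s"
  proof (cases "\<exists>P\<in>{set A, set B, set C}. (u \<in> P) \<noteq> (v \<in> P)")
    case True
    then show ?thesis using uv K.linked_sym by blast
  next
    case False
    then consider "u \<in> set A" "v \<in> set A" | "u \<in> set B" "v \<in> set B" | "u \<in> set C" "v \<in> set C"
      using uv S by auto
    then obtain z where "z \<in> set A \<union> set B \<union> set C" "K.linked z y"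
    proof cases
      case 1
      then show thesis using theta_linked_rotate[OF th S, of u v] uv that by auto
    next
      case 2
      then show thesis using theta_linked_rotate[OF th S, of u v] uv that by auto
    next
      case 3
      then show thesis using theta_linked_rotate[OF th'(1) S'(1), of u v] uv that by auto
    qed
    then show ?thesis using y by blast
  qed
  then obtain P c s where P: "P \<in> {set A, set B, set C}" "c \<in> P" "s \<in> S - {x}" "s \<notin> P" "K.linked c s"
    by blast
  have "K.linked c z" if z: "z \<in> S - {x}" for z
  proof -
    from P(1) consider "P = set A" | "P = set B" | "P = set C" by blast
    then show ?thesis
    proof cases
      case 1
      then show ?thesis
        using theta_linked_outside[OF th'(3) S'(3), of c s z] P z ne by auto
    next
      case 2
      then show ?thesis
        using theta_linked_outside[OF th'(1) S'(1), of c s z] P z ne by auto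
    next
      case 3
      then show ?thesis
        using theta_linked_outside[OF th S, of c s z] P z ne by auto
    qed
  qed
  then have "K.linked a b" if "a \<in> S - {x}" "b \<in> S - {x}" for a b
    using that K.linked_sym K.linked_trans by blast
  then show ?thesis
    using all_linkedI[of S x] theta_subset[OF th] walk_connected_theta[OF th] S by auto
qed

definition theta_three_cycle :: "nat \<Rightarrow> nat \<Rightarrow> nat list \<Rightarrow> nat list \<Rightarrow> nat list \<Rightarrow> bool" where
  "theta_three_cycle x y A B C \<longleftrightarrow>
     (\<exists>a b c. distinct [a, b, c] \<and> cycle_of_list [a, b, c] \<in> loop_group (theta_set x y A B C) x)"

lemma theta_three_cycle_swap:
  "theta_three_cycle x y B A C = theta_three_cycle x y A B C"
  "theta_three_cycle x y A C B = theta_three_cycle x y A B C"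
  unfolding theta_three_cycle_def by (simp_all add: Un_ac)

lemma all_linked_of_three_cycle:
  assumes th: "theta x y A B C" and "theta_three_cycle x y A B C"
    and ne: "A \<noteq> [] \<or> B \<noteq> []" "A \<noteq> [] \<or> C \<noteq> []" "B \<noteq> [] \<or> C \<noteq> []"
  shows "all_linked (theta_set x y A B C)"
proof -
  define S where "S = theta_set x y A B C"
  interpret K: perm_group "loop_group S x" unfolding S_def by (rule theta_perm_group[OF th])
  obtain a b c where abc: "distinct [a, b, c]" "cycle_of_list [a, b, c] \<in> loop_group S x"
    using assms(2) by (auto simp: theta_three_cycle_def S_def)
  then obtain w where w: "cycle_of_list [a, b, c] = cycle_of_list w" "walk S w" "hd w = x" "last w = x"
    by (auto simp: loop_group_def)
  \<comment> \<open>The 3-cycle comes from a closed walk in \<open>S\<close>, so it fixes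
    \<open>x\<close> and every vertex outside \<open>S\<close>.\<close>
  have fixed: "z \<in> S - {x}" if "cycle_of_list [a, b, c] z \<noteq> z" for z
    using that id_outside_supp[of z w] cycle_of_list_last[of w] w unfolding w(1) by (auto simp: walk_def)
  have "cycle_of_list [a, b, c] a = b" "cycle_of_list [a, b, c] b = c"
    using abc(1) by (auto simp: transpose_apply_other)
  then have "a \<in> S - {x}" "b \<in> S - {x}" using fixed[of a] fixed[of b] abc(1) by auto
  then show ?thesis
    using theta_all_linked[OF th refl, of a b] K.three_cycle_linked(1)[OF abc] abc(1) ne
    by (simp add: S_def)
qed

end

section \<open>Three-cycles from commutators of two cycles of a theta graph\<close>

context symmetric_graph
begin

text \<open>This is the cycle through \<open>B\<close> and \<open>C\<close> conjugated by the cycle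
  through \<open>a # A\<close> and \<open>B\<close>: the latter shifts \<open>B @ [y]\<close> by one
  place to \<open>a # B\<close> and fixes \<open>C\<close>.\<close>

lemma theta_shifted_cycle:
  assumes th: "theta x y (a # A) B C"
  shows "cycle_of_list (a # B @ rev C) \<in> loop_group (theta_set x y (a # A) B C) x"
proof -
  define g where "g = cycle_of_list ((a # A) @ y # rev B)"
  interpret K: perm_group "loop_group (theta_set x y (a # A) B C) x" by (rule theta_perm_group[OF th])
  have d: "distinct (x # y # (a # A) @ B @ C)" using th by (simp add: theta_def)
  have g: "g \<in> loop_group (theta_set x y (a # A) B C) x"
    unfolding g_def by (rule theta_cycle_mem[OF th])
  have h: "cycle_of_list (B @ y # rev C) \<in> loop_group (theta_set x y (a # A) B C) x"
    using theta_cycle_mem[OF theta_swap(2)[OF theta_swap(1)[OF th]]] by (simp add: Un_ac insert_commute)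
  have "map g ((a # A) @ y # rev B) = rotate1 ((a # A) @ y # rev B)"
    unfolding g_def by (rule cycle_map) (use d in auto)
  then have "map g (a # A) @ map g (y # rev B) = (A @ [y]) @ (rev B @ [a])" by simp
  then have "map g (y # rev B) = rev B @ [a]" by (subst (asm) append_eq_append_conv) auto
  then have "rev (map g (y # rev B)) = a # B" by (simp only: rev_append rev_rev_ident) simp
  then have "map g (B @ [y]) = a # B" by (simp add: rev_map)
  moreover have "map g (rev C) = rev C"
    unfolding g_def by (rule map_idI, rule id_outside_supp) (use d in auto)
  ultimately have "map g (B @ y # rev C) = a # B @ rev C" by simp
  moreover have "g \<circ> cycle_of_list (B @ y # rev C) \<circ> inv g = cycle_of_list (map g (B @ y # rev C))"
    by (rule conjugation_of_cycle[OF _ K.bij_mem[OF g]]) (use d in auto)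
  ultimately show ?thesis using K.comp_mem[OF K.comp_mem[OF g h] K.inv_mem[OF g]] by simp
qed

text \<open>This is the commutator of the cycles through \<open>A, B\<close> and through \<open>B, C\<close>: conjugating the
  second one only moves \<open>a\<close> in and \<open>y\<close> out.\<close>
lemma theta_commutator:
  assumes th: "theta x y (a # A) B (C @ [c])"
  shows "transpose a (hd (B @ [c])) \<circ> transpose y c \<in> loop_group (theta_set x y (a # A) B (C @ [c])) x"
proof -
  define t where "t = transpose y c"
  define h where "h = cycle_of_list (B @ y # c # rev C)"
  interpret K: perm_group "loop_group (theta_set x y (a # A) B (C @ [c])) x"
    by (rule theta_perm_group[OF th])
  have d: "distinct (x # y # (a # A) @ B @ C @ [c])" using th by (simp add: theta_def)
  have h: "h \<in> loop_group (theta_set x y (a # A) B (C @ [c])) x"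
    using theta_cycle_mem[OF theta_swap(2)[OF theta_swap(1)[OF th]]]
    by (simp add: Un_ac insert_commute h_def)
  have k: "cycle_of_list (a # B @ c # rev C) \<in> loop_group (theta_set x y (a # A) B (C @ [c])) x"
    using theta_shifted_cycle[OF th] by simp
  \<comment> \<open>Left multiplication by \<open>t\<close> deletes \<open>y\<close> from the cycle
    \<open>h\<close>; putting \<open>a\<close> in front then costs one more transposition.\<close>
  have "map t B = B"
    unfolding t_def by (rule map_idI) (use d in \<open>auto intro!: transpose_apply_other\<close>)
  then have "map t (B @ [y]) = B @ [c]" by (simp add: t_def)
  then have conj: "t \<circ> cycle_of_list (B @ [y]) \<circ> t = cycle_of_list (B @ [c])"
    using conjugation_of_cycle[of "B @ [y]" t] d by (simp add: t_def)
  have "h = cycle_of_list (B @ [y]) \<circ> (t \<circ> cycle_of_list (c # rev C))"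
    unfolding h_def cycle_of_list_append[of B y "c # rev C"] by (simp add: t_def)
  then have "t \<circ> h = cycle_of_list (B @ [c]) \<circ> cycle_of_list (c # rev C)"
    unfolding conj[symmetric] by (simp add: comp_assoc)
  also have "\<dots> = cycle_of_list (B @ c # rev C)" by (rule cycle_of_list_append[symmetric])
  finally have th': "t \<circ> h = cycle_of_list (B @ c # rev C)" .
  have "cycle_of_list (a # B @ c # rev C) = transpose a (hd (B @ [c])) \<circ> (t \<circ> h)"
    unfolding th' by (cases B) auto
  then have "transpose a (hd (B @ [c])) \<circ> t = cycle_of_list (a # B @ c # rev C) \<circ> inv h"
    using K.bij_mem[OF h] by (simp add: comp_assoc bij_is_surj surj_iff[THEN iffD1])
  then show ?thesis using K.comp_mem[OF k K.inv_mem[OF h]] by (simp add: t_def)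
qed

text \<open>When the middle path is empty, the two transpositions in \<open>theta_commutator\<close>
  share \<open>c\<close>, so the commutator is already a 3-cycle.\<close>

lemma theta_three_cycle_edge:
  assumes th: "theta x y A [] C" and "A \<noteq> []" "C \<noteq> []"
  shows "theta_three_cycle x y A [] C"
proof -
  obtain a A' where A: "A = a # A'" using assms(2) by (cases A) auto
  obtain C' c where C: "C = C' @ [c]" using assms(3) by (cases C rule: rev_cases) auto
  have "cycle_of_list [a, c, y] = transpose a (hd ([] @ [c])) \<circ> transpose y c"
    by (simp add: transpose_commute)
  then have "cycle_of_list [a, c, y] \<in> loop_group (theta_set x y A [] C) x"
    using theta_commutator[OF th[unfolded A C]] by (simp only: A C)
  moreover have "distinct [a, c, y]" using th by (auto simp: theta_def A C)
  ultimately show ?thesis unfolding theta_three_cycle_def by blast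
qed

text \<open>The commutator is a double transposition; its product with the conjugate by a \<open>d\<close>-fold
  rotation squares to a 3-cycle once the two share only the point \<open>c\<close>.\<close>
lemma theta_three_cycle_long:
  assumes th: "theta x y A B C" and ne: "A \<noteq> []" "C \<noteq> []"
    and d: "2 \<le> d" "d < length B" "d \<noteq> length A" "d \<noteq> length A + 1"
  shows "theta_three_cycle x y A B C"
proof -
  define S where "S = theta_set x y A B C"
  interpret K: perm_group "loop_group S x" unfolding S_def by (rule theta_perm_group[OF th])
  obtain a A' where A: "A = a # A'" using ne(1) by (cases A) auto
  obtain C' c where C: "C = C' @ [c]" using ne(2) by (cases C rule: rev_cases) auto
  obtain b B' where B: "B = b # B'" using d by (cases B) auto
  define L where "L = A @ y # rev B"
  define g where "g = cycle_of_list L"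
  define f where "f = transpose a b \<circ> transpose y c"
  have dis: "distinct (x # y # A @ B @ C)" using th by (simp add: theta_def)
  then have dL: "distinct L" by (auto simp: L_def)
  have len: "length L = length A + length B + 1" by (simp add: L_def)
  have gK: "g \<in> loop_group S x" unfolding g_def L_def S_def by (rule theta_cycle_mem[OF th])
  have fK: "f \<in> loop_group S x"
    using theta_commutator[OF th[unfolded A C]] unfolding f_def S_def A B C by simp
  have L: "L ! 0 = a" "L ! length A = y" "L ! (length A + length B) = b"
    by (simp add: L_def A) (simp add: L_def nth_append, simp add: L_def nth_append B)
  define s where "s = g ^^ d"
  have sK: "s \<in> loop_group S x" unfolding s_def by (rule K.funpow_mem[OF gK])
  have s: "s (L ! i) = L ! ((i + d) mod length L)" if "i < length L" for i
    unfolding s_def g_def by (rule distinct_cycle_nth[OF dL that])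
  have sc: "s c = c"
  proof -
    have "g c = c" unfolding g_def by (rule id_outside_supp) (use dis in \<open>auto simp: L_def C\<close>)
    then show ?thesis unfolding s_def by (induction d) auto
  qed
  have sa: "s a = L ! d" using s[of 0] L d len by simp
  \<comment> \<open>\<open>b\<close> is the last entry of \<open>L\<close>, so a shift by
    \<open>d\<close> wraps around to position \<open>d - 1\<close>.\<close>
  have "(length A + length B + d) mod length L = d - 1"
  proof -
    have "length A + length B + d = (d - 1) + length L" using d len by simp
    moreover have "d - 1 < length L" using d len by simp
    ultimately show ?thesis by (metis mod_add_self2 mod_less)
  qed
  then have sb: "s b = L ! (d - 1)" using s[of "length A + length B"] L len by simp
  have sy: "s y = L ! (length A + d)" using s[of "length A"] L d len by simp
  have cL: "c \<notin> set L" using dis by (auto simp: L_def C)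
  \<comment> \<open>Positions in \<open>L\<close> of \<open>a\<close>, \<open>b\<close>,
    \<open>y\<close> and of their images under \<open>s\<close>; the conditions on \<open>d\<close>
    keep these six apart.\<close>
  have idx: "distinct (map ((!) L) [0, length A + length B, length A, d, d - 1, length A + d])"
  proof -
    have "inj_on ((!) L) (set [0, length A + length B, length A, d, d - 1, length A + d])"
      by (rule inj_on_nth[OF dL]) (use d len in auto)
    moreover have "distinct [0, length A + length B, length A, d, d - 1, length A + d]"
      using d ne(1) by auto
    ultimately show ?thesis unfolding distinct_map by blast
  qed
  have "set (map ((!) L) [0, length A + length B, length A, d, d - 1, length A + d]) \<subseteq> set L"
    using d len by auto
  then have "c \<notin> set (map ((!) L) [0, length A + length B, length A, d, d - 1, length A + d])"
    using cL by blast
  then have dist: "distinct [a, b, y, c, s a, s b, s y]"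
    using idx unfolding sa sb sy list.map L by auto
  define f' where "f' = transpose (s a) (s b) \<circ> transpose (s y) c"
  have bs: "bij s" by (rule K.bij_mem[OF sK])
  have "s \<circ> transpose u v \<circ> inv s = transpose (s u) (s v)" if "u \<noteq> v" for u v
    using conjugation_of_cycle[of "[u, v]" s] bs that by simp
  then have "s \<circ> transpose a b \<circ> inv s \<circ> (s \<circ> transpose y c \<circ> inv s) = f'"
    using dist by (simp add: f'_def sc)
  moreover have "s \<circ> transpose a b \<circ> inv s \<circ> (s \<circ> transpose y c \<circ> inv s) = s \<circ> f \<circ> inv s"
    using bs by (simp add: f_def fun_eq_iff bij_is_inj)
  ultimately have f'K: "f' \<in> loop_group S x"
    using K.comp_mem[OF K.comp_mem[OF sK fK] K.inv_mem[OF sK]] by simp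
  have "cycle_of_list [c, y, s y] = (f \<circ> f') \<circ> (f \<circ> f')"
    by (rule double_transposition_square[symmetric, OF dist f_def f'_def])
  also have "\<dots> \<in> loop_group S x" by (intro K.comp_mem fK f'K)
  finally have "cycle_of_list [c, y, s y] \<in> loop_group S x" .
  moreover have "distinct [c, y, s y]" using dist by auto
  ultimately show ?thesis unfolding theta_three_cycle_def S_def by blast
qed

lemma theta_three_cycle_sorted:
  assumes th: "theta x y A B C" and le: "length A \<le> length B" "length B \<le> length C"
    and ne: "B \<noteq> []" and not122: "\<not> (length A = 1 \<and> length B = 2 \<and> length C = 2)"
  shows "theta_three_cycle x y A B C"
proof -
  define S where "S = theta_set x y A B C"
  interpret K: perm_group "loop_group S x" unfolding S_def by (rule theta_perm_group[OF th])
  have d: "distinct (x # y # A @ B @ C)" using th by (simp add: theta_def)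
  have ab: "cycle_of_list (A @ y # rev B) \<in> loop_group S x"
    unfolding S_def by (rule theta_cycle_mem[OF th])
  have bc: "cycle_of_list (B @ y # rev C) \<in> loop_group S x"
    using theta_cycle_mem[OF theta_swap(2)[OF theta_swap(1)[OF th]]] S_def by (simp add: Un_ac)
  have ac: "cycle_of_list (A @ y # rev C) \<in> loop_group S x"
    using theta_cycle_mem[OF theta_swap(2)[OF th]] S_def by (simp add: Un_ac)
  have cb: "cycle_of_list (C @ y # rev B) \<in> loop_group S x"
    using K.inv_mem[OF bc] by (simp add: inv_cycle_of_list)
  have ca: "cycle_of_list (C @ y # rev A) \<in> loop_group S x"
    using K.inv_mem[OF ac] by (simp add: inv_cycle_of_list)
  have Cne: "C \<noteq> []" using le ne by auto
  have three: ?thesis if "distinct [p, q, r]" "f = cycle_of_list [p, q, r]" "f \<in> loop_group S x" for p q r f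
    unfolding theta_three_cycle_def using that S_def by blast
  have long_bc: ?thesis if "length A \<ge> 1" "2 \<le> e" "e < length C" "e \<noteq> length B" "e \<noteq> length B + 1" for e
  proof -
    have "theta x y B C A" by (rule theta_swap(2)[OF theta_swap(1)[OF th]])
    then have "theta_three_cycle x y B C A"
      using theta_three_cycle_long ne that by force
    then show ?thesis by (simp add: theta_three_cycle_swap)
  qed
  have long_ac: ?thesis if "length A \<ge> 1" "2 \<le> e" "e < length C" "e \<noteq> length A" "e \<noteq> length A + 1" for e
  proof -
    have "theta x y A C B" by (rule theta_swap(2)[OF th])
    then have "theta_three_cycle x y A C B"
      using theta_three_cycle_long ne that by force
    then show ?thesis by (simp add: theta_three_cycle_swap)
  qed
  have "length B \<ge> 1" using ne by (cases B) auto
  define a b c where abc: "a = length A" "b = length B" "c = length C"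
  \<comment> \<open>Type (0,b,c) is settled by the empty path; in type (1,1,c) the cycle through
    \<open>A\<close> and \<open>B\<close> is itself a 3-cycle; longer paths admit a suitable
    rotation number \<open>d\<close>. Types (1,2,3), (2,2,2), (2,2,3) and (2,2,4) admit none and
    rely on the explicit words.\<close>
  have "a = 0 \<or> a = 1 \<and> b = 1 \<or> a \<ge> 1 \<and> b \<ge> 3 \<or> a \<ge> 1 \<and> b = 2 \<and> c \<ge> 5 \<or>
      a = 1 \<and> b = 2 \<and> (c = 3 \<or> c = 4) \<or> a = 2 \<and> b = 2 \<and> (c = 2 \<or> c = 3 \<or> c = 4)"
  proof (cases "a = 0 \<or> b \<ge> 3")
    case False
    have l: "a \<le> b" "b \<le> c" "1 \<le> b" using le \<open>length B \<ge> 1\<close> by (simp_all add: abc)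
    then have "b = 1 \<and> a = 1 \<or> b = 2 \<and> (a = 1 \<or> a = 2)" using False by linarith
    moreover have "c = 2 \<or> c = 3 \<or> c = 4 \<or> c \<ge> 5 \<or> b = 1" using l False by linarith
    ultimately show ?thesis using not122 False by (auto simp: abc[symmetric])
  qed auto
  then show ?thesis
    unfolding abc
  proof (elim disjE conjE, goal_cases)
    case 1
    then have "theta x y B [] C" using theta_swap(1)[OF th] by simp
    from theta_three_cycle_edge[OF this ne Cne] show ?thesis
      using 1 theta_three_cycle_swap(1) by simp
  next
    case 2
    then obtain a b where AB: "A = [a]" "B = [b]" by (auto simp: length_Suc_conv)
    show ?thesis
      by (rule three[of a y b, OF _ refl]) (use d ab in \<open>simp_all add: AB\<close>)
  next
    case 3
    then show ?thesis using long_bc[of 2] le by auto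
  next
    case 4
    then show ?thesis using long_bc[of 4] le by auto
  next
    case 5
    then obtain a1 b1 b2 c1 c2 c3 where ABC: "A = [a1]" "B = [b1, b2]" "C = [c1, c2, c3]"
      by (auto simp: length_Suc_conv numeral_eq_Suc)
    have "distinct [a1, b1, b2, c1, c2, c3, y]" using d by (auto simp: ABC)
    from three[OF _ three_cycle_word_123[OF this refl refl refl]] d ab bc ac show ?thesis
      unfolding ABC by (auto intro!: K.comp_mem simp del: cycle_of_list.simps)
  next
    case 6
    then show ?thesis using long_ac[of 3] by auto
  next
    case 7
    then obtain a1 a2 b1 b2 c1 c2 where ABC: "A = [a1, a2]" "B = [b1, b2]" "C = [c1, c2]"
      by (auto simp: length_Suc_conv numeral_eq_Suc)
    have "distinct [a1, a2, b1, b2, c1, c2, y]" using d by (auto simp: ABC)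
    from three[OF _ three_cycle_word_222[OF this refl refl]] d ab bc ac show ?thesis
      unfolding ABC by (auto intro!: K.comp_mem simp del: cycle_of_list.simps)
  next
    case 8
    then obtain a1 a2 b1 b2 c1 c2 c3 where ABC: "A = [a1, a2]" "B = [b1, b2]" "C = [c1, c2, c3]"
      by (auto simp: length_Suc_conv numeral_eq_Suc)
    have "distinct [a1, a2, b1, b2, c1, c2, c3, y]" using d by (auto simp: ABC)
    from three[OF _ three_cycle_word_223[OF this refl refl refl refl refl]] d ab bc ac ca cb show ?thesis
      unfolding ABC by (auto intro!: K.comp_mem simp del: cycle_of_list.simps)
  next
    case 9
    then obtain a1 a2 b1 b2 c1 c2 c3 c4 where ABC: "A = [a1, a2]" "B = [b1, b2]" "C = [c1, c2, c3, c4]"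
      by (auto simp: length_Suc_conv numeral_eq_Suc)
    have "distinct [a1, a2, b1, b2, c1, c2, c3, c4, y]" using d by (auto simp: ABC)
    from three[OF _ three_cycle_word_224[OF this refl refl refl refl refl]] d ab bc ac ca cb show ?thesis
      unfolding ABC by (auto intro!: K.comp_mem simp del: cycle_of_list.simps)
  qed
qed

text \<open>The three paths play symmetric roles, so they may be sorted by length. The excluded type
  is that of theta_0.\<close>

lemma theta_all_linked_unless_122:
  assumes th: "theta x y A B C"
    and two: "A \<noteq> [] \<or> B \<noteq> []" "A \<noteq> [] \<or> C \<noteq> []" "B \<noteq> [] \<or> C \<noteq> []"
    and sort: "sort [length A, length B, length C] \<noteq> [1, 2, 2]"
  shows "all_linked (theta_set x y A B C)"
proof (rule all_linked_of_three_cycle[OF th _ two])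
  have n: "\<not> (length A = 1 \<and> length B = 2 \<and> length C = 2)" "\<not> (length B = 1 \<and> length A = 2 \<and> length C = 2)"
    "\<not> (length C = 1 \<and> length A = 2 \<and> length B = 2)"
    using sort by force+
  show "theta_three_cycle x y A B C"
  proof (cases "length A \<le> length B")
    case AB: True
    consider "length B \<le> length C" | "length A \<le> length C" "length C \<le> length B" | "length C \<le> length A"
      by linarith
    then show ?thesis
    proof cases
      case 1
      show ?thesis by (rule theta_three_cycle_sorted[OF th AB 1]) (use n two AB 1 in auto)
    next
      case 2
      have "theta_three_cycle x y A C B"
        by (rule theta_three_cycle_sorted[OF theta_swap(2)[OF th] 2]) (use n two 2 in auto)
      then show ?thesis by (simp add: theta_three_cycle_swap)
    next
      case 3
      have "theta_three_cycle x y C A B"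
        by (rule theta_three_cycle_sorted[OF theta_swap(1)[OF theta_swap(2)[OF th]] 3 AB])
          (use n two 3 AB in auto)
      then show ?thesis by (simp add: theta_three_cycle_swap)
    qed
  next
    case False
    then have BA: "length B \<le> length A" by simp
    consider "length A \<le> length C" | "length B \<le> length C" "length C \<le> length A" | "length C \<le> length B"
      by linarith
    then show ?thesis
    proof cases
      case 1
      have "theta_three_cycle x y B A C"
        by (rule theta_three_cycle_sorted[OF theta_swap(1)[OF th] BA 1]) (use n two BA 1 in auto)
      then show ?thesis by (simp add: theta_three_cycle_swap)
    next
      case 2
      have "theta_three_cycle x y B C A"
        by (rule theta_three_cycle_sorted[OF theta_swap(2)[OF theta_swap(1)[OF th]] 2]) (use n two 2 in auto)
      then show ?thesis by (simp add: theta_three_cycle_swap)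
    next
      case 3
      have "theta_three_cycle x y C B A"
        by (rule theta_three_cycle_sorted[OF theta_swap(1)[OF theta_swap(2)[OF theta_swap(1)[OF th]]] 3 BA])
          (use n two 3 BA in auto)
      then show ?thesis by (simp add: theta_three_cycle_swap)
    qed
  qed
qed

end

section \<open>Linking all vertices of a non-separable graph\<close>

text \<open>Entries \<open>(i, j, P, Q)\<close>: the cycle of \<open>\<theta>\<^sub>0\<close> through \<open>i\<close> and \<open>j\<close> consisting of the two paths
  with interiors \<open>P\<close> and \<open>Q\<close>. Together with an ear from \<open>i\<close> to \<open>j\<close> it forms a theta graph.\<close>
definition theta0_cycles :: "(nat \<times> nat \<times> nat list \<times> nat list) list" where
  "theta0_cycles =
    [(0, 1, [], [5, 4, 3, 2]), (0, 2, [1], [5, 4, 3]), (0, 3, [1, 2], [5, 4]), (0, 3, [1, 2], [6]),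
     (0, 4, [1, 2, 3], [5]), (0, 5, [1, 2, 3, 4], []), (0, 6, [1, 2, 3], []), (1, 2, [0, 5, 4, 3], []),
     (1, 3, [0, 5, 4], [2]), (1, 4, [0, 5], [2, 3]), (1, 5, [0], [2, 3, 4]), (1, 6, [0], [2, 3]),
     (2, 3, [1, 0, 5, 4], []), (2, 4, [1, 0, 5], [3]), (2, 5, [1, 0], [3, 4]), (2, 6, [1, 0], [3]),
     (3, 4, [2, 1, 0, 5], []), (3, 5, [2, 1, 0], [4]), (3, 6, [2, 1, 0], []), (4, 5, [3, 2, 1, 0], []),
     (4, 6, [3], [5, 0]), (5, 6, [0], [4, 3])]"

lemma theta0_cycles_valid:
  assumes "(i, j, P, Q) \<in> set theta0_cycles"
  shows "distinct (i # j # P @ Q)" "set (i # j # P @ Q) \<subseteq> {..<7}"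
    "successively theta0_adj (i # P @ [j])" "successively theta0_adj (i # Q @ [j])"
proof -
  have "\<forall>(i, j, P, Q) \<in> set theta0_cycles. distinct (i # j # P @ Q) \<and> list_all (\<lambda>a. a < 7) (i # j # P @ Q) \<and>
      successively theta0_adj (i # P @ [j]) \<and> successively theta0_adj (i # Q @ [j])"
    by code_simp
  then show "distinct (i # j # P @ Q)" "set (i # j # P @ Q) \<subseteq> {..<7}"
    "successively theta0_adj (i # P @ [j])" "successively theta0_adj (i # Q @ [j])"
    using assms by (fastforce simp: list_all_iff)+
qed

text \<open>An ear with \<open>k\<close> interior vertices yields a theta graph other than \<open>\<theta>\<^sub>0\<close> in this way except in six
  cases, which need a theta graph using only part of the cycle.\<close>
lemma theta0_cycles_cover:
  assumes "i < j" "j < 7" "k \<noteq> 0 \<or> \<not> theta0_adj i j"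
    and "(i, j, k) \<notin> set [(1, 4, 1), (2, 5, 1), (1, 6, 2), (2, 6, 2), (4, 6, 2), (5, 6, 2)]"
  shows "\<exists>P Q. (i, j, P, Q) \<in> set theta0_cycles \<and> (k \<noteq> 0 \<or> P \<noteq> [] \<and> Q \<noteq> []) \<and> (P \<noteq> [] \<or> Q \<noteq> []) \<and>
    sort [length P, length Q, k] \<noteq> [1, 2, 2]"
proof -
  have "\<forall>j\<in>set [0..<7]. \<forall>i\<in>set [0..<j]. \<forall>k\<in>set [0..<4]. k \<noteq> 0 \<or> \<not> theta0_adj i j \<longrightarrow>
      (i, j, k) \<notin> set [(1, 4, 1), (2, 5, 1), (1, 6, 2), (2, 6, 2), (4, 6, 2), (5, 6, 2)] \<longrightarrow>
      (\<exists>(i', j', P, Q) \<in> set theta0_cycles. i' = i \<and> j' = j \<and> (k \<noteq> 0 \<or> P \<noteq> [] \<and> Q \<noteq> []) \<and>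
        (P \<noteq> [] \<or> Q \<noteq> []) \<and> sort [length P, length Q, k] \<noteq> [1, 2, 2])"
    by code_simp
  \<comment> \<open>Capping \<open>k\<close> at 3 makes the check finite: an entry of 3 or more
    always keeps the sorted triple away from \<open>[1, 2, 2]\<close>.\<close>
  moreover have "j \<in> set [0..<7]" "i \<in> set [0..<j]" "min k 3 \<in> set [0..<4]" using assms by auto
  moreover have "min k 3 \<noteq> 0 \<or> \<not> theta0_adj i j" using assms(3) by auto
  moreover have "(i, j, min k 3) \<notin> set [(1, 4, 1), (2, 5, 1), (1, 6, 2), (2, 6, 2), (4, 6, 2), (5, 6, 2)]"
    using assms(4) by (auto simp: min_def split: if_splits)
  ultimately have "\<exists>(i', j', P, Q) \<in> set theta0_cycles. i' = i \<and> j' = j \<and> (min k 3 \<noteq> 0 \<or> P \<noteq> [] \<and> Q \<noteq> []) \<and>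
      (P \<noteq> [] \<or> Q \<noteq> []) \<and> sort [length P, length Q, min k 3] \<noteq> [1, 2, 2]"
    by blast
  then obtain P Q where PQ: "(i, j, P, Q) \<in> set theta0_cycles" "min k 3 \<noteq> 0 \<or> P \<noteq> [] \<and> Q \<noteq> []"
    "P \<noteq> [] \<or> Q \<noteq> []" "sort [length P, length Q, min k 3] \<noteq> [1, 2, 2]" by blast
  have "sort [length P, length Q, k] \<noteq> [1, 2, 2]"
  proof (cases "k \<le> 3")
    case False
    have "k \<in> set (sort [length P, length Q, k])" unfolding set_sort by simp
    then show ?thesis using False by auto
  qed (use PQ(4) in \<open>simp add: min_def\<close>)
  moreover have "k \<noteq> 0 \<or> P \<noteq> [] \<and> Q \<noteq> []" using PQ(2) by auto
  ultimately show ?thesis using PQ(1,3) by blast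
qed

lemma iso_to_of_list:
  assumes "distinct cs" "set cs = {1..V}" "length cs = n"
    and "\<And>a b. a < n \<Longrightarrow> b < n \<Longrightarrow> E (cs ! a) (cs ! b) \<longleftrightarrow> F a b"
  shows "iso_to V E n F"
proof -
  have b: "bij_betw ((!) cs) {0..<n} {1..V}"
    using bij_betw_nth[OF assms(1), of "{0..<n}" "{1..V}"] assms(2,3) by (simp add: atLeast0LessThan)
  define f where "f = inv_into {0..<n} ((!) cs)"
  have f: "bij_betw f {1..V} {0..<n}" unfolding f_def by (rule bij_betw_inv_into[OF b])
  have "cs ! f i = i" if "i \<in> {1..V}" for i
    unfolding f_def using b that by (metis bij_betw_inv_into_right)
  moreover have "f i < n" if "i \<in> {1..V}" for i
    using bij_betwE[OF f] that by auto
  ultimately have "E i j \<longleftrightarrow> F (f i) (f j)" if "i \<in> {1..V}" "j \<in> {1..V}" for i j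
    using assms(4)[of "f i" "f j"] that by metis
  then show ?thesis unfolding iso_to_def using f by blast
qed

context symmetric_graph
begin

lemma ear_rev: "ear S u p v \<Longrightarrow> S \<subseteq> U \<Longrightarrow> ear S v (rev p) u"
proof -
  assume e: "ear S u p v" "S \<subseteq> U"
  have "walk U (u # p @ [v])" using e by (auto simp: ear_def walk_def)
  then have "walk U (rev (u # p @ [v]))" by (rule walk_rev) simp
  then show ?thesis using e by (auto simp: ear_def walk_def)
qed

lemma theta_of_indices:
  assumes zs: "distinct zs" "length zs = 7" "set zs \<subseteq> U"
    and edges: "\<And>a b. a < 7 \<Longrightarrow> b < 7 \<Longrightarrow> theta0_adj a b \<Longrightarrow> E (zs ! a) (zs ! b)"
    and ear: "ear (set zs) (zs ! i) p (zs ! j)" and ij: "(i, j, P, Q) \<in> set theta0_cycles"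
  shows "theta (zs ! i) (zs ! j) (map ((!) zs) P) (map ((!) zs) Q) p"
proof -
  note v = theta0_cycles_valid[OF ij]
  have succ: "successively E (map ((!) zs) w)" if "successively theta0_adj w" "set w \<subseteq> {..<7}" for w
    unfolding successively_map
    using that(1) by (rule successively_mono) (use that(2) edges in auto)
  have less: "\<forall>a\<in>set (i # j # P @ Q). a < length zs"
    using v(2) by (simp add: zs(2) subset_eq)
  then have d: "distinct (map ((!) zs) (i # j # P @ Q))"
    unfolding distinct_map by (intro conjI v(1) inj_on_nth[OF zs(1)])
  have sub: "(!) zs ` set (i # j # P @ Q) \<subseteq> set zs"
    using less nth_mem by blast
  have "set (i # P @ [j]) \<subseteq> {..<7}" "set (i # Q @ [j]) \<subseteq> {..<7}" using v(2) by simp_all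
  from succ[OF v(3) this(1)] succ[OF v(4) this(2)]
  have "successively E (zs ! i # map ((!) zs) P @ [zs ! j])" "successively E (zs ! i # map ((!) zs) Q @ [zs ! j])"
    by simp_all
  moreover have "distinct (zs ! i # zs ! j # map ((!) zs) P @ map ((!) zs) Q @ p)"
    using d sub ear unfolding ear_def by auto
  moreover have "set (zs ! i # zs ! j # map ((!) zs) P @ map ((!) zs) Q @ p) \<subseteq> U"
    using sub zs(3) ear unfolding ear_def by auto
  ultimately show ?thesis
    using ear unfolding theta_def ear_def by blast
qed

lemma card_theta_set:
  assumes "theta x y A B C" "A \<noteq> [] \<or> B \<noteq> []"
  shows "card (theta_set x y A B C) \<ge> 3"
proof -
  have "theta_set x y A B C = set (x # y # A @ B @ C)" by auto
  then have "card (theta_set x y A B C) = length (x # y # A @ B @ C)"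
    using assms(1) unfolding theta_def by (metis distinct_card)
  then show ?thesis using assms(2) by (cases A; cases B) auto
qed

lemma theta0_ear_all_linked:
  assumes zs: "distinct zs" "length zs = 7" "set zs \<subseteq> U"
    and edges: "\<And>a b. a < 7 \<Longrightarrow> b < 7 \<Longrightarrow> theta0_adj a b \<Longrightarrow> E (zs ! a) (zs ! b)"
    and ear: "ear (set zs) (zs ! i) p (zs ! j)" and ij: "i < j" "j < 7" "p \<noteq> [] \<or> \<not> theta0_adj i j"
  shows "\<exists>S. all_linked S \<and> card S \<ge> 3"
proof -
  have goal: ?thesis if "theta x y A B C" "A \<noteq> [] \<or> B \<noteq> []" "A \<noteq> [] \<or> C \<noteq> []" "B \<noteq> [] \<or> C \<noteq> []"
    "sort [length A, length B, length C] \<noteq> [1, 2, 2]" for x y A B C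
    using theta_all_linked_unless_122[OF that] card_theta_set[OF that(1,2)] by blast
  show ?thesis
  proof (cases "(i, j, length p) \<in> set [(1, 4, 1), (2, 5, 1), (1, 6, 2), (2, 6, 2), (4, 6, 2), (5, 6, 2)]")
    case False
    obtain P Q where PQ: "(i, j, P, Q) \<in> set theta0_cycles" "length p \<noteq> 0 \<or> P \<noteq> [] \<and> Q \<noteq> []"
      "P \<noteq> [] \<or> Q \<noteq> []" "sort [length P, length Q, length p] \<noteq> [1, 2, 2]"
      using theta0_cycles_cover[OF ij(1,2) _ False] ij(3) length_0_conv[of p] by blast
    show ?thesis
    proof (rule goal[OF theta_of_indices[OF zs edges ear PQ(1)]])
      show "sort [length (map ((!) zs) P), length (map ((!) zs) Q), length p] \<noteq> [1, 2, 2]"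
        using PQ(4) by (simp only: length_map not_False_eq_True)
    qed (use PQ(2,3) in auto)
  next
    case True
    obtain z0 z1 z2 z3 z4 z5 z6 where z: "zs = [z0, z1, z2, z3, z4, z5, z6]"
      using zs(2) by (auto simp: length_Suc_conv numeral_eq_Suc)
    have e: "E z0 z1" "E z1 z2" "E z2 z3" "E z3 z4" "E z4 z5" "E z5 z0" "E z0 z6" "E z6 z3"
      using edges[of 0 1] edges[of 1 2] edges[of 2 3] edges[of 3 4] edges[of 4 5] edges[of 5 0]
        edges[of 0 6] edges[of 6 3] by (simp_all add: z theta0_adj_def cycle_adj_def)
    have e': "E z1 z0" "E z2 z1" "E z3 z2" "E z4 z3" "E z5 z4" "E z0 z5" "E z6 z0" "E z3 z6"
      using edges[of 1 0] edges[of 2 1] edges[of 3 2] edges[of 4 3] edges[of 5 4] edges[of 0 5]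
        edges[of 6 0] edges[of 3 6] by (simp_all add: z theta0_adj_def cycle_adj_def)
    have zU: "{z0, z1, z2, z3, z4, z5, z6} \<subseteq> U" "distinct [z0, z1, z2, z3, z4, z5, z6]"
      using zs unfolding z by simp_all
    have eq: "successively E (zs ! j # rev p @ [zs ! i])" "set p \<subseteq> U" "distinct p"
      "set p \<inter> {z0, z1, z2, z3, z4, z5, z6} = {}" "successively E (zs ! i # p @ [zs ! j])"
      using ear_rev[OF ear zs(3)] ear unfolding ear_def z by auto
    \<comment> \<open>Each theta graph below drops one edge of theta_0: \<open>z3 z4\<close> or
      \<open>z2 z3\<close> in the first two cases, of sorted type (0,3,3), and \<open>z6 z3\<close>
      in the others, where the edge from \<open>z6\<close> to \<open>z0\<close> prolongs the ear and
      the types are (0,3,4) and (1,3,3).\<close>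
    from True consider (1) "i = 1" "j = 4" "length p = 1" | (2) "i = 2" "j = 5" "length p = 1"
      | (3) "i = 1" "j = 6" "length p = 2" | (4) "i = 2" "j = 6" "length p = 2"
      | (5) "i = 4" "j = 6" "length p = 2" | (6) "i = 5" "j = 6" "length p = 2" by auto
    then show ?thesis
    proof cases
      case 1
      then obtain q where p: "p = [q]" by (auto simp: length_Suc_conv)
      have "theta z0 z1 [] [z5, z4, q] [z6, z3, z2]"
        unfolding theta_def using e e' zU eq 1 by (auto simp: p z)
      from goal[OF this] show ?thesis by simp
    next
      case 2
      then obtain q where p: "p = [q]" by (auto simp: length_Suc_conv)
      have "theta z0 z5 [z1, z2, q] [] [z6, z3, z4]"
        unfolding theta_def using e e' zU eq 2 by (auto simp: p z)
      from goal[OF this] show ?thesis by simp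
    next
      case 3
      then obtain q r where p: "p = [q, r]" by (auto simp: length_Suc_conv numeral_2_eq_2)
      have "theta z0 z1 [] [z5, z4, z3, z2] [z6, r, q]"
        unfolding theta_def using e e' zU eq 3 by (auto simp: p z)
      from goal[OF this] show ?thesis by simp
    next
      case 4
      then obtain q r where p: "p = [q, r]" by (auto simp: length_Suc_conv numeral_2_eq_2)
      have "theta z0 z2 [z1] [z5, z4, z3] [z6, r, q]"
        unfolding theta_def using e e' zU eq 4 by (auto simp: p z)
      from goal[OF this] show ?thesis by simp
    next
      case 5
      then obtain q r where p: "p = [q, r]" by (auto simp: length_Suc_conv numeral_2_eq_2)
      have "theta z0 z4 [z1, z2, z3] [z5] [z6, r, q]"
        unfolding theta_def using e e' zU eq 5 by (auto simp: p z)
      from goal[OF this] show ?thesis by simp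
    next
      case 6
      then obtain q r where p: "p = [q, r]" by (auto simp: length_Suc_conv numeral_2_eq_2)
      have "theta z0 z5 [z1, z2, z3, z4] [] [z6, r, q]"
        unfolding theta_def using e e' zU eq 6 by (auto simp: p z)
      from goal[OF this] show ?thesis by simp
    qed
  qed
qed

definition closed_path :: "nat list \<Rightarrow> bool" where
  "closed_path cs \<longleftrightarrow> distinct cs \<and> set cs \<subseteq> U \<and> length cs \<ge> 3 \<and> successively E cs \<and> E (last cs) (hd cs)"

lemma theta_of_closed_path_ear:
  assumes cs: "closed_path cs" and split: "cs = c1 @ u # c2 @ v # c3" and ear: "ear (set cs) u p v"
  shows "theta u v c2 (rev (c3 @ c1)) p"
proof -
  have "successively E (v # c3)" "successively E (c1 @ [u])"
    and A: "successively E (u # c2 @ [v])"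
    using cs unfolding closed_path_def split by (auto simp: successively_append_iff successively_Cons hd_append)
  moreover have "E (last (v # c3)) (hd (c1 @ [u]))"
    using cs unfolding closed_path_def split by (auto simp: hd_append)
  ultimately have "successively E ((v # c3) @ c1 @ [u])"
    by (subst successively_append_iff) auto
  then have "walk U (v # c3 @ c1 @ [u])"
    using cs unfolding closed_path_def split walk_def by auto
  then have "walk U (rev (v # c3 @ c1 @ [u]))" by (rule walk_rev) simp
  then have "successively E (u # rev (c3 @ c1) @ [v])" by (simp add: walk_def)
  with A show ?thesis
    using cs ear unfolding theta_def closed_path_def ear_def split by auto
qed

end

section \<open>Ears, cycles and theta subgraphs of a non-separable graph\<close>

locale nonseparable_graph = symmetric_graph +
  assumes irrefl: "x \<in> U \<Longrightarrow> \<not> E x x"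
    and card_U: "card U \<ge> 4"
    and conn: "walk_connected U" and conn_del: "v \<in> U \<Longrightarrow> walk_connected (U - {v})"
begin

text \<open>Connectivity provides an edge leaving \<open>S\<close> at some \<open>s\<close>, and
  connectivity after deleting \<open>s\<close> provides a path from its outer end back to
  \<open>S\<close>. Cut at its first vertex in \<open>S\<close>, this path ends away from
  \<open>s\<close>.\<close>

lemma exists_ear:
  assumes S: "S \<subset> U" and two: "a \<in> S" "b \<in> S" "a \<noteq> b"
  obtains u p v where "ear S u p v" "p \<noteq> []"
proof -
  obtain c where c: "c \<in> U - S" using S by blast
  obtain w where w: "walk U w" "hd w = a" "last w = c"
    using conn two c S unfolding walk_connected_def by blast
  have "\<exists>s t. s \<in> S \<and> t \<in> U - S \<and> E s t"
    using w(1) w(2) w(3) two(1)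
  proof (induction w arbitrary: a)
    case (Cons z w)
    show ?case
    proof (cases "w = []")
      case True
      then show ?thesis using Cons.prems c by auto
    next
      case False
      then have w: "walk U w" "E z (hd w)" "hd w \<in> U"
        using Cons.prems by (auto simp: walk_def successively_Cons)
      show ?thesis
      proof (cases "hd w \<in> S")
        case True
        then show ?thesis using Cons.IH[OF w(1) refl] Cons.prems(3) False by auto
      next
        case n: False
        then show ?thesis using w Cons.prems by auto
      qed
    qed
  qed (simp add: walk_def)
  then obtain s t where st: "s \<in> S" "t \<in> U - S" "E s t" by blast
  obtain s' where s': "s' \<in> S" "s' \<noteq> s" using two by blast
  have "s \<in> U" "t \<in> U - {s}" "s' \<in> U - {s}" using st s' S by auto
  then obtain w where w: "walk (U - {s}) w" "hd w = t" "last w = s'"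
    using conn_del unfolding walk_connected_def by blast
  obtain q where q: "walk (U - {s}) q" "distinct q" "hd q = t" "last q = s'"
    using distinct_path_of_walk[OF w(1)] w by metis
  define p r where "p = takeWhile (\<lambda>z. z \<notin> S) q" and "r = dropWhile (\<lambda>z. z \<notin> S) q"
  have qpr: "q = p @ r" by (simp add: p_def r_def)
  have qne: "q \<noteq> []" using q by (simp add: walk_def)
  then have "s' \<in> set q" using q(4) last_in_set by blast
  then have rne: "r \<noteq> []" unfolding r_def using s' by (auto simp: dropWhile_eq_Nil_conv)
  then obtain v r' where r: "r = v # r'" by (cases r) auto
  have vS: "v \<in> S" using hd_dropWhile[of "\<lambda>z. z \<notin> S" q] rne r unfolding r_def by simp
  have pS: "set p \<inter> S = {}" unfolding p_def using set_takeWhileD by fastforce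
  have pne: "p \<noteq> []" using q(3) st qne unfolding p_def by (cases q) auto
  then have hp: "hd p = t" using q(3) qpr by simp
  have "successively E (p @ [v])"
    using q(1) unfolding walk_def qpr r by (auto simp: successively_append_iff)
  then have "successively E (s # p @ [v])"
    using st(3) hp pne by (cases p) auto
  moreover have "v \<noteq> s" "set p \<subseteq> U" "distinct p"
    using q(1,2) unfolding walk_def qpr r by auto
  ultimately have "ear S s p v"
    using st vS pS by (auto simp: ear_def)
  then show thesis using pne that by blast
qed

text \<open>Every ear found adds a vertex, so repeated attachment exhausts the graph.\<close>

lemma all_linked_extend:
  assumes "all_linked S" "card S \<ge> 3"
  shows "all_linked U"
  using assms
proof (induction "card (U - S)" arbitrary: S rule: less_induct)
  case less
  have SU: "S \<subseteq> U" using less.prems(1) by (simp add: all_linked_def)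
  show ?case
  proof (cases "S = U")
    case True
    then show ?thesis using less.prems by simp
  next
    case False
    then have SU': "S \<subset> U" using SU by blast
    have "\<not> card S \<le> Suc 0" using less.prems(2) by simp
    then obtain a b where ab: "a \<in> S" "b \<in> S" "a \<noteq> b"
      using card_le_Suc0_iff_eq[of S] finite_subset[OF SU fin] by blast
    obtain u p v where ear: "ear S u p v" "p \<noteq> []"
      using exists_ear[OF SU' ab] by blast
    have "all_linked (S \<union> set p)" by (rule all_linked_ear[OF less.prems(1) ear(1) less.prems(2)])
    moreover have "card S \<le> card (S \<union> set p)"
      using SU fin finite_subset by (intro card_mono) auto
    moreover have "card (U - (S \<union> set p)) < card (U - S)"
    proof (rule psubset_card_mono)
      show "U - (S \<union> set p) \<subset> U - S"
        using ear by (cases p) (auto simp: ear_def)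
    qed (use fin in auto)
    ultimately show ?thesis using less.hyps[of "S \<union> set p"] less.prems(2) by linarith
  qed
qed

text \<open>The cycle is an ear on the two ends of an edge, closed up by that edge.\<close>

lemma exists_closed_path: obtains cs where "closed_path cs"
proof -
  have "\<not> card U \<le> Suc 0" using card_U by simp
  then obtain a b where ab: "a \<in> U" "b \<in> U" "a \<noteq> b"
    using card_le_Suc0_iff_eq[OF fin] by blast
  obtain w where w: "walk U w" "hd w = a" "last w = b"
    using conn ab unfolding walk_connected_def by blast
  obtain c w' where "w = a # c # w'"
    using w ab by (metis last.simps list.exhaust_sel walk_def)
  then have ac: "E a c" "c \<in> U" using w(1) by (auto simp: walk_def)
  then have "a \<noteq> c" using irrefl ab by auto
  have "card {a, c} \<le> 2" by (simp add: card_insert_if)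
  then have "{a, c} \<noteq> U" using card_U by auto
  then have "{a, c} \<subset> U" using ab ac by blast
  from exists_ear[OF this _ _ \<open>a \<noteq> c\<close>] obtain u p v where ear: "ear {a, c} u p v" "p \<noteq> []" by blast
  have "E c a" using sym ac ab by blast
  then have "E v u" using ear ac unfolding ear_def by auto
  then have "closed_path (u # p @ [v])"
    using ear ab ac unfolding closed_path_def ear_def by (cases p) auto
  then show thesis by (rule that)
qed

end

lemma cycle_adj_commute: "cycle_adj n a b = cycle_adj n b a"
  by (auto simp: cycle_adj_def)

lemma theta0_adj_commute: "theta0_adj a b = theta0_adj b a"
  by (auto simp: theta0_adj_def cycle_adj_commute)

lemma theta0_edges:
  assumes "theta0_adj a b" "a < 7" "b < 7"
  shows "(a, b) \<in> set [(0, 1), (1, 2), (2, 3), (3, 4), (4, 5), (5, 0), (0, 6), (6, 3),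
    (1, 0), (2, 1), (3, 2), (4, 3), (5, 4), (0, 5), (6, 0), (3, 6)]"
proof -
  have "\<forall>a\<in>set [0..<7]. \<forall>b\<in>set [0..<7]. theta0_adj a b \<longrightarrow>
      (a, b) \<in> set [(0, 1), (1, 2), (2, 3), (3, 4), (4, 5), (5, 0), (0, 6), (6, 3),
        (1, 0), (2, 1), (3, 2), (4, 3), (5, 4), (0, 5), (6, 0), (3, 6)]"
    by code_simp
  moreover have "a \<in> set [0..<7]" "b \<in> set [0..<7]" using assms by auto
  ultimately show ?thesis using assms(1) by blast
qed

lemma split_at_two:
  assumes "a < b" "b < length cs"
  shows "cs = take a cs @ cs ! a # take (b - a - 1) (drop (a + 1) cs) @ cs ! b # drop (b + 1) cs"
proof -
  have "cs = take a cs @ cs ! a # drop (Suc a) cs"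
    using assms by (intro id_take_nth_drop) simp
  moreover have "drop (Suc a) cs = take (b - a - 1) (drop (Suc a) cs) @
      drop (Suc a) cs ! (b - a - 1) # drop (Suc (b - a - 1)) (drop (Suc a) cs)"
    using assms by (intro id_take_nth_drop) simp
  moreover have "drop (Suc a) cs ! (b - a - 1) = cs ! b" "drop (Suc (b - a - 1)) (drop (Suc a) cs) = drop (b + 1) cs"
    using assms by simp_all
  ultimately show ?thesis by simp
qed

lemma split_two_elements:
  assumes "u \<in> set cs" "v \<in> set cs" "u \<noteq> v"
  shows "(\<exists>c1 c2 c3. cs = c1 @ u # c2 @ v # c3) \<or> (\<exists>c1 c2 c3. cs = c1 @ v # c2 @ u # c3)"
proof -
  obtain a b where ab: "a < length cs" "cs ! a = u" "b < length cs" "cs ! b = v"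
    using assms by (metis in_set_conv_nth)
  then consider "a < b" | "b < a" using assms(3) by (cases a b rule: linorder_cases) auto
  then show ?thesis
  proof cases
    case 1
    from split_at_two[OF this ab(3)] show ?thesis unfolding ab by blast
  next
    case 2
    from split_at_two[OF this ab(1)] show ?thesis unfolding ab by blast
  qed
qed

lemma cycle_adj_edge:
  assumes "successively E cs" "E (last cs) (hd cs)" "cs \<noteq> []" "a < length cs" "b = (a + 1) mod length cs"
  shows "E (cs ! a) (cs ! b)"
proof (cases "a + 1 < length cs")
  case True
  then show ?thesis using assms by (simp add: successively_conv_nth)
next
  case False
  then have "a + 1 = length cs" using assms by simp
  then have "a = length cs - 1" "b = 0" using assms(5) by simp_all
  then show ?thesis using assms(2,3) by (simp add: last_conv_nth hd_conv_nth)
qed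

context nonseparable_graph
begin

text \<open>A cycle that misses a vertex has an ear with non-empty interior; a spanning cycle has a
  chord, since the graph is not a polygon. The conditions on the lists rule out two parallel
  edges.\<close>

lemma exists_theta:
  assumes U: "U = {1..V}" and poly: "\<not> is_polygon V E"
  obtains x y A B C where "theta x y A B C"
    "A \<noteq> [] \<or> B \<noteq> []" "A \<noteq> [] \<or> C \<noteq> []" "B \<noteq> [] \<or> C \<noteq> []"
proof -
  obtain cs where cs: "closed_path cs" by (rule exists_closed_path)
  have cs': "distinct cs" "set cs \<subseteq> U" "length cs \<ge> 3" "successively E cs" "E (last cs) (hd cs)"
    using cs by (simp_all add: closed_path_def)
  have "\<exists>u v p c1 c2 c3. cs = c1 @ u # c2 @ v # c3 \<and> ear (set cs) u p v \<and>
      (p \<noteq> [] \<or> c2 \<noteq> [] \<and> c3 @ c1 \<noteq> [])"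
  proof (cases "set cs = U")
    case False
    obtain s t r where st: "cs = s # t # r"
      using cs'(3) by (metis One_nat_def Suc_le_length_iff numeral_3_eq_3)
    have "set cs \<subset> U" "s \<in> set cs" "t \<in> set cs" "s \<noteq> t" using False cs'(1,2) by (auto simp: st)
    then obtain u p v where ear: "ear (set cs) u p v" "p \<noteq> []" using exists_ear by blast
    then have "u \<in> set cs" "v \<in> set cs" "u \<noteq> v" by (auto simp: ear_def)
    from split_two_elements[OF this] show ?thesis
    proof
      assume "\<exists>c1 c2 c3. cs = c1 @ u # c2 @ v # c3"
      then show ?thesis using ear by blast
    next
      assume "\<exists>c1 c2 c3. cs = c1 @ v # c2 @ u # c3"
      moreover have "ear (set cs) v (rev p) u" "rev p \<noteq> []"
        using ear_rev[OF ear(1) cs'(2)] ear(2) by auto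
      ultimately show ?thesis by blast
    qed
  next
    case True
    have len: "length cs = V" using distinct_card[OF cs'(1)] by (simp add: True U)
    then have csne: "cs \<noteq> []" using cs'(3) by auto
    have nthU: "cs ! a \<in> U" if "a < V" for a using that True len nth_mem by blast
    have adjE: "E (cs ! a) (cs ! b)" if "a < V" "b < V" "cycle_adj V a b" for a b
    proof -
      from that(3) consider "b = (a + 1) mod length cs" | "a = (b + 1) mod length cs"
        by (auto simp: cycle_adj_def len)
      then show ?thesis
      proof cases
        case 1
        show ?thesis by (rule cycle_adj_edge[OF cs'(4,5) csne _ 1]) (simp add: len that)
      next
        case 2
        have "E (cs ! b) (cs ! a)" by (rule cycle_adj_edge[OF cs'(4,5) csne _ 2]) (simp add: len that)
        then show ?thesis using sym nthU that by blast
      qed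
    qed
    have "\<exists>a b. a < V \<and> b < V \<and> E (cs ! a) (cs ! b) \<and> \<not> cycle_adj V a b"
    proof (rule ccontr)
      assume "\<not> ?thesis"
      then have "iso_to V E V (cycle_adj V)"
        using adjE by (intro iso_to_of_list[OF cs'(1) _ len]) (auto simp: True U)
      then show False using poly by (simp add: is_polygon_def)
    qed
    then obtain a b where ab: "a < V" "b < V" "E (cs ! a) (cs ! b)" "\<not> cycle_adj V a b" by blast
    have "a \<noteq> b" using ab irrefl nthU by blast
    then have "\<exists>a b. a < b \<and> b < V \<and> E (cs ! a) (cs ! b) \<and> \<not> cycle_adj V a b"
    proof (cases "a < b")
      case False
      then have "b < a" using \<open>a \<noteq> b\<close> by simp
      moreover have "E (cs ! b) (cs ! a)" using ab sym nthU by blast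
      ultimately show ?thesis using ab cycle_adj_commute by blast
    qed (use ab in blast)
    then obtain a b where ab: "a < b" "b < V" "E (cs ! a) (cs ! b)" "\<not> cycle_adj V a b" by blast
    define c1 c2 c3 where "c1 = take a cs" "c2 = take (b - a - 1) (drop (a + 1) cs)" "c3 = drop (b + 1) cs"
    note cdef = this
    have "cs = c1 @ cs ! a # c2 @ cs ! b # c3"
      unfolding cdef by (rule split_at_two) (use ab len in auto)
    moreover have "ear (set cs) (cs ! a) [] (cs ! b)"
      using ab len nth_eq_iff_index_eq[OF cs'(1), of a b] by (auto simp: ear_def)
    \<comment> \<open>A chord is not an edge of the cycle, so both arcs have interior vertices; the
      second arc wraps around from \<open>V - 1\<close> to \<open>0\<close>.\<close>
    moreover have "c2 \<noteq> []"
    proof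
      assume "c2 = []"
      then have "b = a + 1" using ab len by (auto simp: cdef)
      then show False using ab by (simp add: cycle_adj_def)
    qed
    moreover have "c3 @ c1 \<noteq> []"
    proof
      assume "c3 @ c1 = []"
      then have "a = 0" "b + 1 = V" using ab len csne by (auto simp: cdef)
      then show False using ab by (simp add: cycle_adj_def)
    qed
    ultimately show ?thesis by blast
  qed
  then obtain u v p c1 c2 c3 where split: "cs = c1 @ u # c2 @ v # c3" and ear: "ear (set cs) u p v"
    and ne: "p \<noteq> [] \<or> c2 \<noteq> [] \<and> c3 @ c1 \<noteq> []" by blast
  have "length cs = length c2 + length (c3 @ c1) + 2" using arg_cong[OF split, of length] by simp
  then have "0 < length c2 \<or> 0 < length (c3 @ c1)" using cs'(3) by linarith
  then have "c2 \<noteq> [] \<or> rev (c3 @ c1) \<noteq> []" by (simp only: length_greater_0_conv rev_is_Nil_conv simp_thms)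
  moreover have "p \<noteq> [] \<or> c2 \<noteq> [] \<and> rev (c3 @ c1) \<noteq> []" using ne by (simp only: rev_is_Nil_conv simp_thms)
  ultimately show thesis
    using that[OF theta_of_closed_path_ear[OF cs split ear]] by blast
qed

text \<open>A theta subgraph of any other type is linked by itself. A copy of theta_0 cannot be the
  whole graph: there is a further vertex, which gives an ear, or a further edge, which is an ear
  with empty interior.\<close>

lemma exists_all_linked:
  assumes U: "U = {1..V}" and poly: "\<not> is_polygon V E" and th0: "\<not> is_theta0 V E"
  shows "\<exists>S. all_linked S \<and> card S \<ge> 3"
proof -
  obtain x y A B C where th: "theta x y A B C"
    and ne: "A \<noteq> [] \<or> B \<noteq> []" "A \<noteq> [] \<or> C \<noteq> []" "B \<noteq> [] \<or> C \<noteq> []"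
    by (rule exists_theta[OF U poly])
  show ?thesis
  proof (cases "sort [length A, length B, length C] = [1, 2, 2]")
    case False
    then show ?thesis
      using theta_all_linked_unless_122[OF th ne] card_theta_set[OF th ne(1)] by blast
  next
    case True
    have m: "mset [length A, length B, length C] = mset [1, 2, 2]"
      using arg_cong[OF True, of mset] unfolding mset_sort .
    have "set [length A, length B, length C] = set [1, 2, 2]"
      using arg_cong[OF m, of set_mset] unfolding set_mset_mset .
    then have "length A \<in> {1, 2}" "length B \<in> {1, 2}" "length C \<in> {1, 2}" by auto
    moreover have "length A + length B + length C = 5"
      using arg_cong[OF m, of sum_mset] unfolding sum_mset_sum_list by simp
    ultimately consider "length A = 1" "length B = 2" "length C = 2" | "length B = 1" "length A = 2" "length C = 2"
      | "length C = 1" "length A = 2" "length B = 2"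
      by (elim insertE emptyE) simp_all
    then have "\<exists>A B C. theta x y A B C \<and> length A = 1 \<and> length B = 2 \<and> length C = 2"
    proof cases
      case 1
      then show ?thesis using th by blast
    next
      case 2
      then show ?thesis using theta_swap(1)[OF th] by blast
    next
      case 3
      then show ?thesis using theta_swap(1)[OF theta_swap(2)[OF th]] by blast
    qed
    \<comment> \<open>Numbered as in \<open>theta0_adj\<close>: the paths run from 0 to 3, and 6 is
      the vertex on the short one.\<close>
    then obtain z0 z1 z2 z3 z4 z5 z6 where "theta z0 z3 [z6] [z1, z2] [z5, z4]"
      by (auto simp: length_Suc_conv numeral_2_eq_2)
    note th = this
    define zs where "zs = [z0, z1, z2, z3, z4, z5, z6]"
    have zs: "distinct zs" "length zs = 7" "set zs \<subseteq> U" using th by (auto simp: theta_def zs_def)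
    have zU: "zs ! a \<in> U" if "a < 7" for a using that zs nth_mem by fastforce
    have edges: "E (zs ! a) (zs ! b)" if ab: "a < 7" "b < 7" "theta0_adj a b" for a b
    proof -
      have e: "E (zs ! 0) (zs ! 1)" "E (zs ! 1) (zs ! 2)" "E (zs ! 2) (zs ! 3)" "E (zs ! 4) (zs ! 3)"
        "E (zs ! 5) (zs ! 4)" "E (zs ! 0) (zs ! 5)" "E (zs ! 0) (zs ! 6)" "E (zs ! 6) (zs ! 3)"
        using th by (simp_all add: theta_def zs_def)
      have e': "E (zs ! 1) (zs ! 0)" "E (zs ! 2) (zs ! 1)" "E (zs ! 3) (zs ! 2)" "E (zs ! 3) (zs ! 4)"
        "E (zs ! 4) (zs ! 5)" "E (zs ! 5) (zs ! 0)" "E (zs ! 6) (zs ! 0)" "E (zs ! 3) (zs ! 6)"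
        by (rule sym[OF _ _ e(1)] sym[OF _ _ e(2)] sym[OF _ _ e(3)] sym[OF _ _ e(4)] sym[OF _ _ e(5)]
            sym[OF _ _ e(6)] sym[OF _ _ e(7)] sym[OF _ _ e(8)]; simp add: zU)+
      show ?thesis using theta0_edges[OF ab(3,1,2)] e e' by auto
    qed
    have "\<exists>i j p. i < 7 \<and> j < 7 \<and> ear (set zs) (zs ! i) p (zs ! j) \<and> (p \<noteq> [] \<or> \<not> theta0_adj i j)"
    proof (cases "set zs = U")
      case False
      then have "set zs \<subset> U" "z0 \<in> set zs" "z1 \<in> set zs" "z0 \<noteq> z1"
        using zs by (auto simp: zs_def)
      then obtain u p v where ear: "ear (set zs) u p v" "p \<noteq> []" using exists_ear by blast
      then have "u \<in> set zs" "v \<in> set zs" by (auto simp: ear_def)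
      then show ?thesis using ear zs(2) by (metis in_set_conv_nth)
    next
      case True
      have "\<exists>i j. i < 7 \<and> j < 7 \<and> E (zs ! i) (zs ! j) \<and> \<not> theta0_adj i j"
      proof (rule ccontr)
        assume "\<not> ?thesis"
        then have "iso_to V E 7 theta0_adj"
          using edges by (intro iso_to_of_list[OF zs(1) _ zs(2)]) (auto simp: True U)
        then show False using th0 by (simp add: is_theta0_def)
      qed
      then obtain i j where ij: "i < 7" "j < 7" "E (zs ! i) (zs ! j)" "\<not> theta0_adj i j" by blast
      then have "zs ! i \<noteq> zs ! j" using irrefl zU by metis
      then have "ear (set zs) (zs ! i) [] (zs ! j)" using ij zs(2) by (auto simp: ear_def)
      then show ?thesis using ij by blast
    qed
    then obtain i j p where ij: "i < 7" "j < 7" "ear (set zs) (zs ! i) p (zs ! j)"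
      "p \<noteq> [] \<or> \<not> theta0_adj i j" by blast
    then have "i \<noteq> j" by (auto simp: ear_def)
    then consider "i < j" | "j < i" by linarith
    then show ?thesis
    proof cases
      case 1
      show ?thesis by (rule theta0_ear_all_linked[OF zs edges ij(3) 1 ij(2,4)])
    next
      case 2
      have "rev p \<noteq> [] \<or> \<not> theta0_adj j i" using ij(4) theta0_adj_commute by simp
      from theta0_ear_all_linked[OF zs edges ear_rev[OF ij(3) zs(3)] 2 ij(1) this] show ?thesis .
    qed
  qed
qed

theorem all_linked_vertices:
  assumes "U = {1..V}" "\<not> is_polygon V E" "\<not> is_theta0 V E"
  shows "all_linked U"
  using exists_all_linked[OF assms] all_linked_extend by blast

text \<open>If every closed walk at \<open>x\<close> had an even number of steps, the parity of
  walks from \<open>x\<close> would be a proper 2-colouring. A list of even length is a walk with an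
  odd number of steps.\<close>

lemma odd_loop:
  assumes U: "U = {1..V}" and "\<not> bipartite V E" and x: "x \<in> U"
  obtains w where "walk U w" "hd w = x" "last w = x" "even (length w)"
proof (rule ccontr)
  assume no: "\<not> thesis"
  then have odd: "odd (length w)" if "walk U w" "hd w = x" "last w = x" for w
    using that \<open>\<And>w. walk U w \<Longrightarrow> hd w = x \<Longrightarrow> last w = x \<Longrightarrow> even (length w) \<Longrightarrow> thesis\<close> by blast
  define c where "c v = (\<exists>w. walk U w \<and> hd w = x \<and> last w = v \<and> even (length w))" for v
  have "c i \<noteq> c j" if i: "i \<in> U" and j: "j \<in> U" and e: "E i j" for i j
  proof
    assume eq: "c i = c j"
    have "\<exists>v w. walk U v \<and> hd v = x \<and> last v = i \<and> walk U w \<and> hd w = x \<and> last w = j \<and>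
        even (length v) = even (length w)"
    proof (cases "c i")
      case True
      then show ?thesis using eq unfolding c_def by blast
    next
      case False
      obtain v w where v: "walk U v" "hd v = x" "last v = i" and w: "walk U w" "hd w = x" "last w = j"
        using conn x i j unfolding walk_connected_def by blast
      moreover have "odd (length v)" "odd (length w)" using False eq v w unfolding c_def by blast+
      ultimately show ?thesis by blast
    qed
    then obtain v w where v: "walk U v" "hd v = x" "last v = i" and w: "walk U w" "hd w = x" "last w = j"
      and ev: "even (length v) = even (length w)" by blast
    have r: "walk U (rev w)" "hd (rev w) = j" "last (rev w) = x"
      using walk_rev[OF w(1)] w by (auto simp: hd_rev last_rev)
    have "walk U (v @ rev w)"
      using v r e unfolding walk_def by (auto simp: successively_append_iff hd_rev)
    moreover have "hd (v @ rev w) = x" "last (v @ rev w) = x" using v r by (auto simp: walk_def)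
    ultimately have "odd (length (v @ rev w))" using odd by blast
    then show False using ev by auto
  qed
  then have "bipartite V E" unfolding bipartite_def U by blast
  then show False using assms(2) by blast
qed

text \<open>Outside the bipartite case an odd closed walk turns an odd permutation into an even
  one.\<close>

lemma permutes_mem_loop_group:
  assumes U: "U = {1..V}" "\<not> is_polygon V E" "\<not> is_theta0 V E" and x: "x \<in> U"
    and p: "p permutes (U - {x})" and "evenperm p \<or> \<not> bipartite V E"
  shows "p \<in> loop_group U x"
proof -
  interpret K: perm_group "loop_group U x" by (rule perm_group_loop_group[OF x subset_refl])
  have lnk: "K.linked a b" if "a \<in> U - {x}" "b \<in> U - {x}" for a b
    using all_linked_vertices[OF U] x that unfolding all_linked_def by blast
  have finx: "finite (U - {x})" using fin by simp
  note even_mem = K.evenperm_mem_of_linked[OF finx lnk]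
  show ?thesis
  proof (cases "evenperm p")
    case True
    then show ?thesis using even_mem p by blast
  next
    case False
    then obtain w where w: "walk U w" "hd w = x" "last w = x" "even (length w)"
      using odd_loop[OF U(1) _ x] assms(6) by blast
    define q where "q = cycle_of_list w"
    have q: "q \<in> loop_group U x" unfolding q_def by (rule loop_groupI[OF w(1-3)])
    have "successively (\<noteq>) w"
      using w(1) unfolding walk_def by (auto intro!: successively_mono[where P = E and xs = w] dest: irrefl)
    then have odd: "\<not> evenperm q"
      unfolding q_def using evenperm_cycle_of_list[of w] w by (auto simp: walk_def)
    have qU: "q permutes U"
      unfolding q_def using w(1) permutes_subset[OF cycle_permutes] by (auto simp: walk_def)
    have qx: "q x = x" unfolding q_def using cycle_of_list_last[of w] w by (auto simp: walk_def)
    have "q permutes (U - {x})"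
      using qU qx unfolding permutes_def by auto
    then have "inv q \<circ> p permutes (U - {x})" using permutes_compose[OF p permutes_inv] by blast
    moreover have "evenperm (inv q \<circ> p)"
    proof -
      have "permutation q" "permutation p"
        using qU fin p finx by (auto simp: permutation_permutes)
      then show ?thesis
        using evenperm_comp[OF permutation_inverse[of q]] evenperm_inv[of q] odd False by blast
    qed
    ultimately have "inv q \<circ> p \<in> loop_group U x" using even_mem by blast
    then have "q \<circ> (inv q \<circ> p) \<in> loop_group U x" by (rule K.comp_mem[OF q])
    moreover have "q \<circ> (inv q \<circ> p) = p"
      using permutes_surj[OF qU] by (simp add: fun_eq_iff surj_f_inv_f)
    ultimately show ?thesis by simp
  qed
qed

text \<open>Any walk bringing the hole to the right place leaves a permutation \<open>p\<close> of
  the labels to be realised by a closed walk at \<open>h\<close>. The assumption \<open>alt\<close>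
  takes care of an odd \<open>p\<close>.\<close>

theorem hole_walk_exists:
  fixes \<alpha> \<alpha>' :: "nat \<Rightarrow> 'c"
  assumes U: "U = {1..V}" "\<not> is_polygon V E" "\<not> is_theta0 V E" and h: "h \<in> U" "h' \<in> U"
    and cnt: "\<And>c. card {i \<in> U - {h}. \<alpha> i = c} = card {i \<in> U - {h'}. \<alpha>' i = c}"
    and alt: "\<not> bipartite V E \<or> (\<exists>i\<in>U - {h'}. \<exists>j\<in>U - {h'}. i \<noteq> j \<and> \<alpha>' i = \<alpha>' j)"
  obtains w where "walk U w" "hd w = h'" "last w = h" "\<And>i. i \<in> U - {h} \<Longrightarrow> \<alpha>' (cycle_of_list w i) = \<alpha> i"
proof -
  obtain w where w: "walk U w" "hd w = h'" "last w = h"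
    using conn h unfolding walk_connected_def by blast
  define s where "s = cycle_of_list w"
  have sU: "s permutes U"
    unfolding s_def using w(1) permutes_subset[OF cycle_permutes] by (auto simp: walk_def)
  have sh: "s h = h'" unfolding s_def using cycle_of_list_last[of w] w by (auto simp: walk_def)
  have bij: "bij_betw s (U - {h}) (U - {h'})"
    using bij_betw_DiffI[OF permutes_imp_bij[OF sU], of "{h}" "{h'}"] h sh by (auto simp: bij_betw_def)
  have cnt': "card {i \<in> U - {h}. \<alpha>' (s i) = c} = card {i \<in> U - {h'}. \<alpha>' i = c}" for c
  proof (rule bij_betw_same_card)
    show "bij_betw s {i \<in> U - {h}. \<alpha>' (s i) = c} {i \<in> U - {h'}. \<alpha>' i = c}"
      using bij by (auto simp: bij_betw_def inj_on_def)
  qed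
  have finh: "finite (U - {h})" using fin by simp
  have "image_mset \<alpha> (mset_set (U - {h})) = image_mset (\<lambda>i. \<alpha>' (s i)) (mset_set (U - {h}))"
  proof (rule multiset_eqI)
    fix c
    have "count (image_mset f (mset_set (U - {h}))) c = card {i \<in> U - {h}. f i = c}" for f :: "nat \<Rightarrow> 'c"
      using finh by (simp add: count_image_mset_eq_card_vimage)
    then show "count (image_mset \<alpha> (mset_set (U - {h}))) c =
        count (image_mset (\<lambda>i. \<alpha>' (s i)) (mset_set (U - {h}))) c"
      using cnt cnt' by simp
  qed
  from image_mset_eq_implies_permutes[OF finh this]
  obtain p where p: "p permutes (U - {h})" "\<forall>i\<in>U - {h}. \<alpha> i = \<alpha>' (s (p i))" by blast
  have "\<exists>k\<in>loop_group U h. \<forall>i\<in>U - {h}. \<alpha> i = \<alpha>' (s (k i))"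
  proof (cases "evenperm p \<or> \<not> bipartite V E")
    case True
    then show ?thesis using permutes_mem_loop_group[OF U h(1) p(1)] p(2) by blast
  next
    case False
    then obtain i j where ij: "i \<in> U - {h'}" "j \<in> U - {h'}" "i \<noteq> j" "\<alpha>' i = \<alpha>' j" using alt by blast
    then obtain i' j' where i': "i' \<in> U - {h}" "s i' = i" and j': "j' \<in> U - {h}" "s j' = j"
      using bij by (metis (no_types, lifting) bij_betw_def imageE)
    \<comment> \<open>The swap exchanges two equal labels, so it makes the permutation even without
      being visible in the labelling.\<close>
    define k where "k = transpose i' j' \<circ> p"
    have tp: "transpose i' j' permutes (U - {h})" using i' j' by (intro permutes_swap_id) auto
    have "k permutes (U - {h})" unfolding k_def by (rule permutes_compose[OF p(1) tp])
    moreover have "evenperm k"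
    proof -
      have "i' \<noteq> j'" using i' j' ij by auto
      moreover have "permutation p" using p(1) finh by (auto simp: permutation_permutes)
      ultimately show ?thesis
        unfolding k_def using False evenperm_comp[OF permutation_swap_id, of p i' j'] evenperm_swap[of i' j']
        by blast
    qed
    ultimately have "k \<in> loop_group U h" using permutes_mem_loop_group[OF U h(1)] by blast
    moreover have "\<alpha>' (s (transpose i' j' z)) = \<alpha>' (s z)" for z
      using ij i' j' by (simp add: transpose_def)
    ultimately show ?thesis using p(2) by (intro bexI[of _ k]) (simp_all add: k_def)
  qed
  then obtain k where k: "k \<in> loop_group U h" "\<And>i. i \<in> U - {h} \<Longrightarrow> \<alpha> i = \<alpha>' (s (k i))" by blast
  then obtain v where v: "k = cycle_of_list v" "walk U v" "hd v = h" "last v = h"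
    unfolding loop_group_def by blast
  have lj: "last w = hd v" using w v by simp
  note j = walk_join[OF w(1) v(2) lj]
  show thesis
    by (rule that[of "w @ tl v"]) (use j w v k in \<open>simp_all add: s_def\<close>)
qed

end

section \<open>Fock space amplitudes\<close>

definition cfg :: "nat \<Rightarrow> nat \<Rightarrow> (nat \<Rightarrow> nat) \<Rightarrow> mode set" where
  "cfg V h \<alpha> = (\<lambda>i. (i, \<alpha> i)) ` ({1..V} - {h})"

lemma mem_cfg: "(i, a) \<in> cfg V h \<alpha> \<longleftrightarrow> i \<in> {1..V} - {h} \<and> a = \<alpha> i"
  by (auto simp: cfg_def)

lemma cfg_cong: "(\<And>i. i \<in> {1..V} - {h} \<Longrightarrow> \<alpha> i = \<beta> i) \<Longrightarrow> cfg V h \<alpha> = cfg V h \<beta>"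
  unfolding cfg_def by (rule image_cong) auto

lemma cfg_eq_iff:
  assumes "h \<in> {1..V}" "h' \<in> {1..V}"
  shows "cfg V h \<alpha> = cfg V h' \<alpha>' \<longleftrightarrow> h = h' \<and> (\<forall>i\<in>{1..V} - {h}. \<alpha> i = \<alpha>' i)"
proof
  assume eq: "cfg V h \<alpha> = cfg V h' \<alpha>'"
  have "fst ` cfg V h \<alpha> = {1..V} - {h}" for h \<alpha>
    unfolding cfg_def by (simp add: image_image)
  then have "{1..V} - {h} = {1..V} - {h'}" using eq by metis
  then have hh: "h = h'" using assms by blast
  have "\<alpha> i = \<alpha>' i" if "i \<in> {1..V} - {h}" for i
  proof -
    have "(i, \<alpha> i) \<in> cfg V h' \<alpha>'" using that unfolding eq[symmetric] mem_cfg by simp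
    then show ?thesis by (simp add: mem_cfg)
  qed
  then show "h = h' \<and> (\<forall>i\<in>{1..V} - {h}. \<alpha> i = \<alpha>' i)" using hh by blast
next
  assume "h = h' \<and> (\<forall>i\<in>{1..V} - {h}. \<alpha> i = \<alpha>' i)"
  then show "cfg V h \<alpha> = cfg V h' \<alpha>'" using cfg_cong[of V h \<alpha> \<alpha>'] by blast
qed

lemma card_cfg: "h \<in> {1..V} \<Longrightarrow> card (cfg V h \<alpha>) = V - 1"
  unfolding cfg_def by (subst card_image) (auto simp: inj_on_def)

lemma cfg_subset_modes: "valid_config V N h \<alpha> \<Longrightarrow> cfg V h \<alpha> \<subseteq> modes V N"
  by (auto simp: cfg_def modes_def valid_config_def)

lemma in_H1_cfg:
  assumes "valid_config V N h \<alpha>"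
  shows "in_H1 V N (cfg V h \<alpha>)"
  unfolding in_H1_def
proof (intro conjI allI cfg_subset_modes[OF assms])
  show "card (cfg V h \<alpha>) = V - 1" using assms by (simp add: card_cfg valid_config_def)
  fix i
  have "{a. (i, a) \<in> cfg V h \<alpha>} \<subseteq> {\<alpha> i}" by (auto simp: mem_cfg)
  then show "card {a. (i, a) \<in> cfg V h \<alpha>} \<le> 1"
    using card_mono[of "{\<alpha> i}"] by simp
qed

lemma finite_modes: "finite (modes V N)"
  by (simp add: modes_def)

lemma in_H1_finite: "in_H1 V N S \<Longrightarrow> finite S"
  unfolding in_H1_def using finite_modes finite_subset by blast

lemma in_H1_unique:
  assumes "in_H1 V N S" "(i, a) \<in> S" "(i, b) \<in> S"
  shows "a = b"
proof -
  have "finite {a. (i, a) \<in> S}"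
    using finite_subset[OF _ finite_imageI[OF in_H1_finite[OF assms(1)], of snd], of "{a. (i, a) \<in> S}"]
    by force
  moreover have "card {a. (i, a) \<in> S} \<le> Suc 0" using assms(1) by (simp add: in_H1_def)
  ultimately show ?thesis using assms(2,3) card_le_Suc0_iff_eq by blast
qed

text \<open>No vertex is used twice, so \<open>V - 1\<close> fermions occupy as many vertices and
  leave exactly one hole.\<close>

lemma in_H1_cases:
  assumes S: "in_H1 V N S" and V: "V \<ge> 1"
  obtains h \<alpha> where "valid_config V N h \<alpha>" "S = cfg V h \<alpha>"
proof -
  have sub: "S \<subseteq> modes V N" and card: "card S = V - 1" using S by (auto simp: in_H1_def)
  have inj: "inj_on fst S" using in_H1_unique[OF S] by (auto simp: inj_on_def)
  have fsub: "fst ` S \<subseteq> {1..V}" using sub by (auto simp: modes_def)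
  have "card ({1..V} - fst ` S) = 1"
    using card_Diff_subset[OF finite_imageI[OF in_H1_finite[OF S]] fsub] card_image[OF inj] card V by simp
  then obtain h where h: "{1..V} - fst ` S = {h}" by (auto simp: card_Suc_eq)
  define \<alpha> where "\<alpha> i = (THE a. (i, a) \<in> S)" for i
  have al: "\<alpha> i = a" if "(i, a) \<in> S" for i a
    unfolding \<alpha>_def using in_H1_unique[OF S] that by blast
  have hh: "fst ` S = {1..V} - {h}" using h fsub by blast
  have "S = cfg V h \<alpha>"
  proof (rule set_eqI)
    fix m :: mode
    obtain i a where m: "m = (i, a)" by (cases m)
    show "m \<in> S \<longleftrightarrow> m \<in> cfg V h \<alpha>"
    proof
      assume "m \<in> S"
      then have "i \<in> fst ` S" "a = \<alpha> i" using al m by force+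
      then show "m \<in> cfg V h \<alpha>" by (simp add: m mem_cfg hh)
    next
      assume "m \<in> cfg V h \<alpha>"
      then have "i \<in> fst ` S" "a = \<alpha> i" by (simp_all add: m mem_cfg hh)
      then show "m \<in> S" using al m by force
    qed
  qed
  moreover have "valid_config V N h \<alpha>"
    using h sub unfolding calculation by (auto simp: valid_config_def modes_def cfg_def)
  ultimately show thesis using that by blast
qed

text \<open>The sign counts the occupied vertices before \<open>i\<close>. Besides the hole
  \<open>h\<close>, a vertex \<open>j\<close> may be missing from \<open>S\<close>; taking
  \<open>j = h\<close> means that there is no such vertex. In this form the formula serves creation
  and annihilation alike.\<close>

lemma fsign_cfg:
  assumes "i \<in> {1..V}" "h \<in> {1..V}" "S \<subseteq> cfg V h \<alpha>" "\<And>k. k < i \<Longrightarrow> k \<in> {1..V} - {h} \<Longrightarrow> k \<noteq> j \<Longrightarrow> (k, \<alpha> k) \<in> S"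
    "\<And>a. (i, a) \<in> S \<Longrightarrow> \<not> a < b" "\<And>a. (j, a) \<notin> S \<or> i \<le> j"
  shows "fsign (i, b) S = (-1) ^ card ({1..<i} - {h, j})"
proof -
  have "{m' \<in> S. mode_less m' (i, b)} = (\<lambda>k. (k, \<alpha> k)) ` ({1..<i} - {h, j})"
  proof (rule set_eqI)
    fix m :: mode
    obtain k a where m: "m = (k, a)" by (cases m)
    have "m \<in> S \<and> mode_less m (i, b) \<longleftrightarrow> k < i \<and> m \<in> S"
      using assms(5) by (auto simp: m mode_less_def)
    also have "\<dots> \<longleftrightarrow> k \<in> {1..<i} - {h, j} \<and> a = \<alpha> k"
    proof
      assume k: "k < i \<and> m \<in> S"
      then have "(k, a) \<in> cfg V h \<alpha>" using assms(3) m by blast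
      moreover have "k \<noteq> j" using k assms(6)[of a] m by auto
      ultimately show "k \<in> {1..<i} - {h, j} \<and> a = \<alpha> k" using k by (auto simp: mem_cfg)
    next
      assume "k \<in> {1..<i} - {h, j} \<and> a = \<alpha> k"
      then show "k < i \<and> m \<in> S" using assms(4)[of k] assms(1) by (auto simp: m)
    qed
    finally show "m \<in> {m' \<in> S. mode_less m' (i, b)} \<longleftrightarrow> m \<in> (\<lambda>k. (k, \<alpha> k)) ` ({1..<i} - {h, j})"
      by (auto simp: m)
  qed
  then have "card {m' \<in> S. mode_less m' (i, b)} = card ({1..<i} - {h, j})"
    by (simp add: card_image inj_on_def)
  then show ?thesis by (simp add: fsign_def)
qed

text \<open>The two operators together pass \<open>i + h - 3\<close> fermions. The prefactor
  \<open>(-1) ^ h\<close> of the basis states thus becomes \<open>(-1) ^ i\<close> with a minus sign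
  that does not depend on the positions, which is the purpose of this prefactor.\<close>

lemma hop_sign:
  assumes "i \<in> {1..V}" "h \<in> {1..V}" "i \<noteq> h"
  shows "(-1) ^ h * ((-1) ^ card ({1..<i} - {h}) * (-1) ^ card ({1..<h} - {i})) = (- ((-1) ^ i) :: complex)"
proof -
  have "card ({1..<i} - {h}) + card ({1..<h} - {i}) + 3 = i + h"
  proof (cases "i < h")
    case True
    then have "card ({1..<i} - {h}) = i - 1" "card ({1..<h} - {i}) = h - 2"
      using assms by (auto simp: card_Diff_singleton_if)
    then show ?thesis using True assms by simp
  next
    case False
    then have "card ({1..<i} - {h}) = i - 2" "card ({1..<h} - {i}) = h - 1"
      using assms by (auto simp: card_Diff_singleton_if)
    then show ?thesis using False assms by simp
  qed
  then have "even (h + (card ({1..<i} - {h}) + card ({1..<h} - {i}))) \<longleftrightarrow> odd i" by presburger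
  then show ?thesis by (simp only: power_add[symmetric] minus_one_power_iff) auto
qed

section \<open>Hamiltonian and flavor generators in the signed basis\<close>

definition amp :: "nat \<Rightarrow> fvec \<Rightarrow> nat \<Rightarrow> (nat \<Rightarrow> nat) \<Rightarrow> complex" where
  "amp V \<psi> h \<alpha> = (-1) ^ h * \<psi> (cfg V h \<alpha>)"

lemma insert_cfg_hop:
  assumes "i \<in> {1..V}" "h \<in> {1..V}" "i \<noteq> h"
  shows "insert (h, \<alpha> i) (cfg V h \<alpha> - {(i, \<alpha> i)}) = cfg V i (\<alpha> \<circ> transpose h i)"
proof (rule set_eqI)
  fix m :: mode
  obtain k a where m: "m = (k, a)" by (cases m)
  show "m \<in> insert (h, \<alpha> i) (cfg V h \<alpha> - {(i, \<alpha> i)}) \<longleftrightarrow> m \<in> cfg V i (\<alpha> \<circ> transpose h i)"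
    using assms by (auto simp: m mem_cfg transpose_def)
qed

lemma valid_config_hop:
  assumes "valid_config V N h \<alpha>" "i \<in> {1..V}"
  shows "valid_config V N i (\<alpha> \<circ> transpose h i)"
  using assms by (auto simp: valid_config_def transpose_def)

lemma hopping_term:
  assumes val: "valid_config V N h \<alpha>" and i: "i \<in> {1..V}" and j: "j \<in> {1..V}"
    and diag: "t i i = 0"
  shows "complex_of_real (t i j) * cdag (i, a) (cann (j, a) (projP V N \<psi>)) (cfg V h \<alpha>) =
    (if j = h \<and> i \<noteq> h \<and> a = \<alpha> i
     then complex_of_real (t i h) * ((-1) ^ card ({1..<i} - {h}) * (-1) ^ card ({1..<h} - {i})) *
       \<psi> (cfg V i (\<alpha> \<circ> transpose h i))
     else 0)"
proof (cases "(i, a) \<in> cfg V h \<alpha>")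
  case False
  then show ?thesis using i by (auto simp: cdag_def mem_cfg)
next
  case True
  then have ia: "i \<noteq> h" "a = \<alpha> i" by (auto simp: mem_cfg)
  have h: "h \<in> {1..V}" using val by (simp add: valid_config_def)
  define S where "S = cfg V h \<alpha> - {(i, \<alpha> i)}"
  have eq: "cdag (i, a) (cann (j, a) (projP V N \<psi>)) (cfg V h \<alpha>) =
      fsign (i, \<alpha> i) (cfg V h \<alpha>) * cann (j, \<alpha> i) (projP V N \<psi>) S"
    using True ia by (simp add: cdag_def S_def)
  consider "j = h" | "j = i" | "j \<noteq> h" "j \<noteq> i" by blast
  then show ?thesis
  proof cases
    case 1
    have nin: "(h, \<alpha> i) \<notin> S" by (auto simp: S_def mem_cfg)
    have ins: "insert (h, \<alpha> i) S = cfg V i (\<alpha> \<circ> transpose h i)"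
      unfolding S_def by (rule insert_cfg_hop[OF i h ia(1)])
    have H1: "in_H1 V N (cfg V i (\<alpha> \<circ> transpose h i))"
      by (rule in_H1_cfg[OF valid_config_hop[OF val i]])
    have s1: "fsign (i, \<alpha> i) (cfg V h \<alpha>) = (-1) ^ card ({1..<i} - {h, h})"
      by (rule fsign_cfg[OF i h, where \<alpha> = \<alpha>]) (auto simp: mem_cfg)
    have s2: "fsign (h, \<alpha> i) S = (-1) ^ card ({1..<h} - {h, i})"
      by (rule fsign_cfg[OF h h, where \<alpha> = \<alpha>]) (auto simp: mem_cfg S_def)
    have "{1..<h} - {h, i} = {1..<h} - {i}" by auto
    then show ?thesis
      unfolding eq using 1 ia nin H1 s1 s2 by (simp add: cann_def ins projP_def)
  next
    case 2
    then show ?thesis using diag ia by simp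
  next
    case 3
    \<comment> \<open>Vertex \<open>j\<close> is occupied in the final state, so the hop would start
      from two fermions on \<open>j\<close>, which is either impossible or removed by
      \<open>projP\<close>.\<close>
    have "cann (j, \<alpha> i) (projP V N \<psi>) S = 0"
    proof (cases "(j, \<alpha> i) \<in> S")
      case False
      have "\<not> in_H1 V N (insert (j, \<alpha> i) S)"
      proof
        assume H: "in_H1 V N (insert (j, \<alpha> i) S)"
        have jS: "(j, \<alpha> j) \<in> S" using 3 j by (simp add: S_def mem_cfg)
        then have "\<alpha> i = \<alpha> j" using in_H1_unique[OF H, of j "\<alpha> i" "\<alpha> j"] by simp
        then show False using False jS by simp
      qed
      then show ?thesis by (simp add: cann_def projP_def)
    qed (simp add: cann_def)
    then show ?thesis unfolding eq using 3 by simp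
  qed
qed

lemma sum_sum_single:
  fixes c :: "'c::comm_monoid_add"
  assumes "finite A" "finite B" "x \<in> A" "y \<in> B"
  shows "(\<Sum>j\<in>A. \<Sum>a\<in>B. if j = x \<and> P \<and> a = y then c else 0) = (if P then c else 0)"
proof -
  have "(\<Sum>a\<in>B. if j = x \<and> P \<and> a = y then c else 0) = (if j = x then if P then c else 0 else 0)" for j
    using assms by (cases "j = x \<and> P") (auto simp: sum.delta)
  then show ?thesis using assms by (simp add: sum.delta)
qed

lemma amp_Hinf:
  assumes val: "valid_config V N h \<alpha>" and diag: "\<forall>i\<in>{1..V}. t i i = 0"
  shows "amp V (Hinf V N t \<psi>) h \<alpha> =
    - (\<Sum>i\<in>{1..V} - {h}. complex_of_real (t i h) * amp V \<psi> i (\<alpha> \<circ> transpose h i))"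
proof -
  have h: "h \<in> {1..V}" using val by (simp add: valid_config_def)
  define c where "c i = complex_of_real (t i h) * ((-1) ^ card ({1..<i} - {h}) * (-1) ^ card ({1..<h} - {i})) *
       \<psi> (cfg V i (\<alpha> \<circ> transpose h i))" for i
  have "Hinf V N t \<psi> (cfg V h \<alpha>) = (\<Sum>i\<in>{1..V}. \<Sum>j\<in>{1..V}. \<Sum>a\<in>{1..N}.
      complex_of_real (t i j) * cdag (i, a) (cann (j, a) (projP V N \<psi>)) (cfg V h \<alpha>))"
    using in_H1_cfg[OF val] by (simp add: Hinf_def projP_def hopping_def)
  also have "\<dots> = (\<Sum>i\<in>{1..V}. \<Sum>j\<in>{1..V}. \<Sum>a\<in>{1..N}. if j = h \<and> i \<noteq> h \<and> a = \<alpha> i then c i else 0)"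
    unfolding c_def using diag by (intro sum.cong refl hopping_term[OF val]) auto
  also have "\<dots> = (\<Sum>i\<in>{1..V}. if i \<noteq> h then c i else 0)"
  proof (intro sum.cong refl)
    fix i assume i: "i \<in> {1..V}"
    show "(\<Sum>j\<in>{1..V}. \<Sum>a\<in>{1..N}. if j = h \<and> i \<noteq> h \<and> a = \<alpha> i then c i else 0) = (if i \<noteq> h then c i else 0)"
    proof (cases "i = h")
      case False
      then have "\<alpha> i \<in> {1..N}" using val i by (simp add: valid_config_def)
      then show ?thesis using sum_sum_single[of "{1..V}" "{1..N}" h "\<alpha> i" "i \<noteq> h" "c i"] h by simp
    qed simp
  qed
  also have "\<dots> = (\<Sum>i\<in>{1..V} - {h}. c i)"
    by (rule sum.mono_neutral_cong_right) auto
  finally have "amp V (Hinf V N t \<psi>) h \<alpha> = (\<Sum>i\<in>{1..V} - {h}. (-1) ^ h * c i)"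
    by (simp add: amp_def sum_distrib_left)
  also have "\<dots> = (\<Sum>i\<in>{1..V} - {h}. - (complex_of_real (t i h) * amp V \<psi> i (\<alpha> \<circ> transpose h i)))"
  proof (intro sum.cong refl)
    fix i assume "i \<in> {1..V} - {h}"
    then have "(-1) ^ h * ((-1) ^ card ({1..<i} - {h}) * (-1) ^ card ({1..<h} - {i})) = (- ((-1) ^ i) :: complex)"
      by (intro hop_sign[of i V h]) (use h in auto)
    then have "(-1) ^ h * c i = complex_of_real (t i h) * (- ((-1) ^ i)) * \<psi> (cfg V i (\<alpha> \<circ> transpose h i))"
      unfolding c_def by (metis mult.assoc mult.left_commute)
    then show "(-1) ^ h * c i = - (complex_of_real (t i h) * amp V \<psi> i (\<alpha> \<circ> transpose h i))"
      by (simp add: amp_def)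
  qed
  finally show ?thesis by (simp add: sum_negf)
qed

text \<open>Changing the flavor on one vertex passes the same fermions twice, so no sign
  remains.\<close>

lemma su_gen_cfg:
  assumes h: "h \<in> {1..V}"
  shows "su_gen V a b \<psi> (cfg V h \<alpha>) = (\<Sum>i\<in>{1..V} - {h}. if \<alpha> i = a then \<psi> (cfg V h (\<alpha>(i := b))) else 0)"
proof -
  have "cdag (i, a) (cann (i, b) \<psi>) (cfg V h \<alpha>) =
      (if i \<noteq> h \<and> \<alpha> i = a then \<psi> (cfg V h (\<alpha>(i := b))) else 0)" if i: "i \<in> {1..V}" for i
  proof (cases "(i, a) \<in> cfg V h \<alpha>")
    case False
    then show ?thesis using i by (auto simp: cdag_def mem_cfg)
  next
    case True
    then have ia: "i \<noteq> h" "a = \<alpha> i" by (auto simp: mem_cfg)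
    define S where "S = cfg V h \<alpha> - {(i, \<alpha> i)}"
    have nin: "(i, b) \<notin> S" by (auto simp: S_def mem_cfg)
    have ins: "insert (i, b) S = cfg V h (\<alpha>(i := b))"
    proof (rule set_eqI)
      fix m :: mode
      obtain k a where m: "m = (k, a)" by (cases m)
      show "m \<in> insert (i, b) S \<longleftrightarrow> m \<in> cfg V h (\<alpha>(i := b))"
        using ia(1) i by (auto simp: m mem_cfg S_def)
    qed
    have s1: "fsign (i, \<alpha> i) (cfg V h \<alpha>) = (-1) ^ card ({1..<i} - {h, h})"
      by (rule fsign_cfg[OF i h, where \<alpha> = \<alpha>]) (auto simp: mem_cfg)
    have s2: "fsign (i, b) S = (-1) ^ card ({1..<i} - {h, h})"
      by (rule fsign_cfg[OF i h, where \<alpha> = \<alpha>]) (auto simp: mem_cfg S_def)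
    have "cdag (i, a) (cann (i, b) \<psi>) (cfg V h \<alpha>) =
        fsign (i, \<alpha> i) (cfg V h \<alpha>) * (fsign (i, b) S * \<psi> (cfg V h (\<alpha>(i := b))))"
      using True ia nin ins by (simp add: cdag_def cann_def S_def[symmetric])
    also have "\<dots> = \<psi> (cfg V h (\<alpha>(i := b)))"
      unfolding s1 s2 by (simp add: mult.assoc[symmetric] power_mult_distrib[symmetric])
    finally show ?thesis using ia by simp
  qed
  then have "su_gen V a b \<psi> (cfg V h \<alpha>) =
      (\<Sum>i\<in>{1..V}. if i \<noteq> h \<and> \<alpha> i = a then \<psi> (cfg V h (\<alpha>(i := b))) else 0)"
    by (simp add: su_gen_def)
  also have "\<dots> = (\<Sum>i\<in>{1..V} - {h}. if \<alpha> i = a then \<psi> (cfg V h (\<alpha>(i := b))) else 0)"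
    by (rule sum.mono_neutral_cong_right) auto
  finally show ?thesis .
qed

text \<open>Generators do not change the number of fermions on any vertex, so they preserve the
  one-hole space.\<close>

lemma su_gen_outside:
  assumes \<psi>: "\<psi> \<in> H1 V N" and S: "\<not> in_H1 V N S" and a: "a \<in> {1..N}"
  shows "su_gen V a b \<psi> S = 0"
  unfolding su_gen_def
proof (rule sum.neutral, rule ballI)
  fix i assume i: "i \<in> {1..V}"
  show "cdag (i, a) (cann (i, b) \<psi>) S = 0"
  proof (rule ccontr)
    assume ne: "cdag (i, a) (cann (i, b) \<psi>) S \<noteq> 0"
    define S' where "S' = insert (i, b) (S - {(i, a)})"
    have aS: "(i, a) \<in> S" and bS: "(i, b) \<notin> S - {(i, a)}" and "\<psi> S' \<noteq> 0"
      using ne by (auto simp: cdag_def cann_def S'_def split: if_splits)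
    then have H: "in_H1 V N S'" using \<psi> by (auto simp: H1_def)
    have SS: "S = insert (i, a) (S' - {(i, b)})" using aS bS by (auto simp: S'_def)
    have finS: "finite S'" by (rule in_H1_finite[OF H])
    have "S \<subseteq> modes V N" using H i a unfolding SS by (auto simp: in_H1_def modes_def)
    moreover have "card S = V - 1"
    proof -
      have "finite S" using finS SS by (metis finite_Diff finite_insert)
      then have "card S' = Suc (card (S - {(i, a)}))" using bS by (simp add: S'_def)
      also have "\<dots> = card S" using aS \<open>finite S\<close> by (simp only: card_Suc_Diff1)
      finally show ?thesis using H by (simp add: in_H1_def)
    qed
    moreover have "card {c. (k, c) \<in> S} \<le> 1" for k
    proof (cases "k = i")
      case True
      have "{c. (k, c) \<in> S} \<subseteq> {a}"
      proof
        fix c assume c: "c \<in> {c. (k, c) \<in> S}"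
        show "c \<in> {a}"
        proof (rule ccontr)
          assume "c \<notin> {a}"
          then have "(i, c) \<in> S - {(i, a)}" using c True by auto
          then have "c = b" using in_H1_unique[OF H, of i c b] by (simp add: S'_def)
          then show False using \<open>(i, c) \<in> S - {(i, a)}\<close> bS by simp
        qed
      qed
      then show ?thesis using card_mono[of "{a}"] by simp
    next
      case False
      then have "{c. (k, c) \<in> S} = {c. (k, c) \<in> S'}" by (auto simp: S'_def)
      then show ?thesis using H by (simp add: in_H1_def)
    qed
    ultimately show False using S by (simp add: in_H1_def)
  qed
qed

section \<open>Perron vectors\<close>

text \<open>The term of second order in \<open>e\<close> is absent because
  \<open>t k k = 0\<close>.\<close>

lemma quadratic_form_shift:
  fixes t :: "'a \<Rightarrow> 'a \<Rightarrow> real"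
  assumes "finite U" "k \<in> U" "\<And>i j. i \<in> U \<Longrightarrow> j \<in> U \<Longrightarrow> t i j = t j i" "t k k = 0"
  shows "(\<Sum>i\<in>U. \<Sum>j\<in>U. t i j * (x(k := x k + e)) i * (x(k := x k + e)) j) =
    (\<Sum>i\<in>U. \<Sum>j\<in>U. t i j * x i * x j) + 2 * e * (\<Sum>j\<in>U. t j k * x j)"
proof -
  define y where "y = x(k := x k + e)"
  define s where "s i = (\<Sum>j\<in>U. t i j * x j)" for i
  have y: "y i = x i + (if i = k then e else 0)" for i by (simp add: y_def)
  have inner: "(\<Sum>j\<in>U. t i j * y j) = s i + e * t i k" for i
    using assms(1,2) by (simp add: y s_def distrib_left sum.distrib if_distrib[of "(*) _"] cong: if_cong)
  have sk: "s k = (\<Sum>j\<in>U. t j k * x j)"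
    unfolding s_def using assms(2,3) by (intro sum.cong) auto
  have "(\<Sum>i\<in>U. \<Sum>j\<in>U. t i j * y i * y j) = (\<Sum>i\<in>U. y i * (s i + e * t i k))"
    by (simp add: inner[symmetric] sum_distrib_left mult_ac)
  also have "\<dots> = (\<Sum>i\<in>U. x i * (s i + e * t i k)) + e * (s k + e * t k k)"
    using assms(1,2) by (simp add: y distrib_right sum.distrib if_distrib[of "\<lambda>a. a * _"] cong: if_cong)
  also have "(\<Sum>i\<in>U. x i * (s i + e * t i k)) = (\<Sum>i\<in>U. x i * s i) + e * (\<Sum>j\<in>U. t j k * x j)"
    by (simp add: distrib_left sum.distrib sum_distrib_left mult_ac)
  also have "(\<Sum>i\<in>U. x i * s i) = (\<Sum>i\<in>U. \<Sum>j\<in>U. t i j * x i * x j)"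
    by (simp add: s_def sum_distrib_left mult_ac)
  finally show ?thesis using assms(4) by (simp add: y_def sk)
qed

text \<open>The vector maximises the quadratic form over the nonnegative part of the unit sphere.\<close>
lemma perron_vector:
  fixes t :: "'a \<Rightarrow> 'a \<Rightarrow> real"
  assumes fin: "finite U" and ne: "U \<noteq> {}"
    and nonneg: "\<And>i j. i \<in> U \<Longrightarrow> j \<in> U \<Longrightarrow> t i j \<ge> 0"
    and sym: "\<And>i j. i \<in> U \<Longrightarrow> j \<in> U \<Longrightarrow> t i j = t j i" and diag: "\<And>i. i \<in> U \<Longrightarrow> t i i = 0"
    and conn: "\<And>i j. i \<in> U \<Longrightarrow> j \<in> U \<Longrightarrow> (i, j) \<in> {(i, j). i \<in> U \<and> j \<in> U \<and> t i j > 0}\<^sup>*"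
  obtains \<phi> l where "\<And>i. i \<in> U \<Longrightarrow> \<phi> i > 0" "\<And>i. i \<in> U \<Longrightarrow> (\<Sum>j\<in>U. t j i * \<phi> j) = l * \<phi> i"
proof -
  \<comment> \<open>Coordinates outside \<open>U\<close> are frozen at 0, which makes
    \<open>B\<close> a product of compact sets.\<close>
  define B where "B = Pi UNIV (\<lambda>i. if i \<in> U then {0..1::real} else {0})"
  define K where "K = B \<inter> {x. (\<Sum>i\<in>U. (x i)\<^sup>2) = 1}"
  define f where "f x = (\<Sum>i\<in>U. \<Sum>j\<in>U. t i j * x i * x j)" for x :: "'a \<Rightarrow> real"
  have cont: "continuous_on S (\<lambda>x::'a \<Rightarrow> real. x i)" for S i
    by (rule continuous_on_subset[OF continuous_on_product_coordinates subset_UNIV])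
  have "compactin (product_topology (\<lambda>i::'a. euclidean :: real topology) UNIV)
      (PiE UNIV (\<lambda>i. if i \<in> U then {0..1::real} else {0}))"
    unfolding compactin_PiE by (intro disjI2 ballI) (simp add: compact_Icc)
  then have "compact B" by (simp add: B_def PiE_UNIV_domain euclidean_product_topology)
  moreover have "closed {x::'a \<Rightarrow> real. (\<Sum>i\<in>U. (x i)\<^sup>2) = 1}"
    by (intro closed_Collect_eq continuous_intros cont)
  ultimately have "compact K" unfolding K_def by (rule compact_Int_closed)
  obtain k where k: "k \<in> U" using ne by blast
  have "(\<lambda>i. if i = k then 1 else 0) \<in> K"
    using fin k by (auto simp: K_def B_def if_distrib[of "\<lambda>a. a\<^sup>2"] cong: if_cong)
  then have "K \<noteq> {}" by blast
  moreover have "continuous_on K f" unfolding f_def by (intro continuous_intros cont)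
  ultimately obtain x where x: "x \<in> K" "\<And>y. y \<in> K \<Longrightarrow> f y \<le> f x"
    using continuous_attains_sup[OF \<open>compact K\<close>, of f] by blast
  define l where "l = f x"
  define s where "s k = (\<Sum>j\<in>U. t j k * x j)" for k
  have x0: "x i \<ge> 0" if "i \<in> U" for i using x(1) that by (auto simp: K_def B_def Pi_iff split: if_splits)
  have xo: "x i = 0" if "i \<notin> U" for i using x(1) that by (auto simp: K_def B_def Pi_iff split: if_splits)
  have x1: "(\<Sum>i\<in>U. (x i)\<^sup>2) = 1" using x(1) by (simp add: K_def)
  have bound: "f y \<le> l * (\<Sum>i\<in>U. (y i)\<^sup>2)"
    if y: "\<And>i. i \<in> U \<Longrightarrow> y i \<ge> 0" "\<And>i. i \<notin> U \<Longrightarrow> y i = 0" and pos: "(\<Sum>i\<in>U. (y i)\<^sup>2) > 0" for y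
  proof -
    define n where "n = sqrt (\<Sum>i\<in>U. (y i)\<^sup>2)"
    have n: "n > 0" "n\<^sup>2 = (\<Sum>i\<in>U. (y i)\<^sup>2)" using pos by (auto simp: n_def)
    have "y i \<le> n" if "i \<in> U" for i
    proof -
      have "(y i)\<^sup>2 \<le> n\<^sup>2" unfolding n using fin that by (intro member_le_sum) auto
      then show ?thesis by (rule power2_le_imp_le) (use n(1) in simp)
    qed
    moreover have "(\<Sum>i\<in>U. (y i / n)\<^sup>2) = 1"
    proof -
      have "(\<Sum>i\<in>U. (y i / n)\<^sup>2) = (\<Sum>i\<in>U. (y i)\<^sup>2) / n\<^sup>2"
        by (simp add: power_divide sum_divide_distrib)
      then show ?thesis unfolding n(2) using pos by simp
    qed
    ultimately have "(\<lambda>i. y i / n) \<in> K"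
      using y n(1) unfolding K_def B_def by (simp add: Pi_iff)
    then have "f (\<lambda>i. y i / n) \<le> l" using x(2) by (simp add: l_def)
    moreover have "f (\<lambda>i. y i / n) = f y / n\<^sup>2"
      by (simp add: f_def sum_divide_distrib power2_eq_square)
    ultimately have "f y / n\<^sup>2 \<le> l" by simp
    then show ?thesis unfolding n(2) using pos by (simp add: pos_divide_le_eq)
  qed
  \<comment> \<open>Only increases of a coordinate are tested, as a decrease could leave the
    nonnegative region. This yields an inequality; equality follows at the end by summation.\<close>
  have le: "s k \<le> l * x k" if k: "k \<in> U" for k
  proof (rule ccontr)
    assume "\<not> ?thesis"
    then have d: "s k - l * x k > 0" by simp
    \<comment> \<open>Small enough that the second-order term \<open>l * e\<close> stays below twice
      the gain \<open>s k - l * x k\<close>.\<close>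
    define e where "e = (s k - l * x k) / (\<bar>l\<bar> + 1)"
    have e: "e > 0" unfolding e_def using d by (intro divide_pos_pos) auto
    define y where "y = x(k := x k + e)"
    have ysq: "(\<Sum>i\<in>U. (y i)\<^sup>2) = 1 + (2 * e * x k + e\<^sup>2)"
    proof -
      have "(y i)\<^sup>2 = (x i)\<^sup>2 + (if i = k then 2 * e * x k + e\<^sup>2 else 0)" for i
        by (simp add: y_def power2_sum)
      then show ?thesis using fin k x1 by (simp add: sum.distrib)
    qed
    have "f y = l + 2 * e * s k"
      unfolding f_def y_def l_def s_def
      by (rule quadratic_form_shift[OF fin k]) (use sym diag k in auto)
    moreover have "f y \<le> l * (\<Sum>i\<in>U. (y i)\<^sup>2)"
    proof (rule bound)
      show "y i \<ge> 0" if "i \<in> U" for i using x0[OF that] e by (auto simp: y_def)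
      show "y i = 0" if "i \<notin> U" for i using xo[OF that] that k by (auto simp: y_def)
      show "(\<Sum>i\<in>U. (y i)\<^sup>2) > 0" unfolding ysq using x0[OF k] e by (intro add_pos_nonneg) auto
    qed
    ultimately have "2 * e * s k \<le> l * (2 * e * x k + e\<^sup>2)" by (simp add: ysq distrib_left)
    then have "e * (2 * (s k - l * x k)) \<le> e * (l * e)" by (simp add: algebra_simps power2_eq_square)
    then have "2 * (s k - l * x k) \<le> l * e" using e by simp
    also have "\<dots> \<le> (\<bar>l\<bar> + 1) * e" using e by (intro mult_right_mono) auto
    also have "\<dots> = s k - l * x k" by (simp add: e_def add_nonneg_eq_0_iff)
    finally show False using d by simp
  qed
  \<comment> \<open>By the inequality just shown a zero coordinate makes its neighbours vanish,
    hence all coordinates, against the normalisation.\<close>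
  have pos: "x k > 0" if k: "k \<in> U" for k
  proof (rule ccontr)
    assume "\<not> x k > 0"
    then have xk: "x k = 0" using x0[OF k] by simp
    have step: "x j = 0" if i: "i \<in> U" "x i = 0" and j: "j \<in> U" "t i j > 0" for i j
    proof -
      have "s i = 0"
      proof (rule antisym)
        show "s i \<le> 0" using le[OF i(1)] i(2) by simp
        show "0 \<le> s i" unfolding s_def using nonneg x0 i by (intro sum_nonneg mult_nonneg_nonneg) auto
      qed
      then have "\<forall>j\<in>U. t j i * x j = 0"
        unfolding s_def using nonneg x0 i fin by (subst (asm) sum_nonneg_eq_0_iff) auto
      then show ?thesis using j sym[OF i(1) j(1)] by auto
    qed
    have "x j = 0" if "j \<in> U" for j
      using conn[OF k that] by (induction rule: rtrancl_induct) (use xk step in auto)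
    then show False using x1 by simp
  qed
  \<comment> \<open>Both parts of the sum equal \<open>l\<close>; as its terms are nonnegative,
    every inequality is an equality.\<close>
  have "(\<Sum>k\<in>U. x k * (l * x k - s k)) = 0"
  proof -
    have "(\<Sum>k\<in>U. x k * s k) = l"
      unfolding s_def l_def f_def using sym by (simp add: sum_distrib_left mult_ac)
    moreover have "(\<Sum>k\<in>U. x k * (l * x k)) = l * (\<Sum>k\<in>U. (x k)\<^sup>2)"
      by (simp add: sum_distrib_left power2_eq_square mult_ac)
    ultimately show ?thesis by (simp add: right_diff_distrib sum_subtractf x1)
  qed
  then have "\<forall>k\<in>U. x k * (l * x k - s k) = 0"
    using fin le x0 by (subst (asm) sum_nonneg_eq_0_iff) auto
  then have "s k = l * x k" if "k \<in> U" for k using that pos by fastforce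
  then show thesis using that[of x l] pos unfolding s_def by blast
qed

section \<open>Ground states\<close>

lemma (in symmetric_graph) walk_connected_of_connected_on:
  assumes "connected_on E S"
  shows "walk_connected S"
  unfolding walk_connected_def
proof (intro ballI)
  fix a b assume a: "a \<in> S" and b: "b \<in> S"
  then have "(a, b) \<in> (edges_in E S)\<^sup>*" using assms by (simp add: connected_on_def)
  then show "\<exists>w. walk S w \<and> hd w = a \<and> last w = b"
  proof (induction rule: rtrancl_induct)
    case base
    show ?case by (rule exI[of _ "[a]"]) (use a in \<open>simp add: walk_def\<close>)
  next
    case (step y z)
    then obtain w where w: "walk S w" "hd w = a" "last w = y" by blast
    then have "walk S (w @ [z])" "hd (w @ [z]) = a"
      using step(2) by (auto simp: walk_def edges_in_def successively_append_iff)
    then show ?case by (metis last_snoc)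
  qed
qed

lemma flavor_count_hop:
  assumes "h \<in> {1..V}" "i \<in> {1..V}"
  shows "flavor_count V i (\<alpha> \<circ> transpose h i) b = flavor_count V h \<alpha> b"
  unfolding flavor_count_def
proof (rule bij_betw_same_card)
  show "bij_betw (transpose h i) {k \<in> {1..V} - {i}. (\<alpha> \<circ> transpose h i) k = b} {k \<in> {1..V} - {h}. \<alpha> k = b}"
    by (rule bij_betw_byWitness[where f' = "transpose h i"]) (use assms in \<open>auto simp: transpose_def\<close>)
qed

lemma hole_state_cfg: "hole_state V h \<alpha> S = (if S = cfg V h \<alpha> then (-1) ^ h else 0)"
  by (simp only: hole_state_def cfg_def)

section \<open>Configurations and words\<close>

definition hole :: "nat \<Rightarrow> mode set \<Rightarrow> nat" where
  "hole V S = (THE h. h \<in> {1..V} \<and> h \<notin> fst ` S)"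

definition label :: "mode set \<Rightarrow> nat \<Rightarrow> nat" where
  "label S i = (THE a. (i, a) \<in> S)"

lemma hole_cfg: "h \<in> {1..V} \<Longrightarrow> hole V (cfg V h \<alpha>) = h"
  unfolding hole_def by (rule the_equality) (force simp: cfg_def)+

lemma label_cfg: "i \<in> {1..V} - {h} \<Longrightarrow> label (cfg V h \<alpha>) i = \<alpha> i"
  unfolding label_def by (rule the_equality) (auto simp: mem_cfg)

text \<open>Position \<open>p\<close> of a word, counted from 0, is the \<open>p\<close>-th vertex different from the hole.\<close>
definition site :: "nat \<Rightarrow> nat \<Rightarrow> nat" where
  "site h p = (if p + 1 < h then p + 1 else p + 2)"

lemma bij_betw_site:
  assumes "h \<in> {1..V}"
  shows "bij_betw (site h) {..<V - 1} ({1..V} - {h})"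
  by (rule bij_betw_byWitness[where f' = "\<lambda>i. if i < h then i - 1 else i - 2"])
    (use assms in \<open>auto simp: site_def\<close>)

text \<open>The value 0 past the end is the padding prescribed by \<open>words\<close>.\<close>

definition word :: "nat \<Rightarrow> nat \<Rightarrow> (nat \<Rightarrow> nat) \<Rightarrow> nat \<Rightarrow> nat" where
  "word V h \<alpha> = (\<lambda>p. if p < V - 1 then \<alpha> (site h p) else 0)"

lemma site_mem: "h \<in> {1..V} \<Longrightarrow> p < V - 1 \<Longrightarrow> site h p \<in> {1..V} - {h}"
  using bij_betwE[OF bij_betw_site] by blast

lemma word_cong:
  assumes "h \<in> {1..V}" "\<And>i. i \<in> {1..V} - {h} \<Longrightarrow> \<alpha> i = \<beta> i"
  shows "word V h \<alpha> = word V h \<beta>"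
  unfolding word_def using assms site_mem by fastforce

lemma word_mem_words:
  assumes "valid_config V N h \<alpha>"
  shows "word V h \<alpha> \<in> words N (V - 1)"
proof -
  have "\<alpha> (site h p) \<in> {1..N}" if "p < V - 1" for p
    using assms site_mem[OF _ that] unfolding valid_config_def by blast
  then show ?thesis unfolding words_def word_def by simp
qed

lemma count_word:
  assumes "h \<in> {1..V}"
  shows "card {p \<in> {0..<V - 1}. word V h \<alpha> p = b} = flavor_count V h \<alpha> b"
  unfolding flavor_count_def
proof (rule bij_betw_same_card)
  have "bij_betw (site h) {p \<in> {..<V - 1}. \<alpha> (site h p) = b} {i \<in> {1..V} - {h}. \<alpha> i = b}"
    by (rule bij_betw_Collect[OF bij_betw_site[OF assms]]) simp
  moreover have "{p \<in> {0..<V - 1}. word V h \<alpha> p = b} = {p \<in> {..<V - 1}. \<alpha> (site h p) = b}"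
    by (auto simp: word_def)
  ultimately show "bij_betw (site h) {p \<in> {0..<V - 1}. word V h \<alpha> p = b} {i \<in> {1..V} - {h}. \<alpha> i = b}"
    by simp
qed

text \<open>With the hole at the last vertex, position \<open>p\<close> is vertex
  \<open>p + 1\<close>; so every word comes from a configuration.\<close>

lemma word_of_last_hole:
  assumes "w \<in> words N (V - 1)" "V \<ge> 1"
  shows "valid_config V N V (\<lambda>i. w (i - 1))" "word V V (\<lambda>i. w (i - 1)) = w"
proof -
  have "w (i - 1) \<in> {1..N}" if "i \<in> {1..V} - {V}" for i
  proof -
    have "i - 1 < V - 1" using that by auto
    then show ?thesis using assms(1) unfolding words_def by blast
  qed
  then show "valid_config V N V (\<lambda>i. w (i - 1))" using assms(2) by (simp add: valid_config_def)
  show "word V V (\<lambda>i. w (i - 1)) = w"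
    using assms(1) by (auto simp: word_def site_def words_def fun_eq_iff)
qed

text \<open>Words with equal letter counts are rearrangements of one another. This is what makes
  symmetric tensors insensitive to hops.\<close>

lemma sym_space_eq_of_count:
  assumes f: "f \<in> sym_space N M" and w: "w \<in> words N M" "w' \<in> words N M"
    and cnt: "\<And>b. card {p \<in> {0..<M}. w p = b} = card {p \<in> {0..<M}. w' p = b}"
  shows "f w = f w'"
proof -
  have "image_mset w (mset_set {0..<M}) = image_mset w' (mset_set {0..<M})"
  proof (rule multiset_eqI)
    fix c
    have "count (image_mset g (mset_set {0..<M})) c = card {p \<in> {0..<M}. g p = c}" for g :: "nat \<Rightarrow> nat"
      by (simp add: count_image_mset_eq_card_vimage)
    then show "count (image_mset w (mset_set {0..<M})) c = count (image_mset w' (mset_set {0..<M})) c"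
      using cnt by simp
  qed
  from image_mset_eq_implies_permutes[OF _ this]
  obtain p where p: "p permutes {0..<M}" "\<forall>x\<in>{0..<M}. w x = w' (p x)" by blast
  have "w = w' \<circ> p"
  proof
    fix x
    show "w x = (w' \<circ> p) x"
    proof (cases "x < M")
      case False
      then have "p x = x" using p(1) by (auto simp: permutes_def)
      then show ?thesis using False w by (simp add: words_def)
    qed (use p(2) in simp)
  qed
  then show ?thesis using f p(1) by (simp add: sym_space_def)
qed

lemma Hinf_mem_H1: "Hinf V N t \<psi> \<in> H1 V N"
  by (simp add: H1_def Hinf_def projP_def)

lemma words_comp_iff:
  assumes \<sigma>: "\<sigma> permutes {0..<M}"
  shows "w \<circ> \<sigma> \<in> words N M \<longleftrightarrow> w \<in> words N M"
proof
  have out: "\<sigma> p = p" if "p \<ge> M" for p using \<sigma> that by (auto simp: permutes_def)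
  {
    assume w: "w \<in> words N M"
    have "\<sigma> p < M \<longleftrightarrow> p < M" for p using permutes_in_image[OF \<sigma>, of p] by simp
    then show "w \<circ> \<sigma> \<in> words N M" using w out by (auto simp: words_def)
  }
  assume ws: "w \<circ> \<sigma> \<in> words N M"
  have "w p \<in> {1..N}" if "p < M" for p
  proof -
    have "inv \<sigma> p < M" using permutes_in_image[OF permutes_inv[OF \<sigma>], of p] that by simp
    then have "(w \<circ> \<sigma>) (inv \<sigma> p) \<in> {1..N}" using ws unfolding words_def by blast
    then show ?thesis using permutes_inverses(1)[OF \<sigma>] by simp
  qed
  moreover have "w p = 0" if "p \<ge> M" for p
    using ws out[OF that] that unfolding words_def by fastforce
  ultimately show "w \<in> words N M" by (simp add: words_def)
qed

text \<open>\<open>sector_walk\<close> is the outcome of the graph theory: within a sector the hole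
  can walk from any configuration to any other.\<close>

locale hole_system =
  fixes V N :: nat and E :: "nat \<Rightarrow> nat \<Rightarrow> bool" and t :: "nat \<Rightarrow> nat \<Rightarrow> real"
  assumes V2: "V \<ge> 2" and N1: "N \<ge> 1"
    and t_sym: "i \<in> {1..V} \<Longrightarrow> j \<in> {1..V} \<Longrightarrow> t i j = t j i"
    and t_pos: "i \<in> {1..V} \<Longrightarrow> j \<in> {1..V} \<Longrightarrow> E i j \<Longrightarrow> t i j > 0"
    and t_zero: "i \<in> {1..V} \<Longrightarrow> j \<in> {1..V} \<Longrightarrow> \<not> E i j \<Longrightarrow> t i j = 0"
    and irrefl: "i \<in> {1..V} \<Longrightarrow> \<not> E i i"
    and connected: "connected_on E {1..V}"
    and sector_walk: "valid_config V N h \<alpha> \<Longrightarrow> valid_config V N h' \<alpha>' \<Longrightarrow>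
      (\<And>b. flavor_count V h \<alpha> b = flavor_count V h' \<alpha>' b) \<Longrightarrow>
      \<exists>w. w \<noteq> [] \<and> set w \<subseteq> {1..V} \<and> successively E w \<and> hd w = h' \<and> last w = h \<and>
        (\<forall>i\<in>{1..V} - {h}. \<alpha>' (cycle_of_list w i) = \<alpha> i)"
begin

lemma t_diag: "\<forall>i\<in>{1..V}. t i i = 0"
  using t_zero irrefl by blast

lemma t_nonneg: "i \<in> {1..V} \<Longrightarrow> j \<in> {1..V} \<Longrightarrow> t i j \<ge> 0"
  using t_pos t_zero by (cases "E i j") (auto intro: less_imp_le)

lemma neighbour_exists:
  assumes "h \<in> {1..V}"
  obtains i where "i \<in> {1..V}" "E h i" "E i h"
proof -
  obtain j where j: "j \<in> {1..V}" "j \<noteq> h"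
    using V2 assms by (metis atLeastAtMost_iff le_refl le_trans one_le_numeral n_not_Suc_n Suc_1)
  then have "(h, j) \<in> (edges_in E {1..V})\<^sup>*" using connected assms by (simp add: connected_on_def)
  then obtain i where "(h, i) \<in> edges_in E {1..V}" using j(2) by (metis converse_rtranclE)
  then have i: "i \<in> {1..V}" "E h i" by (auto simp: edges_in_def)
  then have "t i h > 0" using t_pos[OF assms i] t_sym[OF assms i(1)] by simp
  then have "E i h" using t_zero[OF i(1) assms] by auto
  then show thesis using i that by blast
qed

lemma amp_Hinf_valid:
  "valid_config V N h \<alpha> \<Longrightarrow> amp V (Hinf V N t \<psi>) h \<alpha> =
    - (\<Sum>i\<in>{1..V} - {h}. complex_of_real (t i h) * amp V \<psi> i (\<alpha> \<circ> transpose h i))"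
  by (rule amp_Hinf) (use t_diag in auto)

context
  fixes g :: nat and \<gamma> :: "nat \<Rightarrow> nat"
  assumes g: "g \<in> {1..V}"
begin

text \<open>Counts walks of the hole from \<open>(h, \<alpha>)\<close> to \<open>(g, \<gamma>)\<close>, weighted by hopping amplitudes.\<close>
fun wgt :: "nat \<Rightarrow> nat \<Rightarrow> (nat \<Rightarrow> nat) \<Rightarrow> real" where
  "wgt 0 h \<alpha> = (if cfg V h \<alpha> = cfg V g \<gamma> then 1 else 0)"
| "wgt (Suc n) h \<alpha> = (\<Sum>i\<in>{1..V} - {h}. t i h * wgt n i (\<alpha> \<circ> transpose h i))"

lemma amp_power:
  assumes "valid_config V N h \<alpha>"
  shows "amp V ((Hinf V N t ^^ n) (hole_state V g \<gamma>)) h \<alpha> = (-1) ^ n * complex_of_real (wgt n h \<alpha>)"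
  using assms
proof (induction n arbitrary: h \<alpha>)
  case 0
  have h: "h \<in> {1..V}" using 0 by (simp add: valid_config_def)
  show ?case
  proof (cases "cfg V h \<alpha> = cfg V g \<gamma>")
    case True
    then have "h = g" using cfg_eq_iff[OF h g] by blast
    with True show ?thesis
      by (simp add: amp_def hole_state_cfg power_mult_distrib[symmetric])
  qed (simp add: amp_def hole_state_cfg)
next
  case (Suc n)
  have "amp V ((Hinf V N t ^^ Suc n) (hole_state V g \<gamma>)) h \<alpha> =
      - (\<Sum>i\<in>{1..V} - {h}. complex_of_real (t i h) *
          amp V ((Hinf V N t ^^ n) (hole_state V g \<gamma>)) i (\<alpha> \<circ> transpose h i))"
    using amp_Hinf_valid[OF Suc.prems] by simp
  also have "\<dots> = - (\<Sum>i\<in>{1..V} - {h}. complex_of_real (t i h) *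
          ((-1) ^ n * complex_of_real (wgt n i (\<alpha> \<circ> transpose h i))))"
  proof -
    have "amp V ((Hinf V N t ^^ n) (hole_state V g \<gamma>)) i (\<alpha> \<circ> transpose h i) =
        (-1) ^ n * complex_of_real (wgt n i (\<alpha> \<circ> transpose h i))" if "i \<in> {1..V} - {h}" for i
      using Suc.IH[OF valid_config_hop[OF Suc.prems]] that by blast
    then show ?thesis by simp
  qed
  also have "\<dots> = (-1) ^ Suc n * complex_of_real (wgt (Suc n) h \<alpha>)"
    by (simp add: sum_distrib_left sum_negf mult_ac)
  finally show ?case .
qed

lemma wgt_nonneg: "h \<in> {1..V} \<Longrightarrow> wgt n h \<alpha> \<ge> 0"
proof (induction n arbitrary: h \<alpha>)
  case (Suc n)
  then show ?case using t_nonneg by (auto intro!: sum_nonneg mult_nonneg_nonneg)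
qed simp

text \<open>One walk of the hole contributes a positive product of amplitudes, and nothing can
  cancel it because all weights are nonnegative.\<close>

lemma wgt_pos:
  assumes "successively E w" "set w \<subseteq> {1..V}" "w \<noteq> []" "last w = g"
    "\<And>i. i \<in> {1..V} - {g} \<Longrightarrow> \<alpha> (cycle_of_list w i) = \<gamma> i"
  shows "wgt (length w - 1) (hd w) \<alpha> > 0"
  using assms
proof (induction w arbitrary: \<alpha> rule: cycle_of_list.induct)
  case (1 h i w)
  have hi: "h \<in> {1..V}" "i \<in> {1..V}" "E h i" using 1 by auto
  then have "h \<noteq> i" using irrefl by blast
  have "wgt (length (i # w) - 1) (hd (i # w)) (\<alpha> \<circ> transpose h i) > 0"
    by (rule "1.IH") (use "1.prems" in auto)
  then have pos: "t i h * wgt (length w) i (\<alpha> \<circ> transpose h i) > 0"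
    using t_pos[OF hi] t_sym[OF hi(1,2)] by simp
  have "t i h * wgt (length w) i (\<alpha> \<circ> transpose h i) \<le>
      (\<Sum>i\<in>{1..V} - {h}. t i h * wgt (length w) i (\<alpha> \<circ> transpose h i))"
    by (rule member_le_sum) (use hi \<open>h \<noteq> i\<close> t_nonneg wgt_nonneg in \<open>auto intro!: mult_nonneg_nonneg\<close>)
  then show ?case using pos by simp
next
  case ("2_2" h)
  then have "h = g" by simp
  moreover have "cfg V g \<alpha> = cfg V g \<gamma>"
    by (rule cfg_cong) (use "2_2"(5) in simp)
  ultimately show ?case by simp
qed simp

end

lemma inner_hole_state:
  assumes "valid_config V N h \<alpha>"
  shows "Defs.inner V N (hole_state V h \<alpha>) \<psi> = amp V \<psi> h \<alpha>"
proof -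
  have "Defs.inner V N (hole_state V h \<alpha>) \<psi> =
      (\<Sum>S\<in>Pow (modes V N). if S = cfg V h \<alpha> then amp V \<psi> h \<alpha> else 0)"
    unfolding Defs.inner_def by (rule sum.cong) (auto simp: hole_state_cfg amp_def)
  also have "\<dots> = amp V \<psi> h \<alpha>"
    using finite_modes cfg_subset_modes[OF assms] by (simp add: sum.delta)
  finally show ?thesis .
qed

lemma connectivity_holds: "connectivity V N t m"
  unfolding connectivity_def
proof (intro allI impI)
  fix h \<alpha> h' \<alpha>' assume s: "in_sector V N m h \<alpha>" "in_sector V N m h' \<alpha>'"
  then have val: "valid_config V N h \<alpha>" "valid_config V N h' \<alpha>'" by (auto simp: in_sector_def)
  then have h: "h \<in> {1..V}" "h' \<in> {1..V}" by (auto simp: valid_config_def)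
  have "flavor_count V h \<alpha> b = flavor_count V h' \<alpha>' b" for b
  proof (cases "b \<in> {1..N}")
    case True
    then show ?thesis using s by (simp add: in_sector_def)
  next
    case False
    have "{i \<in> {1..V} - {k}. \<beta> i = b} = {}" if "valid_config V N k \<beta>" for k \<beta>
      using that False unfolding valid_config_def by blast
    then show ?thesis using val unfolding flavor_count_def by presburger
  qed
  from sector_walk[OF val this] obtain w where w: "w \<noteq> []" "set w \<subseteq> {1..V}" "successively E w"
    "hd w = h'" "last w = h" "\<And>i. i \<in> {1..V} - {h} \<Longrightarrow> \<alpha>' (cycle_of_list w i) = \<alpha> i" by blast
  \<comment> \<open>The walk may be trivial, whereas a power \<open>n \<ge> 1\<close> is required; a
    step to a neighbour and back is put in front, which changes no label.\<close>
  obtain i where i: "i \<in> {1..V}" "E h' i" "E i h'" using neighbour_exists[OF h(2)] by blast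
  obtain r where r: "w = h' # r" using w(1,4) by (cases w) auto
  have "wgt h \<alpha> (length (h' # i # w) - 1) (hd (h' # i # w)) \<alpha>' > 0"
  proof (rule wgt_pos[OF h(1)])
    show "\<alpha>' (cycle_of_list (h' # i # w) k) = \<alpha> k" if "k \<in> {1..V} - {h}" for k
      using w(6)[OF that] by (simp add: r transpose_commute[of i h'])
  qed (use w i h r in auto)
  then have "amp V ((Hinf V N t ^^ (length w + 1)) (hole_state V h \<alpha>)) h' \<alpha>' \<noteq> 0"
    using amp_power[OF h(1) val(2), of "length w + 1" \<alpha>] by (simp del: funpow.simps wgt.simps)
  then show "\<exists>n\<ge>1. Defs.inner V N (hole_state V h' \<alpha>') ((Hinf V N t ^^ n) (hole_state V h \<alpha>)) \<noteq> 0"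
    using inner_hole_state[OF val(2)] by (intro exI[of _ "length w + 1"]) simp
qed

lemma connected_weights:
  assumes "i \<in> {1..V}" "j \<in> {1..V}"
  shows "(i, j) \<in> {(i, j). i \<in> {1..V} \<and> j \<in> {1..V} \<and> t i j > 0}\<^sup>*"
proof -
  have "edges_in E {1..V} \<subseteq> {(i, j). i \<in> {1..V} \<and> j \<in> {1..V} \<and> t i j > 0}"
    using t_pos by (auto simp: edges_in_def)
  from rtrancl_mono[OF this] show ?thesis
    using connected assms unfolding connected_on_def by blast
qed

end

section \<open>Eigenvectors compared with the Perron vector\<close>

locale perron_hole_system = hole_system +
  fixes \<phi> :: "nat \<Rightarrow> real" and l :: real
  assumes phi_pos: "i \<in> {1..V} \<Longrightarrow> \<phi> i > 0"
    and phi_eig: "i \<in> {1..V} \<Longrightarrow> (\<Sum>j\<in>{1..V}. t j i * \<phi> j) = l * \<phi> i"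
begin

lemma phi_eig':
  assumes "h \<in> {1..V}"
  shows "(\<Sum>i\<in>{1..V} - {h}. t i h * \<phi> i) = l * \<phi> h"
proof -
  have "(\<Sum>i\<in>{1..V} - {h}. t i h * \<phi> i) = (\<Sum>i\<in>{1..V}. t i h * \<phi> i)"
    by (rule sum.mono_neutral_left) (use t_diag assms in auto)
  then show ?thesis using phi_eig[OF assms] by simp
qed

lemma finite_H1_states: "finite {S. in_H1 V N S}"
  by (rule finite_subset[of _ "Pow (modes V N)"]) (auto simp: in_H1_def finite_modes)

text \<open>At a configuration where the modulus of the amplitude divided by \<open>\<phi>\<close>
  is largest, the eigenvalue equation bounds \<open>cmod e\<close> by a weighted sum of hopping
  amplitudes, which is \<open>l\<close> by \<open>phi_eig'\<close>.\<close>

lemma eigenvalue_bound: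
  assumes \<psi>: "\<psi> \<in> H1 V N" "\<psi> S \<noteq> 0" and eig: "Hinf V N t \<psi> = (\<lambda>S. e * \<psi> S)"
  shows "cmod e \<le> l"
proof -
  define \<rho> where "\<rho> S = cmod (\<psi> S) / \<phi> (hole V S)" for S
  define M where "M = Max (\<rho> ` {S. in_H1 V N S})"
  have S: "in_H1 V N S" using \<psi> by (simp add: H1_def)
  have V1: "V \<ge> 1" using V2 by simp
  have le: "\<rho> T \<le> M" if "in_H1 V N T" for T
    unfolding M_def using finite_H1_states that by (intro Max_ge) auto
  have "M \<in> \<rho> ` {S. in_H1 V N S}"
    unfolding M_def using finite_H1_states S by (intro Max_in) auto
  then obtain T where T: "in_H1 V N T" "\<rho> T = M" by blast
  obtain h \<alpha> where val: "valid_config V N h \<alpha>" and Th: "T = cfg V h \<alpha>" by (rule in_H1_cases[OF T(1) V1])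
  have h: "h \<in> {1..V}" using val by (simp add: valid_config_def)
  have norm_amp: "cmod (amp V \<psi> k \<beta>) = \<phi> k * \<rho> (cfg V k \<beta>)" if "k \<in> {1..V}" for k \<beta>
    using phi_pos[OF that] by (simp add: amp_def \<rho>_def hole_cfg[OF that] norm_mult norm_power)
  have "M > 0"
  proof -
    obtain k \<beta> where k: "valid_config V N k \<beta>" and Sk: "S = cfg V k \<beta>" by (rule in_H1_cases[OF S V1])
    then have "k \<in> {1..V}" by (simp add: valid_config_def)
    then have "\<rho> S > 0" using \<psi>(2) phi_pos by (simp add: \<rho>_def Sk hole_cfg)
    then show ?thesis using le[OF S] by simp
  qed
  have "e * amp V \<psi> h \<alpha> = - (\<Sum>i\<in>{1..V} - {h}. complex_of_real (t i h) * amp V \<psi> i (\<alpha> \<circ> transpose h i))"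
    using amp_Hinf_valid[OF val, of \<psi>] by (simp add: eig amp_def mult_ac)
  then have "cmod e * (\<phi> h * M) = cmod (\<Sum>i\<in>{1..V} - {h}. complex_of_real (t i h) * amp V \<psi> i (\<alpha> \<circ> transpose h i))"
    using norm_amp[OF h, of \<alpha>] T(2) Th norm_mult[of e "amp V \<psi> h \<alpha>"] norm_minus_cancel by simp
  also have "\<dots> \<le> (\<Sum>i\<in>{1..V} - {h}. t i h * (\<phi> i * M))"
  proof (rule sum_norm_le)
    fix i assume i: "i \<in> {1..V} - {h}"
    then have i': "i \<in> {1..V}" by simp
    have "\<phi> i * \<rho> (cfg V i (\<alpha> \<circ> transpose h i)) \<le> \<phi> i * M"
      using le[OF in_H1_cfg[OF valid_config_hop[OF val i']]] phi_pos[OF i'] by (intro mult_left_mono) auto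
    then show "cmod (complex_of_real (t i h) * amp V \<psi> i (\<alpha> \<circ> transpose h i)) \<le> t i h * (\<phi> i * M)"
      using norm_amp[OF i'] t_nonneg[OF i' h] by (simp add: norm_mult mult_left_mono)
  qed
  also have "\<dots> = l * (\<phi> h * M)"
    using phi_eig'[OF h] by (simp add: sum_distrib_right[symmetric] mult.assoc[symmetric])
  finally show ?thesis using \<open>M > 0\<close> phi_pos[OF h] by simp
qed

text \<open>Maximum principle: at a maximum over a sector the value is a weighted average of the
  neighbouring values, so the maximum propagates along every walk of the hole.\<close>
lemma harmonic_constant:
  fixes G :: "mode set \<Rightarrow> real"
  assumes harm: "\<And>h \<alpha>. valid_config V N h \<alpha> \<Longrightarrow>
      l * \<phi> h * G (cfg V h \<alpha>) = (\<Sum>i\<in>{1..V} - {h}. t i h * \<phi> i * G (cfg V i (\<alpha> \<circ> transpose h i)))"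
    and val: "valid_config V N h \<alpha>" "valid_config V N h' \<alpha>'"
    and cnt: "\<And>b. flavor_count V h \<alpha> b = flavor_count V h' \<alpha>' b"
  shows "G (cfg V h \<alpha>) = G (cfg V h' \<alpha>')"
proof -
  define Sec where "Sec = {cfg V k \<beta> | k \<beta>. valid_config V N k \<beta> \<and> (\<forall>b. flavor_count V k \<beta> b = flavor_count V h \<alpha> b)}"
  have "Sec \<subseteq> {S. in_H1 V N S}" unfolding Sec_def using in_H1_cfg by blast
  then have fin: "finite Sec" using finite_H1_states finite_subset by blast
  have mem: "cfg V h \<alpha> \<in> Sec" "cfg V h' \<alpha>' \<in> Sec" unfolding Sec_def using val cnt by auto
  define M where "M = Max (G ` Sec)"
  have le: "G T \<le> M" if "T \<in> Sec" for T unfolding M_def using fin that by simp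
  have "M \<in> G ` Sec" unfolding M_def using fin mem by (intro Max_in) auto
  then obtain k \<beta> where k: "valid_config V N k \<beta>" "\<And>b. flavor_count V k \<beta> b = flavor_count V h \<alpha> b"
    "G (cfg V k \<beta>) = M" unfolding Sec_def by auto
  have step: "G (cfg V i (\<beta> \<circ> transpose k i)) = M"
    if v: "valid_config V N k \<beta>" "\<And>b. flavor_count V k \<beta> b = flavor_count V h \<alpha> b" "G (cfg V k \<beta>) = M"
      and i: "i \<in> {1..V}" "E k i" for k \<beta> i
  proof -
    have kV: "k \<in> {1..V}" using v by (simp add: valid_config_def)
    \<comment> \<open>\<open>M\<close> times the Perron equation minus the equation for
      \<open>G\<close>: nonnegative deficits add up to zero, so every neighbour attains the maximum
      as well.\<close>
    have "(\<Sum>i\<in>{1..V} - {k}. t i k * \<phi> i * (M - G (cfg V i (\<beta> \<circ> transpose k i)))) = 0"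
      using harm[OF v(1)] phi_eig'[OF kV] v(3)
      by (simp add: right_diff_distrib sum_subtractf sum_distrib_right[symmetric])
    moreover have "t j k * \<phi> j * (M - G (cfg V j (\<beta> \<circ> transpose k j))) \<ge> 0" if j: "j \<in> {1..V} - {k}" for j
    proof -
      have "cfg V j (\<beta> \<circ> transpose k j) \<in> Sec"
      proof -
        have j': "j \<in> {1..V}" using j by simp
        have "\<forall>b. flavor_count V j (\<beta> \<circ> transpose k j) b = flavor_count V h \<alpha> b"
          using flavor_count_hop[OF kV j'] v(2) by simp
        then show ?thesis unfolding Sec_def using valid_config_hop[OF v(1) j'] by blast
      qed
      then show ?thesis using le t_nonneg[of j k] phi_pos[of j] j kV by (intro mult_nonneg_nonneg) auto
    qed
    ultimately have zero: "\<forall>j\<in>{1..V} - {k}. t j k * \<phi> j * (M - G (cfg V j (\<beta> \<circ> transpose k j))) = 0"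
      by (subst (asm) sum_nonneg_eq_0_iff) auto
    have "i \<noteq> k" using i irrefl kV by auto
    then have "t i k * \<phi> i * (M - G (cfg V i (\<beta> \<circ> transpose k i))) = 0" using zero i(1) by blast
    moreover have "t i k * \<phi> i > 0" using t_pos[OF kV i] t_sym[OF kV i(1)] phi_pos[OF i(1)] by simp
    ultimately show ?thesis by auto
  qed
  have along: "G (cfg V (last w) (\<beta> \<circ> cycle_of_list w)) = M"
    if "successively E w" "set w \<subseteq> {1..V}" "w \<noteq> []" "valid_config V N (hd w) \<beta>"
      "\<And>b. flavor_count V (hd w) \<beta> b = flavor_count V h \<alpha> b" "G (cfg V (hd w) \<beta>) = M" for w \<beta>
    using that
  proof (induction w arbitrary: \<beta> rule: cycle_of_list.induct)
    case (1 p q w)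
    have pq: "p \<in> {1..V}" "q \<in> {1..V}" "E p q" using "1.prems" by auto
    have v: "valid_config V N p \<beta>" "\<And>b. flavor_count V p \<beta> b = flavor_count V h \<alpha> b" "G (cfg V p \<beta>) = M"
      using "1.prems" by simp_all
    have "G (cfg V (last (q # w)) ((\<beta> \<circ> transpose p q) \<circ> cycle_of_list (q # w))) = M"
    proof (rule "1.IH")
      show "successively E (q # w)" "set (q # w) \<subseteq> {1..V}" "q # w \<noteq> []" using "1.prems" by auto
      show "valid_config V N (hd (q # w)) (\<beta> \<circ> transpose p q)" using valid_config_hop[OF v(1) pq(2)] by simp
      show "flavor_count V (hd (q # w)) (\<beta> \<circ> transpose p q) b = flavor_count V h \<alpha> b" for b
        using flavor_count_hop[OF pq(1,2)] v(2) by simp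
      show "G (cfg V (hd (q # w)) (\<beta> \<circ> transpose p q)) = M" using step[OF v pq(2,3)] by simp
    qed
    then show ?case
      by (simp only: cycle_of_list.simps(1) comp_assoc last.simps list.distinct if_False)
  qed simp_all
  have eqM: "G (cfg V h1 \<alpha>1) = M"
    if v: "valid_config V N h1 \<alpha>1" and c: "\<And>b. flavor_count V h1 \<alpha>1 b = flavor_count V h \<alpha> b" for h1 \<alpha>1
  proof -
    have "flavor_count V h1 \<alpha>1 b = flavor_count V k \<beta> b" for b using c k(2) by simp
    from sector_walk[OF v k(1) this] obtain w where w: "w \<noteq> []" "set w \<subseteq> {1..V}" "successively E w"
      "hd w = k" "last w = h1" "\<And>i. i \<in> {1..V} - {h1} \<Longrightarrow> \<beta> (cycle_of_list w i) = \<alpha>1 i" by blast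
    have "cfg V h1 (\<beta> \<circ> cycle_of_list w) = cfg V h1 \<alpha>1" by (rule cfg_cong) (use w(6) in simp)
    then show ?thesis using along[OF w(3,2,1), of \<beta>] w(4,5) k by simp
  qed
  show ?thesis using eqM[OF val(1) refl] eqM[OF val(2) cnt[symmetric]] by simp
qed

text \<open>The maximum principle concerns real functions, so it is applied to real and imaginary
  parts separately; \<open>P\<close> stands for either.\<close>

lemma ground_amp_ratio:
  assumes eig: "Hinf V N t \<psi> = (\<lambda>S. complex_of_real (- l) * \<psi> S)"
    and val: "valid_config V N h \<alpha>" "valid_config V N h' \<alpha>'"
    and cnt: "\<And>b. flavor_count V h \<alpha> b = flavor_count V h' \<alpha>' b"
  shows "amp V \<psi> h \<alpha> / \<phi> h = amp V \<psi> h' \<alpha>' / \<phi> h'"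
proof -
  have main: "P (amp V \<psi> h \<alpha>) / \<phi> h = P (amp V \<psi> h' \<alpha>') / \<phi> h'"
    if P: "\<And>z. P (- z) = - P z" "\<And>r z. P (complex_of_real r * z) = r * P z"
      "\<And>(f :: nat \<Rightarrow> complex) A. P (\<Sum>i\<in>A. f i) = (\<Sum>i\<in>A. P (f i))" for P :: "complex \<Rightarrow> real"
  proof -
    define G where "G S = P ((-1) ^ hole V S * \<psi> S) / \<phi> (hole V S)" for S
    have G: "G (cfg V k \<beta>) = P (amp V \<psi> k \<beta>) / \<phi> k" if "k \<in> {1..V}" for k \<beta>
      using that by (simp add: G_def hole_cfg amp_def)
    have hV: "h \<in> {1..V}" "h' \<in> {1..V}" using val by (auto simp: valid_config_def)
    have "G (cfg V h \<alpha>) = G (cfg V h' \<alpha>')"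
    proof (rule harmonic_constant[OF _ val cnt])
      fix k \<beta> assume v: "valid_config V N k \<beta>"
      then have k: "k \<in> {1..V}" by (simp add: valid_config_def)
      have "complex_of_real (- l) * amp V \<psi> k \<beta> =
          - (\<Sum>i\<in>{1..V} - {k}. complex_of_real (t i k) * amp V \<psi> i (\<beta> \<circ> transpose k i))"
        using amp_Hinf_valid[OF v, of \<psi>] by (simp add: eig amp_def mult_ac)
      from arg_cong[OF this, of P]
      have "l * P (amp V \<psi> k \<beta>) = (\<Sum>i\<in>{1..V} - {k}. t i k * P (amp V \<psi> i (\<beta> \<circ> transpose k i)))"
        unfolding P by simp
      moreover have "P (amp V \<psi> i \<gamma>) = \<phi> i * G (cfg V i \<gamma>)" if "i \<in> {1..V}" for i \<gamma>
        using G[OF that] phi_pos[OF that] by simp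
      ultimately show "l * \<phi> k * G (cfg V k \<beta>) =
          (\<Sum>i\<in>{1..V} - {k}. t i k * \<phi> i * G (cfg V i (\<beta> \<circ> transpose k i)))"
        using k by (simp add: mult.assoc)
    qed
    then show ?thesis using G hV by simp
  qed
  have "Re (amp V \<psi> h \<alpha>) / \<phi> h = Re (amp V \<psi> h' \<alpha>') / \<phi> h'" by (rule main) auto
  moreover have "Im (amp V \<psi> h \<alpha>) / \<phi> h = Im (amp V \<psi> h' \<alpha>') / \<phi> h'" by (rule main) auto
  ultimately show ?thesis by (simp add: complex_eq_iff)
qed

section \<open>The ground space as a space of symmetric tensors\<close>

definition embed :: "((nat \<Rightarrow> nat) \<Rightarrow> complex) \<Rightarrow> fvec" where
  "embed f = (\<lambda>S. if in_H1 V N S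
     then (-1) ^ hole V S * complex_of_real (\<phi> (hole V S)) * f (word V (hole V S) (label S)) else 0)"

lemma embed_cfg:
  assumes "valid_config V N h \<alpha>"
  shows "embed f (cfg V h \<alpha>) = (-1) ^ h * complex_of_real (\<phi> h) * f (word V h \<alpha>)"
proof -
  have h: "h \<in> {1..V}" using assms by (simp add: valid_config_def)
  have "word V h (label (cfg V h \<alpha>)) = word V h \<alpha>"
    by (rule word_cong[OF h label_cfg])
  then show ?thesis using in_H1_cfg[OF assms] by (simp add: embed_def hole_cfg[OF h])
qed

lemma amp_embed:
  "valid_config V N h \<alpha> \<Longrightarrow> amp V (embed f) h \<alpha> = complex_of_real (\<phi> h) * f (word V h \<alpha>)"
  by (simp add: amp_def embed_cfg mult.assoc[symmetric] power_mult_distrib[symmetric])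

lemma embed_mem_H1: "embed f \<in> H1 V N"
  by (simp add: H1_def embed_def)

lemma fvec_eqI:
  assumes "\<psi> \<in> H1 V N" "\<psi>' \<in> H1 V N"
    and "\<And>h \<alpha>. valid_config V N h \<alpha> \<Longrightarrow> amp V \<psi> h \<alpha> = amp V \<psi>' h \<alpha>"
  shows "\<psi> = \<psi>'"
proof
  fix S
  show "\<psi> S = \<psi>' S"
  proof (cases "in_H1 V N S")
    case True
    then obtain h \<alpha> where "valid_config V N h \<alpha>" "S = cfg V h \<alpha>"
      using in_H1_cases V2 by (metis one_le_numeral order_trans)
    then show ?thesis using assms(3)[of h \<alpha>] by (simp add: amp_def)
  next
    case False
    then have "\<psi> S = 0" "\<psi>' S = 0" using assms by (auto simp: H1_def)
    then show ?thesis by simp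
  qed
qed

lemma sym_space_sector:
  assumes "f \<in> sym_space N (V - 1)" "valid_config V N h \<alpha>" "valid_config V N h' \<alpha>'"
    and "\<And>b. flavor_count V h \<alpha> b = flavor_count V h' \<alpha>' b"
  shows "f (word V h \<alpha>) = f (word V h' \<alpha>')"
proof (rule sym_space_eq_of_count[OF assms(1) word_mem_words[OF assms(2)] word_mem_words[OF assms(3)]])
  have "h \<in> {1..V}" "h' \<in> {1..V}" using assms by (auto simp: valid_config_def)
  then show "card {p \<in> {0..<V - 1}. word V h \<alpha> p = b} = card {p \<in> {0..<V - 1}. word V h' \<alpha>' p = b}" for b
    using assms(4) by (simp only: count_word)
qed

lemma embed_mem_ground_space:
  assumes f: "f \<in> sym_space N (V - 1)"
  shows "embed f \<in> ground_space V N t (- l)"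
proof -
  have "Hinf V N t (embed f) = (\<lambda>S. complex_of_real (- l) * embed f S)"
  proof (rule fvec_eqI)
    show "Hinf V N t (embed f) \<in> H1 V N" by (rule Hinf_mem_H1)
    show "(\<lambda>S. complex_of_real (- l) * embed f S) \<in> H1 V N"
      using embed_mem_H1[of f] by (simp add: H1_def)
    fix h \<alpha> assume val: "valid_config V N h \<alpha>"
    then have h: "h \<in> {1..V}" by (simp add: valid_config_def)
    have "amp V (embed f) i (\<alpha> \<circ> transpose h i) = complex_of_real (\<phi> i) * f (word V h \<alpha>)" if i: "i \<in> {1..V} - {h}" for i
    proof -
      have i': "i \<in> {1..V}" using i by simp
      have "f (word V i (\<alpha> \<circ> transpose h i)) = f (word V h \<alpha>)"
        by (rule sym_space_sector[OF f valid_config_hop[OF val i'] val flavor_count_hop[OF h i']])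
      then show ?thesis using amp_embed[OF valid_config_hop[OF val i']] by simp
    qed
    then have "amp V (Hinf V N t (embed f)) h \<alpha> =
        - (\<Sum>i\<in>{1..V} - {h}. complex_of_real (t i h * \<phi> i) * f (word V h \<alpha>))"
      using amp_Hinf_valid[OF val, of "embed f"] by (simp add: mult.assoc)
    also have "\<dots> = - (complex_of_real (\<Sum>i\<in>{1..V} - {h}. t i h * \<phi> i) * f (word V h \<alpha>))"
      by (simp add: sum_distrib_right)
    also have "\<dots> = - (complex_of_real (l * \<phi> h) * f (word V h \<alpha>))"
      by (simp only: phi_eig'[OF h])
    also have "\<dots> = amp V (\<lambda>S. complex_of_real (- l) * embed f S) h \<alpha>"
      using amp_embed[OF val, of f] by (simp add: amp_def mult_ac)
    finally show "amp V (Hinf V N t (embed f)) h \<alpha> = amp V (\<lambda>S. complex_of_real (- l) * embed f S) h \<alpha>" .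
  qed
  then show ?thesis using embed_mem_H1 by (simp add: ground_space_def)
qed

text \<open>Configurations with the hole at \<open>V\<close> already produce every word, and
  \<open>\<phi> V\<close> is positive.\<close>

lemma embed_inj: "inj_on embed (sym_space N (V - 1))"
proof (rule inj_onI)
  fix f g assume f: "f \<in> sym_space N (V - 1)" and g: "g \<in> sym_space N (V - 1)" and eq: "embed f = embed g"
  show "f = g"
  proof
    fix w
    show "f w = g w"
    proof (cases "w \<in> words N (V - 1)")
      case True
      have V1: "V \<ge> 1" using V2 by simp
      note w = word_of_last_hole[OF True V1]
      have "complex_of_real (\<phi> V) * f w = complex_of_real (\<phi> V) * g w"
        using amp_embed[OF w(1), of f] amp_embed[OF w(1), of g] eq w(2) by simp
      moreover have "\<phi> V > 0" using phi_pos V1 by simp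
      ultimately show ?thesis by simp
    next
      case False
      then have "f w = 0" "g w = 0" using f g by (auto simp: sym_space_def)
      then show ?thesis by simp
    qed
  qed
qed

text \<open>The tensor is read off from the amplitudes with the hole at \<open>V\<close>. By
  \<open>ground_amp_ratio\<close> any configuration with the same flavor counts gives the same
  value, whence both the symmetry and the recovery of \<open>\<psi>\<close>.\<close>

lemma embed_surj:
  assumes "\<psi> \<in> ground_space V N t (- l)"
  shows "\<exists>f\<in>sym_space N (V - 1). embed f = \<psi>"
proof -
  have \<psi>: "\<psi> \<in> H1 V N" and eig: "Hinf V N t \<psi> = (\<lambda>S. complex_of_real (- l) * \<psi> S)"
    using assms by (auto simp: ground_space_def)
  have V1: "V \<ge> 1" "V \<in> {1..V}" using V2 by auto
  define f where "f w = (if w \<in> words N (V - 1) then amp V \<psi> V (\<lambda>i. w (i - 1)) / \<phi> V else 0)" for w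
  have f_ratio: "f w = amp V \<psi> h \<alpha> / \<phi> h"
    if w: "w \<in> words N (V - 1)" and val: "valid_config V N h \<alpha>"
      and cnt: "\<And>b. card {p \<in> {0..<V - 1}. w p = b} = flavor_count V h \<alpha> b" for w h \<alpha>
  proof -
    note ww = word_of_last_hole[OF w V1(1)]
    have "flavor_count V V (\<lambda>i. w (i - 1)) b = flavor_count V h \<alpha> b" for b
      using count_word[OF V1(2), of "\<lambda>i. w (i - 1)" b] ww(2) cnt by simp
    from ground_amp_ratio[OF eig ww(1) val this] show ?thesis using w by (simp add: f_def)
  qed
  have "f \<in> sym_space N (V - 1)"
    unfolding sym_space_def
  proof (intro CollectI conjI allI impI)
    show "w \<in> words N (V - 1)" if "f w \<noteq> 0" for w using that by (auto simp: f_def split: if_splits)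
    fix w \<sigma> assume \<sigma>: "\<sigma> permutes {0..<V - 1}"
    show "f (w \<circ> \<sigma>) = f w"
    proof (cases "w \<in> words N (V - 1)")
      case True
      note ww = word_of_last_hole[OF True V1(1)]
      have c1: "card {p \<in> {0..<V - 1}. w p = b} = flavor_count V V (\<lambda>i. w (i - 1)) b" for b
        using count_word[OF V1(2), of "\<lambda>i. w (i - 1)" b] ww(2) by simp
      have "card {p \<in> {0..<V - 1}. (w \<circ> \<sigma>) p = b} = card {p \<in> {0..<V - 1}. w p = b}" for b
        by (rule bij_betw_same_card[where f = \<sigma>], rule bij_betw_Collect[OF permutes_imp_bij[OF \<sigma>]]) simp
      then have c2: "card {p \<in> {0..<V - 1}. (w \<circ> \<sigma>) p = b} = flavor_count V V (\<lambda>i. w (i - 1)) b" for b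
        using c1 by simp
      have ws: "w \<circ> \<sigma> \<in> words N (V - 1)" using words_comp_iff[OF \<sigma>] True by blast
      show ?thesis
        by (rule trans[OF f_ratio[OF ws ww(1) c2] f_ratio[OF True ww(1) c1, symmetric]])
    next
      case False
      then show ?thesis using words_comp_iff[OF \<sigma>, of w N] by (simp only: f_def if_False)
    qed
  qed
  moreover have "embed f = \<psi>"
  proof (rule fvec_eqI[OF embed_mem_H1 \<psi>])
    fix h \<alpha> assume val: "valid_config V N h \<alpha>"
    then have h: "h \<in> {1..V}" by (simp add: valid_config_def)
    have "f (word V h \<alpha>) = amp V \<psi> h \<alpha> / \<phi> h"
      by (rule f_ratio[OF word_mem_words[OF val] val count_word[OF h]])
    then show "amp V (embed f) h \<alpha> = amp V \<psi> h \<alpha>"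
      using amp_embed[OF val, of f] phi_pos[OF h] by simp
  qed
  ultimately show ?thesis by blast
qed

text \<open>The generator leaves the hole alone, so the prefactor is unaffected; \<open>site\<close>
  translates the sum over occupied vertices into one over word positions.\<close>

lemma embed_sym_gen:
  assumes a: "a \<in> {1..N}" and b: "b \<in> {1..N}"
  shows "embed (sym_gen (V - 1) a b f) = su_gen V a b (embed f)"
proof (rule fvec_eqI[OF embed_mem_H1])
  show "su_gen V a b (embed f) \<in> H1 V N"
    using su_gen_outside[OF embed_mem_H1 _ a] by (auto simp: H1_def)
  fix h \<alpha> assume val: "valid_config V N h \<alpha>"
  then have h: "h \<in> {1..V}" by (simp add: valid_config_def)
  have bij: "bij_betw (site h) {..<V - 1} ({1..V} - {h})" by (rule bij_betw_site[OF h])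
  have upd: "word V h (\<alpha>(site h p := b)) = (word V h \<alpha>)(p := b)" if p: "p < V - 1" for p
  proof
    fix q
    have "site h q = site h p \<longleftrightarrow> q = p" if "q < V - 1"
      using bij p that unfolding bij_betw_def inj_on_def by auto
    then show "word V h (\<alpha>(site h p := b)) q = ((word V h \<alpha>)(p := b)) q"
      using p by (auto simp: word_def)
  qed
  have "amp V (su_gen V a b (embed f)) h \<alpha> =
      (\<Sum>i\<in>{1..V} - {h}. (-1) ^ h * (if \<alpha> i = a then embed f (cfg V h (\<alpha>(i := b))) else 0))"
    by (simp only: amp_def su_gen_cfg[OF h] sum_distrib_left)
  also have "\<dots> = (\<Sum>i\<in>{1..V} - {h}. if \<alpha> i = a then complex_of_real (\<phi> h) * f (word V h (\<alpha>(i := b))) else 0)"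
  proof (rule sum.cong[OF refl])
    fix i assume i: "i \<in> {1..V} - {h}"
    have "valid_config V N h (\<alpha>(i := b))" using val b by (simp add: valid_config_def)
    from amp_embed[OF this, of f]
    show "(-1) ^ h * (if \<alpha> i = a then embed f (cfg V h (\<alpha>(i := b))) else 0) =
        (if \<alpha> i = a then complex_of_real (\<phi> h) * f (word V h (\<alpha>(i := b))) else 0)"
      by (simp add: amp_def)
  qed
  also have "\<dots> = (\<Sum>p<V - 1. if \<alpha> (site h p) = a
      then complex_of_real (\<phi> h) * f (word V h (\<alpha>(site h p := b))) else 0)"
    by (rule sum.reindex_bij_betw[OF bij, symmetric])
  also have "\<dots> = (\<Sum>p<V - 1. complex_of_real (\<phi> h) *
      (if word V h \<alpha> p = a then f ((word V h \<alpha>)(p := b)) else 0))"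
    by (rule sum.cong[OF refl]) (simp add: upd, simp add: word_def)
  also have "\<dots> = complex_of_real (\<phi> h) * sym_gen (V - 1) a b f (word V h \<alpha>)"
    by (simp only: sym_gen_def sum_distrib_left)
  also have "\<dots> = amp V (embed (sym_gen (V - 1) a b f)) h \<alpha>"
    by (rule amp_embed[OF val, symmetric])
  finally show "amp V (embed (sym_gen (V - 1) a b f)) h \<alpha> = amp V (su_gen V a b (embed f)) h \<alpha>" by simp
qed

lemma ground_space_iso: "iso_to_symmetric_irrep V N (V - 1) (ground_space V N t (- l))"
  unfolding iso_to_symmetric_irrep_def
proof (intro exI[of _ embed] conjI ballI allI)
  have "embed ` sym_space N (V - 1) = ground_space V N t (- l)"
    using embed_mem_ground_space embed_surj by blast
  then show "bij_betw embed (sym_space N (V - 1)) (ground_space V N t (- l))"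
    using embed_inj by (simp add: bij_betw_def)
  show "embed (\<lambda>w. c * f w + g w) = (\<lambda>S. c * embed f S + embed g S)" for c f g
    by (auto simp: embed_def fun_eq_iff algebra_simps)
  show "embed (sym_gen (V - 1) a b f) = su_gen V a b (embed f)" if "a \<in> {1..N}" "b \<in> {1..N}" for a b f
    by (rule embed_sym_gen[OF that])
qed

lemma ground_energy_perron: "ground_energy V N t (- l)"
  unfolding ground_energy_def
proof (intro conjI ballI allI impI)
  \<comment> \<open>The constant tensor gives a nonzero ground state, as seen on the configuration
    with the hole at \<open>V\<close> and flavor 1 everywhere.\<close>
  define \<psi> where "\<psi> = embed (\<lambda>w. if w \<in> words N (V - 1) then 1 else 0)"
  have val: "valid_config V N V (\<lambda>_. 1)" using V2 N1 by (simp add: valid_config_def)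
  have "amp V \<psi> V (\<lambda>_. 1) = complex_of_real (\<phi> V)"
    unfolding \<psi>_def using amp_embed[OF val] word_mem_words[OF val] by simp
  then have "\<psi> (cfg V V (\<lambda>_. 1)) \<noteq> 0" using phi_pos[of V] V2 by (auto simp: amp_def)
  moreover have "(\<lambda>w. if w \<in> words N (V - 1) then 1 else 0) \<in> sym_space N (V - 1)"
    by (auto simp: sym_space_def words_comp_iff split: if_splits)
  then have "\<psi> \<in> ground_space V N t (- l)" unfolding \<psi>_def by (rule embed_mem_ground_space)
  ultimately show "\<exists>\<psi>\<in>H1 V N. (\<exists>S. \<psi> S \<noteq> 0) \<and> Hinf V N t \<psi> = (\<lambda>S. complex_of_real (- l) * \<psi> S)"
    unfolding ground_space_def by blast
next
  fix \<psi> e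
  assume "\<psi> \<in> H1 V N" and e: "(\<exists>S. \<psi> S \<noteq> 0) \<and> Hinf V N t \<psi> = (\<lambda>S. e * \<psi> S)"
  then have "cmod e \<le> l" using eigenvalue_bound by blast
  then show "- l \<le> Re e" using abs_Re_le_cmod[of e] by linarith
qed

end

text \<open>\<open>N > 2\<close> and \<open>V \<ge> N + 1\<close> give \<open>V \<ge> 4\<close>, so
  the polygon hypothesis becomes \<open>\<not> is_polygon V E\<close>.\<close>

lemma hole_system_of_graph:
  fixes V N :: nat and E :: "nat \<Rightarrow> nat \<Rightarrow> bool" and t :: "nat \<Rightarrow> nat \<Rightarrow> real"
  assumes "N > 2" and VN: "V \<ge> N + 1" and simple: "simple_graph V E"
    and tsym: "\<forall>i\<in>{1..V}. \<forall>j\<in>{1..V}. t i j = t j i"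
    and t: "\<forall>i\<in>{1..V}. \<forall>j\<in>{1..V}. (E i j \<longrightarrow> t i j > 0) \<and> (\<not> E i j \<longrightarrow> t i j = 0)"
    and nonsep: "non_separable V E" and th0: "\<not> is_theta0 V E"
    and poly: "\<not> (is_polygon V E \<and> V \<ge> 4)" and bip: "bipartite V E \<longrightarrow> V \<ge> N + 2"
  shows "hole_system V N E t"
proof
  show "V \<ge> 2" "N \<ge> 1" using assms by auto
  show "t i j = t j i" if "i \<in> {1..V}" "j \<in> {1..V}" for i j using tsym that by blast
  show "t i j > 0" if "i \<in> {1..V}" "j \<in> {1..V}" "E i j" for i j using t that by blast
  show "t i j = 0" if "i \<in> {1..V}" "j \<in> {1..V}" "\<not> E i j" for i j using t that by blast
  show irr: "\<not> E i i" if "i \<in> {1..V}" for i using simple that by (simp add: simple_graph_def)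
  show con: "connected_on E {1..V}" using nonsep by (simp add: non_separable_def)
  interpret symmetric_graph E "{1..V}"
    by unfold_locales (use simple in \<open>auto simp: simple_graph_def\<close>)
  interpret nonseparable_graph E "{1..V}"
  proof unfold_locales
    show "card {1..V} \<ge> 4" using assms by simp
    show "walk_connected {1..V}" by (rule walk_connected_of_connected_on[OF con])
    show "walk_connected ({1..V} - {v})" if "v \<in> {1..V}" for v
      using nonsep that by (intro walk_connected_of_connected_on) (simp add: non_separable_def)
  qed (use irr in blast)
  have poly': "\<not> is_polygon V E" using poly assms(1,2) by simp
  fix h \<alpha> h' \<alpha>'
  assume val: "valid_config V N h \<alpha>" "valid_config V N h' \<alpha>'"
    and cnt: "\<And>b. flavor_count V h \<alpha> b = flavor_count V h' \<alpha>' b"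
  have h: "h \<in> {1..V}" "h' \<in> {1..V}" using val by (auto simp: valid_config_def)
  have alt: "\<not> bipartite V E \<or> (\<exists>i\<in>{1..V} - {h'}. \<exists>j\<in>{1..V} - {h'}. i \<noteq> j \<and> \<alpha>' i = \<alpha>' j)"
  proof (cases "bipartite V E")
    case True
    then have "V \<ge> N + 2" using bip by blast
    \<comment> \<open>At least \<open>N + 1\<close> fermions share \<open>N\<close> flavors, so two
      of them agree.\<close>
    have "\<alpha>' ` ({1..V} - {h'}) \<subseteq> {1..N}" using val(2) by (auto simp: valid_config_def)
    then have "card (\<alpha>' ` ({1..V} - {h'})) \<le> N" using card_mono[of "{1..N}"] by force
    moreover have "card ({1..V} - {h'}) = V - 1" using h by simp
    ultimately have "\<not> inj_on \<alpha>' ({1..V} - {h'})"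
      using pigeonhole[of \<alpha>' "{1..V} - {h'}"] \<open>V \<ge> N + 2\<close> by simp
    then show ?thesis unfolding inj_on_def by blast
  qed simp
  obtain w where "walk {1..V} w" "hd w = h'" "last w = h"
    "\<And>i. i \<in> {1..V} - {h} \<Longrightarrow> \<alpha>' (cycle_of_list w i) = \<alpha> i"
    using hole_walk_exists[OF refl poly' th0 h _ alt, of \<alpha>] cnt unfolding flavor_count_def by blast
  then show "\<exists>w. w \<noteq> [] \<and> set w \<subseteq> {1..V} \<and> successively E w \<and> hd w = h' \<and> last w = h \<and>
      (\<forall>i\<in>{1..V} - {h}. \<alpha>' (cycle_of_list w i) = \<alpha> i)"
    unfolding walk_def by blast
qed

theorem theorem2:
  fixes V N :: nat and E :: "nat \<Rightarrow> nat \<Rightarrow> bool" and t :: "nat \<Rightarrow> nat \<Rightarrow> real"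
  assumes "N > 2"
    and "V \<ge> N + 1"
    and "simple_graph V E"
    and "\<forall>i\<in>{1..V}. \<forall>j\<in>{1..V}. t i j = t j i"
    and "\<forall>i\<in>{1..V}. \<forall>j\<in>{1..V}. (E i j \<longrightarrow> t i j > 0) \<and> (\<not> E i j \<longrightarrow> t i j = 0)"
    and "non_separable V E"
    and "\<not> is_theta0 V E"
    and "\<not> (is_polygon V E \<and> V \<ge> 4)"
    and "bipartite V E \<longrightarrow> V \<ge> N + 2"
  shows "(\<forall>m. (\<Sum>b\<in>{1..N}. m b) = V - 1 \<longrightarrow> connectivity V N t m) \<and>
         (\<exists>E0. ground_energy V N t E0 \<and>
               iso_to_symmetric_irrep V N (V - 1) (ground_space V N t E0))"
proof -
  interpret hole_system V N E t by (rule hole_system_of_graph[OF assms])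
  have ne: "{1..V} \<noteq> {}" using V2 by simp
  obtain \<phi> l where "\<And>i. i \<in> {1..V} \<Longrightarrow> \<phi> i > 0"
    "\<And>i. i \<in> {1..V} \<Longrightarrow> (\<Sum>j\<in>{1..V}. t j i * \<phi> j) = l * \<phi> i"
    by (rule perron_vector[OF finite_atLeastAtMost ne t_nonneg t_sym _ connected_weights])
      (use t_diag in auto)
  then interpret perron_hole_system V N E t \<phi> l by unfold_locales
  show ?thesis using connectivity_holds ground_energy_perron ground_space_iso by blast
qed

end
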